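(* Let $X$ be a compact metric space, $r:X\to X$ Borel measurable with $0<\#r^{-1}(x)<\infty$ for all $x$, $\mu$ a strongly invariant Borel probability measure on $X$, and $m_0\in L^\infty(X,\mu)$ with $\frac{1}{\#r^{-1}(x)}\sum_{r(y)=x}|m_0(y)|^2=1$ for all $x$, and suppose $m_0$ is non-singular, i.e. $\mu(\{m_0=0\})=0$. Let $(\mathcal H,U,\pi,\varphi)$ be the realization on the solenoid described in the context. The following are equivalent: (i) the wavelet representation is irreducible, i.e. the only bounded operators on $\mathcal H$ commuting with $U$ and with all $\pi(f)$, $f\in L^\infty(X)$, are scalar multiples of the identity; (ii) the automorphism $r_\infty$ on $(X_\infty,\mu_\infty)$ is ergodic; (iii) the only bounded measurable fixed points of the transfer operator $R_{m_0}$ are the constants; (iv) there is no $p>1$ and no non-constant $h\in L^p(X,\mu)$ with $R_{m_0}h=h$ and $\sup_{n\in\mathbb N}\int_X|m_0^{(n)}(x)|^2|h(x)|^p\,d\mu(x)<\infty$, where $m_0^{(n)}(x)=m_0(x)m_0(r(x))\cdots m_0(r^{n-1}(x))$; (v) if $\varphi'\in\mathcal H$ satisfies $U\varphi'=\pi(m_0)\varphi'$, then $\varphi'$ is a constant multiple of $\varphi$.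
   Context: Strongly invariant: $\int f\,d\mu=\int\frac{1}{\#r^{-1}(x)}\sum_{r(y)=x}f(y)\,d\mu(x)$ for all $f\in C(X)$. Transfer operator: $R_{m_0}f(x)=\frac{1}{\#r^{-1}(x)}\sum_{r(y)=x}|m_0(y)|^2f(y)$. Solenoid: $X_\infty=\{(x_0,x_1,\dots)\in X^{\mathbb N}: r(x_{n+1})=x_n\ \forall n\}$ with the cylinder $\sigma$-algebra, $r_\infty(x_0,x_1,\dots)=(r(x_0),x_0,x_1,\dots)$, $\theta_0(x_0,x_1,\dots)=x_0$. With $W(x)=|m_0(x)|^2/\#r^{-1}(r(x))$, the path measure $P_x$ on $\Omega_x=\{(x_n)\in X_\infty: x_0=x\}$ is $P_x(\{x_1=z_1,\dots,x_n=z_n\})=W(z_1)\cdots W(z_n)$, and $\int f\,d\mu_\infty=\int_X\int_{\Omega_x}f\,dP_x\,d\mu(x)$. Then $\mathcal H=L^2(X_\infty,\mu_\infty)$, $Uf=(m_0\circ\theta_0)(f\circ r_\infty)$ (unitary), $\pi(f)g=(f\circ\theta_0)g$, $\varphi=1$; this is the wavelet representation associated to $m_0$. *)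

theory Defs
  imports "HOL-Probability.Probability"
begin

definition fib :: "('a \<Rightarrow> 'a) \<Rightarrow> 'a \<Rightarrow> 'a set" where
  "fib r x = r -` {x}"

definition strongly_invariant :: "('a::metric_space \<Rightarrow> 'a) \<Rightarrow> 'a measure \<Rightarrow> bool" where
  "strongly_invariant r \<mu> \<longleftrightarrow>
     (\<forall>f :: 'a \<Rightarrow> complex. continuous_on UNIV f \<longrightarrow>
        (\<integral>x. f x \<partial>\<mu>) = (\<integral>x. (\<Sum>y\<in>fib r x. f y) / of_nat (card (fib r x)) \<partial>\<mu>))"

definition transfer_op :: "('a \<Rightarrow> 'a) \<Rightarrow> ('a \<Rightarrow> complex) \<Rightarrow> ('a \<Rightarrow> complex) \<Rightarrow> 'a \<Rightarrow> complex" where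
  "transfer_op r m0 h x =
     (\<Sum>y\<in>fib r x. of_real ((cmod (m0 y))\<^sup>2) * h y) / of_nat (card (fib r x))"

definition Wt :: "('a \<Rightarrow> 'a) \<Rightarrow> ('a \<Rightarrow> complex) \<Rightarrow> 'a \<Rightarrow> real" where
  "Wt r m0 y = (cmod (m0 y))\<^sup>2 / real (card (fib r (r y)))"

definition m0_iter :: "('a \<Rightarrow> 'a) \<Rightarrow> ('a \<Rightarrow> complex) \<Rightarrow> nat \<Rightarrow> 'a \<Rightarrow> complex" where
  "m0_iter r m0 n x = (\<Prod>k<n. m0 ((r ^^ k) x))"

definition ess_bounded :: "'a measure \<Rightarrow> ('a \<Rightarrow> complex) \<Rightarrow> bool" where
  "ess_bounded M g \<longleftrightarrow> g \<in> borel_measurable M \<and> (\<exists>B. AE x in M. cmod (g x) \<le> B)"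

definition solenoid :: "('a \<Rightarrow> 'a) \<Rightarrow> (nat \<Rightarrow> 'a) set" where
  "solenoid r = {\<omega>. \<forall>n. r (\<omega> (Suc n)) = \<omega> n}"

definition solenoid_space :: "('a::topological_space \<Rightarrow> 'a) \<Rightarrow> (nat \<Rightarrow> 'a) measure" where
  "solenoid_space r = restrict_space (PiM UNIV (\<lambda>_. borel)) (solenoid r)"

definition r_inf :: "('a \<Rightarrow> 'a) \<Rightarrow> (nat \<Rightarrow> 'a) \<Rightarrow> (nat \<Rightarrow> 'a)" where
  "r_inf r \<omega> = (\<lambda>n. case n of 0 \<Rightarrow> r (\<omega> 0) | Suc k \<Rightarrow> \<omega> k)"

definition theta0 :: "(nat \<Rightarrow> 'a) \<Rightarrow> 'a" where
  "theta0 \<omega> = \<omega> 0"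

text \<open>Path weight: \<open>pathw [A1,...,An] x = P_x({x1\<in>A1,...,xn\<in>An})\<close>, where
  \<open>P_x({x1=z1,...,xn=zn}) = W(z1)\<cdots>W(zn)\<close>.\<close>
fun pathw :: "('a \<Rightarrow> 'a) \<Rightarrow> ('a \<Rightarrow> real) \<Rightarrow> 'a set list \<Rightarrow> 'a \<Rightarrow> real" where
  "pathw r W [] x = 1"
| "pathw r W (A # As) x = (\<Sum>y\<in>fib r x \<inter> A. W y * pathw r W As y)"

definition cylinder :: "('a \<Rightarrow> 'a) \<Rightarrow> 'a set \<Rightarrow> 'a set list \<Rightarrow> (nat \<Rightarrow> 'a) set" where
  "cylinder r A0 As = {\<omega> \<in> solenoid r. \<omega> 0 \<in> A0 \<and> (\<forall>i<length As. \<omega> (Suc i) \<in> As ! i)}"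

text \<open>The measure \<open>\<mu>\<^sub>\<infinity>\<close>: the measure on the solenoid with
  \<open>\<mu>\<^sub>\<infinity>({x0\<in>A0,x1\<in>A1,...,xn\<in>An}) = \<integral>\<^sub>A0 P_x({x1\<in>A1,...,xn\<in>An}) d\<mu>(x)\<close>
  (this determines it uniquely; it is \<open>\<integral>\<^sub>X \<integral>\<^sub>\<Omega>x f dP_x d\<mu>(x)\<close>).\<close>
definition mu_inf :: "('a::topological_space \<Rightarrow> 'a) \<Rightarrow> 'a measure \<Rightarrow> ('a \<Rightarrow> complex) \<Rightarrow> (nat \<Rightarrow> 'a) measure" where
  "mu_inf r \<mu> m0 = (SOME N. sets N = sets (solenoid_space r) \<and> space N = solenoid r \<and>
     (\<forall>A0 As. A0 \<in> sets borel \<longrightarrow> set As \<subseteq> sets borel \<longrightarrow>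
        emeasure N (cylinder r A0 As) = (\<integral>\<^sup>+x\<in>A0. ennreal (pathw r (Wt r m0) As x) \<partial>\<mu>)))"

definition Uop :: "('a \<Rightarrow> 'a) \<Rightarrow> ('a \<Rightarrow> complex) \<Rightarrow> ((nat \<Rightarrow> 'a) \<Rightarrow> complex) \<Rightarrow> (nat \<Rightarrow> 'a) \<Rightarrow> complex" where
  "Uop r m0 f \<omega> = m0 (theta0 \<omega>) * f (r_inf r \<omega>)"

definition piop :: "('a \<Rightarrow> complex) \<Rightarrow> ((nat \<Rightarrow> 'a) \<Rightarrow> complex) \<Rightarrow> (nat \<Rightarrow> 'a) \<Rightarrow> complex" where
  "piop g f \<omega> = g (theta0 \<omega>) * f \<omega>"

definition L2 :: "'b measure \<Rightarrow> ('b \<Rightarrow> complex) set" where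
  "L2 N = {f. f \<in> borel_measurable N \<and> integrable N (\<lambda>x. (cmod (f x))\<^sup>2)}"

definition bounded_op :: "'b measure \<Rightarrow> (('b \<Rightarrow> complex) \<Rightarrow> ('b \<Rightarrow> complex)) \<Rightarrow> bool" where
  "bounded_op N T \<longleftrightarrow>
     (\<forall>f\<in>L2 N. T f \<in> L2 N) \<and>
     (\<forall>f\<in>L2 N. \<forall>g\<in>L2 N. (AE x in N. f x = g x) \<longrightarrow> (AE x in N. T f x = T g x)) \<and>
     (\<forall>f\<in>L2 N. \<forall>g\<in>L2 N. \<forall>a b. AE x in N. T (\<lambda>y. a * f y + b * g y) x = a * T f x + b * T g x) \<and>
     (\<exists>C. \<forall>f\<in>L2 N. (\<integral>x. (cmod (T f x))\<^sup>2 \<partial>N) \<le> C * (\<integral>x. (cmod (f x))\<^sup>2 \<partial>N))"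

definition wavelet_irreducible :: "('a::topological_space \<Rightarrow> 'a) \<Rightarrow> 'a measure \<Rightarrow> ('a \<Rightarrow> complex) \<Rightarrow> bool" where
  "wavelet_irreducible r \<mu> m0 \<longleftrightarrow> (let N = mu_inf r \<mu> m0 in
     \<forall>T. bounded_op N T \<and>
          (\<forall>f\<in>L2 N. AE \<omega> in N. T (Uop r m0 f) \<omega> = Uop r m0 (T f) \<omega>) \<and>
          (\<forall>g. ess_bounded \<mu> g \<longrightarrow> (\<forall>f\<in>L2 N. AE \<omega> in N. T (piop g f) \<omega> = piop g (T f) \<omega>))
        \<longrightarrow> (\<exists>c. \<forall>f\<in>L2 N. AE \<omega> in N. T f \<omega> = c * f \<omega>))"

definition ergodic_map :: "'b measure \<Rightarrow> ('b \<Rightarrow> 'b) \<Rightarrow> bool" where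
  "ergodic_map N T \<longleftrightarrow>
     (\<forall>A\<in>sets N. T -` A \<inter> space N = A \<longrightarrow> emeasure N A = 0 \<or> emeasure N A = 1)"

end

theory Submission
  imports Defs
begin

text \<open>
  Strong invariance does double duty: a nonzero integral forces the fibre average of a continuous
  function to be Borel, and by approximation fibre averages of Borel functions are Borel, so no
  measurable selection is needed. The path measure is then an Ionescu-Tulcea measure, and
  \<open>N = \<mu>\<^sub>\<infinity>\<close> satisfies \<open>\<integral> |m\<^sub>0 \<circ> \<theta>\<^sub>0|\<^sup>2 (f \<circ> r\<^sub>\<infinity>) dN = \<integral> f dN\<close>.
  Since \<open>\<omega> m\<close> determines \<open>\<omega> n\<close> for \<open>n \<le> m\<close>, the events \<open>\<omega> n \<in> B\<close> form a generating \<open>\<pi>\<close>-system,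
  on which every identity is checked.

  An operator in the commutant commutes with multiplication by functions of each coordinate, hence
  is multiplication by its value at the constant function 1, which is \<open>r\<^sub>\<infinity>\<close>-invariant.
  Invariant sets and bounded harmonic functions correspond by conditioning on \<open>\<theta>\<^sub>0\<close> and, backwards,
  by the almost sure limit, along a subsequence, of the \<open>L\<^sup>2\<close>-martingale \<open>h (\<omega> n)\<close>. An \<open>L\<^sup>p\<close>-bounded harmonic \<open>h\<close> is
  reduced to a bounded one through the least harmonic majorant of \<open>|h|\<close>.
\<close>

text \<open>Harmonicity and invariance hold only almost everywhere, so null sets must survive the
  dynamics. Under \<open>tr\<close> this is \<open>AE_fib\<close>: the fibre average of the
  indicator of a null set has integral zero. Under \<open>r_inf r\<close> it is not automatic,
  because the map carries the weighted measure \<open>w (\<omega> 0) dN\<close>, not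
  \<open>N\<close>, to \<open>N\<close>; the weight can be divided out only because
  \<open>m0\<close> vanishes on a null set. The same division cancels \<open>m0\<close> in equations
  between vectors. The core is an ennreal-valued calculus of the Markov operator \<open>tr\<close>:
  sums, monotone limits and Fatou need no integrability, and finite fibres let \<open>tr\<close>
  pass to pointwise limits. Signs and complex values enter late, through real and imaginary parts
  and an affine map into [0,1]. For L^p functions the obstacle is that truncation destroys
  harmonicity: the modulus of a harmonic function is only subharmonic, its minimum with a constant
  only superharmonic. Iterating \<open>tr\<close> restores it, since both sequences are monotone
  with harmonic limits. The loss by truncation is controlled by tails that are small uniformly in
  time, and p > 1 is used exactly there.\<close>

lemma L2_iff: "f \<in> L2 M \<longleftrightarrow> f \<in> borel_measurable M \<and> (\<integral>\<^sup>+x. ennreal ((cmod (f x))\<^sup>2) \<partial>M) < \<infinity>"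
  by (auto simp: L2_def integrable_iff_bounded)

lemma L2_measurable: "f \<in> L2 M \<Longrightarrow> f \<in> borel_measurable M"
  by (simp add: L2_def)

lemma L2_bound:
  assumes g: "g \<in> L2 M" and f: "f \<in> borel_measurable M" and le: "AE x in M. cmod (f x) \<le> K * cmod (g x)"
  shows "f \<in> L2 M"
proof -
  have "integrable M (\<lambda>x. K\<^sup>2 * (cmod (g x))\<^sup>2)" using g by (simp add: L2_def)
  moreover have "AE x in M. norm ((cmod (f x))\<^sup>2) \<le> norm (K\<^sup>2 * (cmod (g x))\<^sup>2)"
    using le
  proof eventually_elim
    fix x assume "cmod (f x) \<le> K * cmod (g x)"
    then have "(cmod (f x))\<^sup>2 \<le> (K * cmod (g x))\<^sup>2" by (rule power_mono) simp
    then show "norm ((cmod (f x))\<^sup>2) \<le> norm (K\<^sup>2 * (cmod (g x))\<^sup>2)" by (simp add: power_mult_distrib)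
  qed
  ultimately have "integrable M (\<lambda>x. (cmod (f x))\<^sup>2)"
    using f by (elim Bochner_Integration.integrable_bound[rotated 2]) simp_all
  with f show ?thesis by (simp add: L2_def)
qed

lemma ennreal_le_add_minus: "a \<le> b + (a - b)" for a b :: ennreal
  using ennreal_minus_le_iff[of a b "a - b"] by simp

locale wavelet_setup =
  fixes r :: "'a::metric_space \<Rightarrow> 'a" and \<mu> :: "'a measure" and m0 :: "'a \<Rightarrow> complex"
  assumes compact_space: "compact (UNIV :: 'a set)"
    and r_borel [measurable]: "r \<in> borel_measurable borel"
    and fib_finite_nonempty: "\<forall>x. finite (fib r x) \<and> fib r x \<noteq> {}"
    and prob_space_mu: "prob_space \<mu>"
    and sets_mu [measurable_cong, simp]: "sets \<mu> = sets borel"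
    and strongly_inv: "strongly_invariant r \<mu>"
    and m0_bounded: "ess_bounded \<mu> m0"
    and m0_normalized: "\<forall>x. (\<Sum>y\<in>fib r x. (cmod (m0 y))\<^sup>2) / real (card (fib r x)) = 1"
    and m0_nonsingular: "emeasure \<mu> {x. m0 x = 0} = 0"
begin

sublocale mu: prob_space \<mu> by (rule prob_space_mu)

lemma space_mu [simp]: "space \<mu> = UNIV"
  using sets_eq_imp_space_eq[OF sets_mu] by simp

lemma emeasure_mu_UNIV [simp]: "emeasure \<mu> UNIV = 1" and measure_mu_UNIV [simp]: "measure \<mu> UNIV = 1"
  using mu.emeasure_space_1 mu.prob_space by simp_all

lemma borel_measurable_mu [simp]: "borel_measurable \<mu> = borel_measurable borel"
  by (rule measurable_cong_sets) simp_all

lemma m0_borel [measurable]: "m0 \<in> borel_measurable borel"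
  using m0_bounded by (simp add: ess_bounded_def)

lemma finite_fib [simp]: "finite (fib r x)" and fib_nonempty [simp]: "fib r x \<noteq> {}"
  using fib_finite_nonempty by auto

lemma card_fib_pos [simp]: "0 < card (fib r x)"
  by (simp add: card_gt_0_iff)

lemma in_fib_iff [simp]: "y \<in> fib r x \<longleftrightarrow> r y = x"
  by (simp add: fib_def)

subsection \<open>Averages over fibres\<close>

definition avg :: "('a \<Rightarrow> ennreal) \<Rightarrow> 'a \<Rightarrow> ennreal" where
  "avg f x = (\<Sum>y\<in>fib r x. ennreal (1 / real (card (fib r x))) * f y)"

lemma avg_const: "avg (\<lambda>_. c) x = c"
  by (simp add: avg_def flip: ennreal_of_nat_eq_real_of_nat mult.assoc)
     (simp add: ennreal_of_nat_eq_real_of_nat flip: ennreal_mult'')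

lemma avg_add: "avg (\<lambda>y. f y + g y) x = avg f x + avg g x"
  by (simp add: avg_def distrib_left sum.distrib)

lemma avg_cmult: "avg (\<lambda>y. c * f y) x = c * avg f x"
  by (simp add: avg_def sum_distrib_left mult_ac)

lemma avg_comp: "avg (\<lambda>y. c (r y) * f y) x = c x * avg f x"
  by (simp add: avg_def sum_distrib_left mult_ac)

lemma avg_mono: "(\<And>y. f y \<le> g y) \<Longrightarrow> avg f x \<le> avg g x"
  unfolding avg_def by (intro sum_mono mult_left_mono) auto

lemma avg_tendsto:
  assumes "\<And>y. (\<lambda>n. f n y) \<longlonglongrightarrow> g y"
  shows "(\<lambda>n. avg (f n) x) \<longlonglongrightarrow> avg g x"
  unfolding avg_def using assms by (intro tendsto_sum ennreal_tendsto_cmult) auto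

lemma avg_ennreal:
  assumes "\<And>y. 0 \<le> f y"
  shows "avg (\<lambda>y. ennreal (f y)) x = ennreal ((\<Sum>y\<in>fib r x. f y) / real (card (fib r x)))"
proof -
  have "avg (\<lambda>y. ennreal (f y)) x = (\<Sum>y\<in>fib r x. ennreal (f y / real (card (fib r x))))"
    unfolding avg_def using assms by (intro sum.cong refl) (simp flip: ennreal_mult)
  also have "\<dots> = ennreal (\<Sum>y\<in>fib r x. f y / real (card (fib r x)))"
    using assms by (intro sum_ennreal) simp
  finally show ?thesis by (simp add: sum_divide_distrib)
qed

text \<open>Measurability of the fibre average and invariance of the integral travel together: for
  continuous functions the first is extracted from the second, and every approximation step
  preserves both.\<close>

definition avg_ok :: "('a \<Rightarrow> ennreal) \<Rightarrow> bool" where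
  "avg_ok f \<longleftrightarrow> f \<in> borel_measurable borel \<and> avg f \<in> borel_measurable borel \<and>
     (\<integral>\<^sup>+x. avg f x \<partial>\<mu>) = (\<integral>\<^sup>+x. f x \<partial>\<mu>)"

(* The Bochner integral of a non-measurable function is 0, so a nonzero integral yields measurability. *)
lemma avg_ok_continuous:
  assumes f: "continuous_on UNIV f" and nn: "\<And>x. 0 \<le> f x"
  shows "avg_ok (\<lambda>x. ennreal (f x))"
proof -
  define E where "E f x = (\<Sum>y\<in>fib r x. f y) / real (card (fib r x))" for f :: "'a \<Rightarrow> real" and x
  have fm [measurable]: "f \<in> borel_measurable borel" using f by (rule borel_measurable_continuous_onI)
  have "bounded (range f)" using compact_continuous_image[OF f compact_space] by (rule compact_imp_bounded)
  then obtain B where B: "\<And>x. \<bar>f x\<bar> \<le> B" by (auto simp: bounded_iff)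
  have int_f: "integrable \<mu> f"
    using B by (intro mu.integrable_const_bound[where B = B]) auto
  \<comment> \<open>The summand 1 forces the integral to be at least 1, hence nonzero, also when
    \<open>f\<close> itself integrates to 0.\<close>
  let ?g = "\<lambda>x. complex_of_real (f x + 1)"
  have "continuous_on UNIV ?g" using f by (intro continuous_intros)
  then have "(\<integral>x. ?g x \<partial>\<mu>) = (\<integral>x. (\<Sum>y\<in>fib r x. ?g y) / of_nat (card (fib r x)) \<partial>\<mu>)"
    using strongly_inv by (auto simp: strongly_invariant_def)
  also have "(\<lambda>x. (\<Sum>y\<in>fib r x. ?g y) / of_nat (card (fib r x))) = (\<lambda>x. complex_of_real (E f x + 1))"
    by (auto simp: E_def sum.distrib add_divide_distrib fun_eq_iff)
  finally have eq: "(\<integral>x. f x + 1 \<partial>\<mu>) = (\<integral>x. E f x + 1 \<partial>\<mu>)"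
    by (metis integral_complex_of_real of_real_eq_iff)
  have "(\<integral>x. f x + 1 \<partial>\<mu>) \<ge> 1"
    using int_f nn by simp
  then have "integrable \<mu> (\<lambda>x. E f x + 1)"
    using eq not_integrable_integral_eq[of \<mu> "\<lambda>x. E f x + 1"] by fastforce
  then have int_E: "integrable \<mu> (E f)"
    using Bochner_Integration.integrable_diff[of \<mu> "\<lambda>x. E f x + 1" "\<lambda>x. 1"] by simp
  then have "(\<integral>x. f x \<partial>\<mu>) = (\<integral>x. E f x \<partial>\<mu>)"
    using eq int_f int_E by simp
  moreover have "0 \<le> E f x" for x using nn by (auto simp: E_def intro!: divide_nonneg_nonneg sum_nonneg)
  moreover have "avg (\<lambda>x. ennreal (f x)) = (\<lambda>x. ennreal (E f x))"
    using nn by (auto simp: avg_ennreal E_def)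
  moreover have "E f \<in> borel_measurable borel" using int_E by auto
  ultimately show ?thesis
    using int_E int_f nn by (auto simp: avg_ok_def nn_integral_eq_integral)
qed

lemma avg_ok_incseq:
  assumes ok: "\<And>n. avg_ok (f n)" and inc: "incseq f" and lim: "\<And>x. (\<lambda>n. f n x) \<longlonglongrightarrow> g x"
  shows "avg_ok g"
proof -
  have [measurable]: "f n \<in> borel_measurable borel" "avg (f n) \<in> borel_measurable borel" for n
    using ok[of n] by (auto simp: avg_ok_def)
  have [measurable]: "g \<in> borel_measurable borel"
    by (rule borel_measurable_LIMSEQ_order[OF lim]) simp
  have limE: "(\<lambda>n. avg (f n) x) \<longlonglongrightarrow> avg g x" for x
    using lim by (rule avg_tendsto)
  have [measurable]: "avg g \<in> borel_measurable borel"
    by (rule borel_measurable_LIMSEQ_order[OF limE]) simp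
  have "(\<lambda>n. \<integral>\<^sup>+x. f n x \<partial>\<mu>) \<longlonglongrightarrow> (\<integral>\<^sup>+x. g x \<partial>\<mu>)"
    using inc lim by (intro nn_integral_LIMSEQ) auto
  moreover have "incseq (\<lambda>n. avg (f n))"
    using inc by (auto simp: incseq_def le_fun_def intro!: avg_mono)
  then have "(\<lambda>n. \<integral>\<^sup>+x. avg (f n) x \<partial>\<mu>) \<longlonglongrightarrow> (\<integral>\<^sup>+x. avg g x \<partial>\<mu>)"
    using limE by (intro nn_integral_LIMSEQ) auto
  moreover have "(\<integral>\<^sup>+x. avg (f n) x \<partial>\<mu>) = (\<integral>\<^sup>+x. f n x \<partial>\<mu>)" for n
    using ok[of n] by (auto simp: avg_ok_def)
  ultimately show ?thesis
    using LIMSEQ_unique by (auto simp: avg_ok_def)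
qed

lemma avg_ok_const: "avg_ok (\<lambda>_. c)"
  by (simp add: avg_ok_def avg_const cong: measurable_cong)

lemma avg_ok_add: "avg_ok f \<Longrightarrow> avg_ok g \<Longrightarrow> avg_ok (\<lambda>x. f x + g x)"
  by (auto simp: avg_ok_def avg_add nn_integral_add fun_eq_iff cong: measurable_cong)

lemma avg_ok_cmult: "avg_ok f \<Longrightarrow> avg_ok (\<lambda>x. c * f x)"
  by (auto simp: avg_ok_def avg_cmult nn_integral_cmult cong: measurable_cong)

text \<open>Closure under complements for the Dynkin argument. Subtraction in ennreal is harmless
  here: \<open>f\<close> and \<open>avg f\<close> are at most 1, and the total mass is 1.\<close>

lemma avg_ok_compl:
  assumes f: "avg_ok f" and g: "g \<in> borel_measurable borel" and fg: "\<And>x. f x + g x = 1"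
  shows "avg_ok g"
proof -
  have [measurable]: "f \<in> borel_measurable borel" "avg f \<in> borel_measurable borel" "g \<in> borel_measurable borel"
    using f g by (auto simp: avg_ok_def)
  have int: "(\<integral>\<^sup>+x. avg f x \<partial>\<mu>) = (\<integral>\<^sup>+x. f x \<partial>\<mu>)"
    using f by (simp add: avg_ok_def)
  have le: "f x \<le> 1" "avg f x \<le> 1" for x
  proof -
    show "f x \<le> 1" for x using fg[of x] by (metis le_iff_add)
    then show "avg f x \<le> 1" using avg_mono[of f "\<lambda>_. 1" x] by (simp add: avg_const)
  qed
  have gd: "g x = 1 - f x" for x
    using fg[of x] le(1)[of x] by (metis ennreal_add_diff_cancel_left top.not_eq_extremum ennreal_one_less_top le_less_trans less_irrefl)
  have "avg f x + avg g x = 1" for x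
    using fg by (simp add: avg_const flip: avg_add)
  then have agd: "avg g x = 1 - avg f x" for x
    using le(2)[of x] by (metis ennreal_add_diff_cancel_left top.not_eq_extremum ennreal_one_less_top le_less_trans less_irrefl)
  have fin: "(\<integral>\<^sup>+x. f x \<partial>\<mu>) \<noteq> \<infinity>"
  proof -
    have "(\<integral>\<^sup>+x. f x \<partial>\<mu>) \<le> (\<integral>\<^sup>+x. 1 \<partial>\<mu>)" using le by (intro nn_integral_mono) auto
    also have "\<dots> < \<infinity>" by simp
    finally show ?thesis by simp
  qed
  have "(\<integral>\<^sup>+x. g x \<partial>\<mu>) = (\<integral>\<^sup>+x. 1 \<partial>\<mu>) - (\<integral>\<^sup>+x. f x \<partial>\<mu>)"
    unfolding gd using fin le by (intro nn_integral_diff) auto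
  also have "\<dots> = (\<integral>\<^sup>+x. avg g x \<partial>\<mu>)"
    unfolding agd int[symmetric] using fin int le by (intro nn_integral_diff[symmetric]) auto
  finally show ?thesis
    using agd by (simp add: avg_ok_def cong: measurable_cong)
qed

lemma avg_ok_sum: "finite I \<Longrightarrow> (\<And>i. i \<in> I \<Longrightarrow> avg_ok (f i)) \<Longrightarrow> avg_ok (\<lambda>x. \<Sum>i\<in>I. f i x)"
  by (induction I rule: finite_induct) (auto intro: avg_ok_const avg_ok_add)

lemma avg_ok_open:
  assumes "open U" shows "avg_ok (indicator U)"
\<comment> \<open>If \<open>U\<close> is everything, its complement is empty, \<open>infdist\<close>
  to it is 0, and the approximants below would vanish identically.\<close>
proof (cases "U = UNIV")
  case True then show ?thesis using avg_ok_const[of 1] by (simp add: indicator_def[abs_def])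
next
  case False
  then have ne: "- U \<noteq> {}" by auto
  have cl: "closed (- U)" using assms by auto
  \<comment> \<open>Continuous functions that vanish off \<open>U\<close> and increase to 1 at each
    point of \<open>U\<close>, because the distance to the closed complement is positive
    there.\<close>
  let ?f = "\<lambda>n x. min 1 (real n * infdist x (- U))"
  show ?thesis
  proof (rule avg_ok_incseq)
    show "avg_ok (\<lambda>x. ennreal (?f n x))" for n
      by (intro avg_ok_continuous continuous_intros) (auto simp: infdist_nonneg)
    show "incseq (\<lambda>n x. ennreal (?f n x))"
      by (auto simp: incseq_def le_fun_def intro!: ennreal_leI min.mono mult_right_mono infdist_nonneg)
    show "(\<lambda>n. ennreal (?f n x)) \<longlonglongrightarrow> indicator U x" for x
    proof (cases "x \<in> U")
      case True
      then have pos: "infdist x (- U) > 0"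
        using in_closed_iff_infdist_zero[OF cl ne] infdist_nonneg[of x "- U"] by (auto simp: less_le)
      obtain n where n: "real n * infdist x (- U) > 1" using reals_Archimedean3[OF pos] by blast
      have "?f k x = 1" if "k \<ge> n" for k
      proof -
        have "real n * infdist x (- U) \<le> real k * infdist x (- U)"
          using that pos by (intro mult_right_mono) auto
        with n show ?thesis by linarith
      qed
      then have "eventually (\<lambda>k. ennreal (?f k x) = indicator U x) sequentially"
        using True by (auto simp: eventually_sequentially)
      then show ?thesis by (rule tendsto_eventually)
    next
      case False
      then show ?thesis using in_closed_iff_infdist_zero[OF cl ne] by simp
    qed
  qed
qed

text \<open>Open sets form a generating system stable under intersection, so complements and
  disjoint unions suffice. Disjointness is what makes the increasing partial sums converge to the
  indicator of the union.\<close>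

lemma avg_ok_indicator:
  assumes "A \<in> sets borel" shows "avg_ok (indicator A)"
proof -
  have "Int_stable {S::'a set. open S}" by (auto simp: Int_stable_def)
  moreover have "{S::'a set. open S} \<subseteq> Pow UNIV" by auto
  moreover have "A \<in> sigma_sets UNIV {S. open S}" using assms by (simp add: sets_borel)
  ultimately show ?thesis
  proof (induction rule: sigma_sets_induct_disjoint)
    case (basic A) then show ?case by (auto intro: avg_ok_open)
  next
    case empty show ?case using avg_ok_const[of 0] by (simp add: indicator_def[abs_def])
  next
    case (compl A)
    from compl(1) have [measurable]: "A \<in> sets borel" by (simp add: sets_borel)
    show ?case
      by (rule avg_ok_compl[OF compl(2)]) (auto split: split_indicator)
  next
    case (union A)
    define S where "S n x = (\<Sum>i<n. indicator (A i) x :: ennreal)" for n :: nat and x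
    have S_Suc: "S (Suc n) x = S n x + indicator (A n) x" for n x
      by (simp add: S_def)
    have "S n x \<le> S (Suc n) x" for n x
      unfolding S_Suc by (rule add_increasing2) auto
    then have inc: "incseq S" by (intro incseq_SucI le_funI)
    have lim: "(\<lambda>n. S n x) \<longlonglongrightarrow> indicator (\<Union>i. A i) x" for x
      unfolding S_def suminf_indicator[OF union(1), of x, symmetric]
      by (rule summable_LIMSEQ) simp
    have "avg_ok (S n)" for n
      unfolding S_def[abs_def] using union(3) by (intro avg_ok_sum) auto
    then show ?case using inc lim by (rule avg_ok_incseq)
  qed
qed

lemma avg_ok_borel:
  assumes "f \<in> borel_measurable borel" shows "avg_ok f"
  using assms
proof (induction rule: borel_measurable_induct)
  case (cong f g)
  then have "f = g" by (simp add: fun_eq_iff)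
  with cong show ?case by simp
next
  case (set A) then show ?case by (intro avg_ok_indicator) simp
next
  case (mult u c) show ?case by (rule avg_ok_cmult) fact
next
  case (add u v) show ?case by (rule avg_ok_add) fact+
next
  case (seq U)
  show ?case
  proof (rule avg_ok_incseq)
    show "(\<lambda>n. U n x) \<longlonglongrightarrow> (SUP i. U i) x" for x
      using LIMSEQ_SUP[of "\<lambda>n. U n x"] seq(3) by (simp add: incseq_def le_fun_def image_comp)
  qed (use seq in auto)
qed

lemma avg_borel [measurable]: "f \<in> borel_measurable borel \<Longrightarrow> avg f \<in> borel_measurable borel"
  using avg_ok_borel by (auto simp: avg_ok_def)

lemma nn_integral_avg: "f \<in> borel_measurable borel \<Longrightarrow> (\<integral>\<^sup>+x. avg f x \<partial>\<mu>) = (\<integral>\<^sup>+x. f x \<partial>\<mu>)"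
  using avg_ok_borel by (auto simp: avg_ok_def)

subsection \<open>The transfer operator\<close>

text \<open>Cover the exceptional set by a null set: the average of its indicator has integral 0 and
  so is 0 almost everywhere, and every point of a fibre has positive weight in the average. This
  licenses the use of almost-everywhere equations under \<open>tr\<close>.\<close>

lemma AE_fib:
  assumes "AE x in \<mu>. P x"
  shows "AE x in \<mu>. \<forall>y. r y = x \<longrightarrow> P y"
proof -
  from assms obtain N where N: "{x \<in> space \<mu>. \<not> P x} \<subseteq> N" "emeasure \<mu> N = 0" "N \<in> sets \<mu>"
    by (rule AE_E)
  have [measurable]: "N \<in> sets borel" using N by simp
  have "(\<integral>\<^sup>+x. avg (indicator N) x \<partial>\<mu>) = 0"
    using N by (subst nn_integral_avg) simp_all
  then have "AE x in \<mu>. avg (indicator N) x = 0"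
    by (subst (asm) nn_integral_0_iff_AE) simp_all
  then show ?thesis
  proof (eventually_elim, intro allI impI)
    fix x y assume *: "avg (indicator N) x = 0" "r y = x"
    then have "ennreal (1 / real (card (fib r x))) * indicator N y = 0"
      unfolding avg_def by (subst (asm) sum_eq_0_iff) auto
    moreover have "ennreal (1 / real (card (fib r x))) \<noteq> 0" using card_fib_pos[of x] by (simp add: ennreal_eq_0_iff)
    ultimately have "y \<notin> N" by (auto split: split_indicator_asm)
    then show "P y" using N by auto
  qed
qed

definition w :: "'a \<Rightarrow> ennreal" where "w y = ennreal ((cmod (m0 y))\<^sup>2)"

text \<open>\<open>transfer_op\<close> on nonnegative functions, with the cardinality absorbed in
  \<open>Wt\<close>. It is the transition operator of the walk that moves from x to a preimage y
  with probability W(y).\<close>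

definition tr :: "('a \<Rightarrow> ennreal) \<Rightarrow> 'a \<Rightarrow> ennreal" where
  "tr f x = (\<Sum>y\<in>fib r x. ennreal (Wt r m0 y) * f y)"

lemma w_borel [measurable]: "w \<in> borel_measurable borel"
  unfolding w_def[abs_def] by measurable

lemma w_finite [simp]: "w x < \<top>" "w x \<noteq> \<top>"
  by (simp_all add: w_def)

lemma w_nonzero: "AE x in \<mu>. w x \<noteq> 0"
  using m0_nonsingular by (intro AE_I[where N = "{x. m0 x = 0}"]) (auto simp: w_def)

lemma tr_eq_avg: "tr f x = avg (\<lambda>y. w y * f y) x"
proof -
  have "ennreal (Wt r m0 y) = ennreal (1 / real (card (fib r x))) * w y" if "r y = x" for y
    using that by (simp add: w_def Wt_def flip: ennreal_mult)
  then show ?thesis unfolding tr_def avg_def by (intro sum.cong refl) (simp add: mult.assoc)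
qed

lemma tr_const: "tr (\<lambda>_. c) x = c"
proof -
  have "tr (\<lambda>_. 1) x = ennreal 1"
    unfolding tr_eq_avg w_def mult_1_right using m0_normalized by (subst avg_ennreal) (simp, metis)
  moreover have "tr (\<lambda>_. c) x = tr (\<lambda>_. 1) x * c"
    by (simp add: tr_def sum_distrib_right)
  ultimately show ?thesis by simp
qed

lemma tr_add: "tr (\<lambda>y. f y + g y) x = tr f x + tr g x"
  by (simp add: tr_def distrib_left sum.distrib)

lemma tr_cmult: "tr (\<lambda>y. c * f y) x = c * tr f x"
  by (simp add: tr_def sum_distrib_left mult_ac)

lemma tr_comp: "tr (\<lambda>y. c (r y) * f y) x = c x * tr f x"
  by (simp add: tr_def sum_distrib_left mult_ac)

lemma tr_mono: "(\<And>y. r y = x \<Longrightarrow> f y \<le> g y) \<Longrightarrow> tr f x \<le> tr g x"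
  unfolding tr_def by (intro sum_mono mult_left_mono) auto

lemma tr_cong: "(\<And>y. r y = x \<Longrightarrow> f y = g y) \<Longrightarrow> tr f x = tr g x"
  unfolding tr_def by (intro sum.cong) auto

lemma tr_tendsto:
  assumes "\<And>y. r y = x \<Longrightarrow> (\<lambda>n. f n y) \<longlonglongrightarrow> g y"
  shows "(\<lambda>n. tr (f n) x) \<longlonglongrightarrow> tr g x"
  unfolding tr_def using assms by (intro tendsto_sum ennreal_tendsto_cmult) auto

lemma tr_borel [measurable]: "f \<in> borel_measurable borel \<Longrightarrow> tr f \<in> borel_measurable borel"
  unfolding tr_eq_avg[abs_def] by measurable

lemma nn_integral_tr: "f \<in> borel_measurable borel \<Longrightarrow> (\<integral>\<^sup>+x. tr f x \<partial>\<mu>) = (\<integral>\<^sup>+x. w x * f x \<partial>\<mu>)"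
  unfolding tr_eq_avg by (rule nn_integral_avg) simp

lemma tr_AE_cong:
  assumes "AE x in \<mu>. f x = g x" shows "AE x in \<mu>. tr f x = tr g x"
  using AE_fib[OF assms] by eventually_elim (auto intro: tr_cong)

lemma tr_AE_mono:
  assumes "AE x in \<mu>. f x \<le> g x" shows "AE x in \<mu>. tr f x \<le> tr g x"
  using AE_fib[OF assms] by eventually_elim (auto intro: tr_mono)

lemma funpow_r_borel [measurable]: "(r ^^ n) \<in> borel_measurable borel"
  by (induction n) (auto simp: id_def)

lemma funpow_tr_borel [measurable]: "f \<in> borel_measurable borel \<Longrightarrow> (tr ^^ n) f \<in> borel_measurable borel"
  by (induction n) auto

lemma funpow_tr_const: "(tr ^^ n) (\<lambda>_. c) = (\<lambda>_. c)"
  by (induction n) (auto simp: tr_const)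

text \<open>The density with respect to \<mu> of the law of the coordinate \<open>\<omega> n\<close>
  under \<open>N\<close>; this is why the weights \<open>m0_iter\<close> occur in the moment
  condition on harmonic functions.\<close>

definition w_iter :: "nat \<Rightarrow> 'a \<Rightarrow> ennreal" where
  "w_iter n x = (\<Prod>k<n. w ((r ^^ k) x))"

lemma w_iter_borel [measurable]: "w_iter n \<in> borel_measurable borel"
  unfolding w_iter_def[abs_def] by (intro borel_measurable_prod_ennreal measurable_compose[OF _ w_borel]) auto

lemma w_iter_Suc: "w_iter (Suc n) x = w x * w_iter n (r x)"
  unfolding w_iter_def prod.lessThan_Suc_shift by (simp add: funpow_swap1)

lemma w_iter_eq: "w_iter n x = ennreal ((cmod (m0_iter r m0 n x))\<^sup>2)"
  by (simp add: w_iter_def w_def m0_iter_def prod_power_distrib prod_ennreal flip: prod_norm)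

text \<open>The n-th power of \<open>tr\<close> is dual to
  \<open>\<phi> \<mapsto> w_iter n * (\<phi> o r^n)\<close>: a function of \<open>r y\<close> leaves
  the fibre sum, and strong invariance then removes the sum.\<close>

lemma nn_integral_funpow_tr:
  assumes "\<phi> \<in> borel_measurable borel" "f \<in> borel_measurable borel"
  shows "(\<integral>\<^sup>+x. \<phi> x * (tr ^^ n) f x \<partial>\<mu>) = (\<integral>\<^sup>+x. w_iter n x * \<phi> ((r ^^ n) x) * f x \<partial>\<mu>)"
  using assms(1)
proof (induction n arbitrary: \<phi>)
  case 0 then show ?case by (simp add: w_iter_def)
next
  case (Suc n)
  note [measurable] = Suc.prems assms(2)
  have "(\<integral>\<^sup>+x. \<phi> x * (tr ^^ Suc n) f x \<partial>\<mu>) = (\<integral>\<^sup>+x. tr (\<lambda>y. \<phi> (r y) * (tr ^^ n) f y) x \<partial>\<mu>)"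
    by (simp add: tr_comp)
  also have "\<dots> = (\<integral>\<^sup>+x. (w x * \<phi> (r x)) * (tr ^^ n) f x \<partial>\<mu>)"
    by (subst nn_integral_tr) (auto simp: mult.assoc)
  also have "\<dots> = (\<integral>\<^sup>+x. w_iter n x * (w ((r ^^ n) x) * \<phi> (r ((r ^^ n) x))) * f x \<partial>\<mu>)"
    by (rule Suc.IH) simp
  finally show ?case by (simp add: w_iter_def mult_ac)
qed

section \<open>Path weights as iterated transfer operators\<close>

lemma Wt_nonneg [simp]: "0 \<le> Wt r m0 y"
  by (simp add: Wt_def)

lemma pathw_nonneg: "0 \<le> pathw r (Wt r m0) As x"
  by (induction As arbitrary: x) (auto intro!: sum_nonneg mult_nonneg_nonneg)

lemma ennreal_pathw_Cons:
  "ennreal (pathw r (Wt r m0) (A # As) x) =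
     tr (\<lambda>y. indicator A y * ennreal (pathw r (Wt r m0) As y)) x"
proof -
  have "tr (\<lambda>y. indicator A y * ennreal (pathw r (Wt r m0) As y)) x =
      (\<Sum>y\<in>fib r x \<inter> A. ennreal (Wt r m0 y) * ennreal (pathw r (Wt r m0) As y))"
    unfolding tr_def by (intro sum.mono_neutral_cong_right) (auto split: split_indicator)
  also have "\<dots> = (\<Sum>y\<in>fib r x \<inter> A. ennreal (Wt r m0 y * pathw r (Wt r m0) As y))"
    by (simp add: ennreal_mult pathw_nonneg)
  also have "\<dots> = ennreal (pathw r (Wt r m0) (A # As) x)"
    by (simp add: sum_ennreal pathw_nonneg)
  finally show ?thesis by simp
qed

text \<open>\<open>pathw\<close> with a payoff \<open>f\<close> at the last point in place of 1. The
  freedom in \<open>f\<close> lets an induction strip sets from the end of the list, which is how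
  the path law is built up.\<close>

fun trw :: "'a set list \<Rightarrow> ('a \<Rightarrow> ennreal) \<Rightarrow> 'a \<Rightarrow> ennreal" where
  "trw [] f = f"
| "trw (A # As) f = tr (\<lambda>y. indicator A y * trw As f y)"

lemma trw_snoc: "trw (As @ [A]) f = trw As (tr (\<lambda>y. indicator A y * f y))"
  by (induction As) auto

lemma trw_one: "trw As (\<lambda>_. 1) x = ennreal (pathw r (Wt r m0) As x)"
proof (induction As arbitrary: x)
  case (Cons A As) then show ?case unfolding ennreal_pathw_Cons by simp
qed simp

subsection \<open>The path measure\<close>

text \<open>The weights live on a finite fibre that varies with x; pushing them to the Borel sets of
  the whole space gives all transition measures the same state space.\<close>

definition kern :: "'a \<Rightarrow> 'a measure" where
  "kern x = distr (density (count_space (fib r x)) (\<lambda>y. ennreal (Wt r m0 y))) borel (\<lambda>y. y)"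

lemma sets_kern [simp, measurable_cong]: "sets (kern x) = sets borel" and space_kern [simp]: "space (kern x) = UNIV"
  by (simp_all add: kern_def)

lemma nn_integral_kern: "f \<in> borel_measurable borel \<Longrightarrow> (\<integral>\<^sup>+y. f y \<partial>kern x) = tr f x"
  unfolding kern_def
  by (subst nn_integral_distr)
     (auto simp: nn_integral_density nn_integral_count_space_finite tr_def)

lemma emeasure_kern: "A \<in> sets borel \<Longrightarrow> emeasure (kern x) A = tr (indicator A) x"
  using nn_integral_kern[of "indicator A" x] by simp

lemma prob_space_kern: "prob_space (kern x)"
proof (rule prob_spaceI)
  have "indicator UNIV = (\<lambda>_::'a. 1 :: ennreal)" by (simp add: fun_eq_iff)
  then show "emeasure (kern x) (space (kern x)) = 1" by (simp add: emeasure_kern tr_const)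
qed

text \<open>Here the measurability of fibre averages pays off: the mass of \<open>A\<close> under
  \<open>kern x\<close>, as a function of x, is \<open>tr (indicator A)\<close>.\<close>

lemma kern_measurable [measurable]: "kern \<in> borel \<rightarrow>\<^sub>M subprob_algebra borel"
  by (rule measurable_subprob_algebra)
     (auto intro: prob_space_imp_subprob_space prob_space_kern simp: emeasure_kern cong: measurable_cong)

text \<open>Step i draws coordinate i from the coordinates before it, so step 0 has no past and
  draws the starting point from \<mu>; the first genuine transition is step 1.\<close>

definition step_kernel :: "nat \<Rightarrow> (nat \<Rightarrow> 'a) \<Rightarrow> 'a measure" where
  "step_kernel i \<omega> = (case i of 0 \<Rightarrow> \<mu> | Suc j \<Rightarrow> kern (\<omega> j))"

sublocale IT: Ionescu_Tulcea step_kernel "\<lambda>_. borel"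
proof (rule Ionescu_Tulcea.intro)
  show "step_kernel i \<in> Pi\<^sub>M {0..<i} (\<lambda>_. borel) \<rightarrow>\<^sub>M subprob_algebra borel" for i
  proof (cases i)
    case 0
    have "\<mu> \<in> space (subprob_algebra borel)"
      by (simp add: space_subprob_algebra prob_space_imp_subprob_space prob_space_mu)
    then show ?thesis by (simp add: step_kernel_def[abs_def] 0)
  next
    case (Suc j)
    have "(\<lambda>\<omega>. \<omega> j) \<in> Pi\<^sub>M {0..<Suc j} (\<lambda>_. borel) \<rightarrow>\<^sub>M (borel :: 'a measure)"
      by (rule measurable_component_singleton) simp
    then show ?thesis by (simp add: step_kernel_def[abs_def] Suc)
  qed
  show "prob_space (step_kernel i x)" if "x \<in> space (Pi\<^sub>M {0..<i} (\<lambda>_. borel))" for i x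
    by (auto simp: step_kernel_def prob_space_mu prob_space_kern split: nat.split)
qed

text \<open>The empty history is the single point \<open>\<lambda>_. undefined\<close> of the
  product over the empty index set; \<open>prefix_law n\<close> is the law of coordinates 0 to n -
  1.\<close>

abbreviation prefix_law :: "nat \<Rightarrow> (nat \<Rightarrow> 'a) measure" where
  "prefix_law n \<equiv> IT.C 0 n (\<lambda>_. undefined)"

lemma sets_prefix_law [measurable_cong, simp]: "sets (prefix_law n) = sets (Pi\<^sub>M {0..<n} (\<lambda>_. borel))"
  using IT.sets_C[of "\<lambda>_. undefined" 0 n] by simp

lemma space_prefix_law [simp]: "space (prefix_law n) = space (Pi\<^sub>M {0..<n} (\<lambda>_. borel))"
  using IT.space_C[of "\<lambda>_. undefined" 0 n] by simp

lemma nn_integral_prefix_law_Suc: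
  assumes f: "f \<in> borel_measurable (Pi\<^sub>M {0..<Suc n} (\<lambda>_. borel))"
  shows "(\<integral>\<^sup>+\<omega>. f \<omega> \<partial>prefix_law (Suc n)) = (\<integral>\<^sup>+\<omega>. (\<integral>\<^sup>+y. f (fun_upd \<omega> (n) y) \<partial>step_kernel n \<omega>) \<partial>prefix_law n)"
proof -
  have "(\<integral>\<^sup>+\<omega>. f \<omega> \<partial>prefix_law (Suc n)) = (\<integral>\<^sup>+\<omega>. (\<integral>\<^sup>+\<omega>'. f \<omega>' \<partial>IT.eP n \<omega>) \<partial>prefix_law n)"
    using f IT.measurable_eP[of n] by (subst IT.C.simps, subst nn_integral_bind[where B = "Pi\<^sub>M {0..<Suc n} (\<lambda>_. borel)"])
      (simp_all cong: measurable_cong_sets)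
  also have "\<dots> = (\<integral>\<^sup>+\<omega>. (\<integral>\<^sup>+y. f (fun_upd \<omega> (n) y) \<partial>step_kernel n \<omega>) \<partial>prefix_law n)"
    using f by (intro nn_integral_cong IT.nn_integral_eP) simp_all
  finally show ?thesis .
qed

lemma measurable_coord:
  "i < (n::nat) \<Longrightarrow> (\<lambda>\<omega>. \<omega> i) \<in> Pi\<^sub>M {0..<n} (\<lambda>_. borel) \<rightarrow>\<^sub>M borel"
  by (rule measurable_component_singleton) simp

text \<open>Integrating out the last coordinate replaces the payoff \<open>f\<close> by
  \<open>tr\<close> of \<open>indicator A * f\<close> at the coordinate before it, which is the
  statement for the shorter list with a new payoff.\<close>

lemma nn_integral_prefix_law:
  assumes "A0 \<in> sets borel" "set As \<subseteq> sets borel" "f \<in> borel_measurable borel"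
  shows "(\<integral>\<^sup>+\<omega>. (\<Prod>i<Suc (length As). indicator ((A0 # As) ! i) (\<omega> i)) * f (\<omega> (length As)) \<partial>prefix_law (Suc (length As)))
    = (\<integral>\<^sup>+x. indicator A0 x * trw As f x \<partial>\<mu>)"
  using assms(2,3)
proof (induction As arbitrary: f rule: rev_induct)
  case Nil
  note [measurable] = assms(1) Nil(2)
  have [measurable]: "(\<lambda>\<omega>. \<omega> 0) \<in> Pi\<^sub>M {0..<Suc 0} (\<lambda>_. borel) \<rightarrow>\<^sub>M (borel :: 'a measure)"
    by (rule measurable_coord) simp
  have "(\<integral>\<^sup>+\<omega>. indicator A0 (\<omega> 0) * f (\<omega> 0) \<partial>prefix_law (Suc 0)) =
      (\<integral>\<^sup>+\<omega>. (\<integral>\<^sup>+y. indicator A0 y * f y \<partial>step_kernel 0 \<omega>) \<partial>prefix_law 0)"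
    by (subst nn_integral_prefix_law_Suc) (simp_all del: IT.C.simps)
  also have "\<dots> = (\<integral>\<^sup>+y. indicator A0 y * f y \<partial>\<mu>)"
  proof -
    have "step_kernel 0 \<omega> = \<mu>" for \<omega> by (simp add: step_kernel_def)
    moreover have "emeasure (prefix_law 0) (space (prefix_law 0)) = 1"
      by (rule prob_space.emeasure_space_1[OF IT.prob_space_C]) (simp add: space_PiM)
    ultimately show ?thesis by (simp only: nn_integral_const mult_1_right)
  qed
  finally show ?case by (simp del: IT.C.simps)
next
  case (snoc A As)
  note [measurable] = assms(1) snoc(3)
  have [measurable]: "A \<in> sets borel" and As: "set As \<subseteq> sets borel" using snoc by auto
  let ?n = "length As"
  let ?P = "\<lambda>\<omega>. \<Prod>i<Suc ?n. indicator ((A0 # As) ! i) (\<omega> i) :: ennreal"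
  have nth: "(A0 # As @ [A]) ! i = (A0 # As) ! i" if "i < Suc ?n" for i
    using that by (auto simp: nth_Cons nth_append split: nat.split)
  have nth_meas: "(A0 # As) ! i \<in> sets borel" if "i < Suc ?n" for i
    using that As assms(1) nth_mem by (cases i) auto
  have P_meas [measurable]: "?P \<in> borel_measurable (Pi\<^sub>M {0..<m} (\<lambda>_. borel))" if "Suc ?n \<le> m" for m
    using nth_meas that by (intro borel_measurable_prod_ennreal) (auto intro!: measurable_compose[OF measurable_coord borel_measurable_indicator])
  have "(\<integral>\<^sup>+\<omega>. (\<Prod>i<Suc (length (As @ [A])). indicator ((A0 # As @ [A]) ! i) (\<omega> i)) * f (\<omega> (length (As @ [A]))) \<partial>prefix_law (Suc (length (As @ [A]))))
     = (\<integral>\<^sup>+\<omega>. ?P \<omega> * (indicator A (\<omega> (Suc ?n)) * f (\<omega> (Suc ?n))) \<partial>prefix_law (Suc (Suc ?n)))"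
  proof -
    have *: "(\<Prod>i<Suc (Suc ?n). indicator ((A0 # As @ [A]) ! i) (\<omega> i)) = ?P \<omega> * (indicator A (\<omega> (Suc ?n)) :: ennreal)" for \<omega>
      by (subst prod.lessThan_Suc) (simp add: nth nth_append del: prod.lessThan_Suc)
    show ?thesis
      by (simp del: IT.C.simps prod.lessThan_Suc add: * mult.assoc)
  qed
  also have "\<dots> = (\<integral>\<^sup>+\<omega>. (\<integral>\<^sup>+y. ?P (fun_upd \<omega> (Suc ?n) y) * (indicator A y * f y) \<partial>step_kernel (Suc ?n) \<omega>) \<partial>prefix_law (Suc ?n))"
    by (subst nn_integral_prefix_law_Suc) (use P_meas[of "Suc (Suc ?n)"] in \<open>simp_all del: IT.C.simps\<close>)
  also have "\<dots> = (\<integral>\<^sup>+\<omega>. ?P \<omega> * tr (\<lambda>y. indicator A y * f y) (\<omega> ?n) \<partial>prefix_law (Suc ?n))"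
  proof (rule nn_integral_cong)
    fix \<omega> :: "nat \<Rightarrow> 'a"
    have "?P (fun_upd \<omega> (Suc ?n) y) = ?P \<omega>" for y by (intro prod.cong) auto
    then have "(\<integral>\<^sup>+y. ?P (fun_upd \<omega> (Suc ?n) y) * (indicator A y * f y) \<partial>step_kernel (Suc ?n) \<omega>) =
       (\<integral>\<^sup>+y. ?P \<omega> * (indicator A y * f y) \<partial>kern (\<omega> ?n))"
      by (simp add: step_kernel_def)
    also have "\<dots> = ?P \<omega> * tr (\<lambda>y. indicator A y * f y) (\<omega> ?n)"
      by (simp add: nn_integral_kern tr_cmult del: prod.lessThan_Suc)
    finally show "(\<integral>\<^sup>+y. ?P (fun_upd \<omega> (Suc ?n) y) * (indicator A y * f y) \<partial>step_kernel (Suc ?n) \<omega>)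
      = ?P \<omega> * tr (\<lambda>y. indicator A y * f y) (\<omega> ?n)" .
  qed
  also have "\<dots> = (\<integral>\<^sup>+x. indicator A0 x * trw As (tr (\<lambda>y. indicator A y * f y)) x \<partial>\<mu>)"
    using As by (intro snoc.IH) measurable
  finally show ?case by (simp add: trw_snoc)
qed

section \<open>Measurability of the solenoid\<close>

text \<open>Compactness gives a finite net of radius 1/(n+1) for every n. Two points with equal
  distances to all net points lie within 2/(n+1) of each other for every n.\<close>

lemma ex_countable_separating:
  obtains D :: "'a set" where "countable D" "\<And>x y. (\<And>d. d \<in> D \<Longrightarrow> dist x d = dist y d) \<Longrightarrow> x = y"
proof -
  have "\<exists>F. finite F \<and> (UNIV :: 'a set) \<subseteq> (\<Union>x\<in>F. ball x (1 / real (Suc n)))" for n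
    by (rule compactE_image[OF compact_space, of UNIV "\<lambda>x. ball x (1 / real (Suc n))"]) auto
  then obtain F where F: "\<And>n. finite (F n)" "\<And>n. (UNIV :: 'a set) \<subseteq> (\<Union>x\<in>F n. ball x (1 / real (Suc n)))"
    by metis
  show ?thesis
  proof
    show "countable (\<Union>n. F n)" using F(1) by (auto intro: countable_finite)
    fix x y assume eq: "\<And>d. d \<in> (\<Union>n. F n) \<Longrightarrow> dist x d = dist y d"
    show "x = y"
    proof (rule ccontr)
      assume "x \<noteq> y"
      then obtain n where n: "1 / real (Suc n) < dist x y / 2"
        using nat_approx_posE[of "dist x y / 2"] by auto
      have "x \<in> (\<Union>d\<in>F n. ball d (1 / real (Suc n)))" using F(2)[of n] by blast
      then obtain d where d: "d \<in> F n" "dist d x < 1 / real (Suc n)" by auto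
      moreover have "dist x d = dist y d" using d(1) by (intro eq) blast
      ultimately have "dist y d < 1 / real (Suc n)" by (simp add: dist_commute)
      with d n dist_triangle2[of x y d] show False by (simp add: dist_commute)
    qed
  qed
qed

text \<open>Equality of points is a countable conjunction of equalities of real distances. It makes
  the solenoid, cut out by the equations \<open>r (\<omega> (Suc n)) = \<omega> n\<close>, an
  event.\<close>

lemma measurable_eq [measurable]:
  assumes [measurable]: "f \<in> M \<rightarrow>\<^sub>M (borel :: 'a measure)" "g \<in> M \<rightarrow>\<^sub>M borel"
  shows "Measurable.pred M (\<lambda>x. f x = g x)"
proof -
  obtain D :: "'a set" where D: "countable D" "\<And>x y. (\<And>d. d \<in> D \<Longrightarrow> dist x d = dist y d) \<Longrightarrow> x = y"
    using ex_countable_separating by metis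
  have [measurable]: "(\<lambda>x. dist x d) \<in> borel_measurable borel" for d :: 'a
    by (intro borel_measurable_continuous_onI continuous_intros)
  have "(\<lambda>x. f x = g x) = (\<lambda>x. \<forall>d\<in>D. dist (f x) d = dist (g x) d)"
    using D(2) by (auto simp: fun_eq_iff)
  also have "Measurable.pred M \<dots>"
    unfolding pred_def using D(1) by (intro sets.sets_Collect_countable_All') measurable
  finally show ?thesis .
qed

text \<open>The transition measure from \<open>\<omega> n\<close> is carried by the fibre over
  \<open>\<omega> n\<close>.\<close>

lemma AE_prefix_law_step: "AE \<omega> in prefix_law (Suc (Suc n)). r (\<omega> (Suc n)) = \<omega> n"
proof -
  have [measurable]: "(\<lambda>\<omega>. \<omega> (Suc n)) \<in> Pi\<^sub>M {0..<Suc (Suc n)} (\<lambda>_. borel) \<rightarrow>\<^sub>M (borel :: 'a measure)"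
    "(\<lambda>\<omega>. \<omega> n) \<in> Pi\<^sub>M {0..<Suc (Suc n)} (\<lambda>_. borel) \<rightarrow>\<^sub>M (borel :: 'a measure)"
    by (auto intro!: measurable_coord)
  have "(\<integral>\<^sup>+\<omega>. indicator {\<omega>. r (\<omega> (Suc n)) \<noteq> \<omega> n} \<omega> \<partial>prefix_law (Suc (Suc n))) =
    (\<integral>\<^sup>+\<omega>. (\<integral>\<^sup>+y. indicator {\<omega>. r (\<omega> (Suc n)) \<noteq> \<omega> n} (fun_upd \<omega> (Suc n) y) \<partial>step_kernel (Suc n) \<omega>) \<partial>prefix_law (Suc n))"
    by (rule nn_integral_prefix_law_Suc) measurable
  also have "\<dots> = (\<integral>\<^sup>+\<omega>. (\<integral>\<^sup>+y. indicator {y. r y \<noteq> \<omega> n} y \<partial>kern (\<omega> n)) \<partial>prefix_law (Suc n))"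
    by (intro nn_integral_cong) (unfold step_kernel_def nat.case, intro nn_integral_cong, simp add: indicator_def)
  also have "\<dots> = (\<integral>\<^sup>+\<omega>. 0 \<partial>prefix_law (Suc n))"
  proof (intro nn_integral_cong)
    fix \<omega> :: "nat \<Rightarrow> 'a"
    have "(\<integral>\<^sup>+y. indicator {y. r y \<noteq> \<omega> n} y \<partial>kern (\<omega> n)) = tr (indicator {y. r y \<noteq> \<omega> n}) (\<omega> n)"
      by (rule nn_integral_kern) measurable
    also have "\<dots> = tr (\<lambda>_. 0) (\<omega> n)" by (rule tr_cong) auto
    finally show "(\<integral>\<^sup>+y. indicator {y. r y \<noteq> \<omega> n} y \<partial>kern (\<omega> n)) = 0" by (simp add: tr_const)
  qed
  finally have "(\<integral>\<^sup>+\<omega>. indicator {\<omega>. r (\<omega> (Suc n)) \<noteq> \<omega> n} \<omega> \<partial>prefix_law (Suc (Suc n))) = 0" by simp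
  then have "AE \<omega> in prefix_law (Suc (Suc n)). indicator {\<omega>. r (\<omega> (Suc n)) \<noteq> \<omega> n} \<omega> = (0 :: ennreal)"
    by (subst (asm) nn_integral_0_iff_AE) measurable
  then show ?thesis by eventually_elim (auto split: split_indicator_asm)
qed

abbreviation path_law :: "(nat \<Rightarrow> 'a) measure" where "path_law \<equiv> IT.PF.lim"

lemma sets_path_law [measurable_cong, simp]: "sets path_law = sets (Pi\<^sub>M UNIV (\<lambda>_. borel))"
  by (rule IT.PF.sets_lim)

lemma space_path_law [simp]: "space path_law = UNIV"
  using sets_eq_imp_space_eq[OF sets_path_law] by (simp add: space_PiM)

lemma distr_path_law: "distr path_law (Pi\<^sub>M {0..<n} (\<lambda>_. borel)) (\<lambda>\<omega>. restrict \<omega> {0..<n}) = prefix_law n"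
proof (rule measure_eqI)
  show "sets (distr path_law (Pi\<^sub>M {0..<n} (\<lambda>_. borel)) (\<lambda>\<omega>. restrict \<omega> {0..<n})) = sets (prefix_law n)" by simp
  fix X assume "X \<in> sets (distr path_law (Pi\<^sub>M {0..<n} (\<lambda>_. borel)) (\<lambda>\<omega>. restrict \<omega> {0..<n}))"
  then have X: "X \<in> sets (Pi\<^sub>M {0..<n} (\<lambda>_. borel))" by simp
  have "emeasure (distr path_law (Pi\<^sub>M {0..<n} (\<lambda>_. borel)) (\<lambda>\<omega>. restrict \<omega> {0..<n})) X = emeasure (IT.CI {0..<n}) X"
    by (subst IT.distr_lim) simp_all
  also have "\<dots> = emeasure (prefix_law n) (prod_emb {0..<n} (\<lambda>_. borel) {0..<n} X)"
    using X by (intro IT.emeasure_CI) simp_all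
  also have "prod_emb {0..<n} (\<lambda>_. borel) {0..<n} X = X"
    using sets.sets_into_space[OF X] by (intro prod_emb_id) (simp add: space_PiM)
  finally show "emeasure (distr path_law (Pi\<^sub>M {0..<n} (\<lambda>_. borel)) (\<lambda>\<omega>. restrict \<omega> {0..<n})) X = emeasure (prefix_law n) X" .
qed

lemma restrict_measurable [measurable]:
  "(\<lambda>\<omega>. restrict \<omega> {0..<n::nat}) \<in> Pi\<^sub>M UNIV (\<lambda>_. borel) \<rightarrow>\<^sub>M Pi\<^sub>M {0..<n} (\<lambda>_. borel :: 'a measure)"
  by (rule measurable_restrict_subset) simp

lemma measurable_solenoid [measurable]: "solenoid r \<in> sets (Pi\<^sub>M UNIV (\<lambda>_. borel))"
proof -
  have "solenoid r = {\<omega> \<in> space (Pi\<^sub>M UNIV (\<lambda>_. borel)). \<forall>n. r (\<omega> (Suc n)) = \<omega> n}"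
    by (auto simp: solenoid_def space_PiM)
  also have "\<dots> \<in> sets (Pi\<^sub>M UNIV (\<lambda>_. borel))" by measurable
  finally show ?thesis .
qed

lemma AE_path_law_solenoid: "AE \<omega> in path_law. \<omega> \<in> solenoid r"
proof -
  have "AE \<omega> in path_law. r (\<omega> (Suc n)) = \<omega> n" for n
  proof -
    have [measurable]: "(\<lambda>\<omega>. \<omega> (Suc n)) \<in> Pi\<^sub>M {0..<Suc (Suc n)} (\<lambda>_. borel) \<rightarrow>\<^sub>M (borel :: 'a measure)"
      "(\<lambda>\<omega>. \<omega> n) \<in> Pi\<^sub>M {0..<Suc (Suc n)} (\<lambda>_. borel) \<rightarrow>\<^sub>M (borel :: 'a measure)"
      by (auto intro!: measurable_coord)
    have "AE \<omega> in distr path_law (Pi\<^sub>M {0..<Suc (Suc n)} (\<lambda>_. borel)) (\<lambda>\<omega>. restrict \<omega> {0..<Suc (Suc n)}). r (\<omega> (Suc n)) = \<omega> n"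
      unfolding distr_path_law by (rule AE_prefix_law_step)
    then show ?thesis
      by (subst (asm) AE_distr_iff) auto
  qed
  then show ?thesis by (simp add: solenoid_def AE_all_countable)
qed

lemma emeasure_path_law_cylinder:
  assumes A0: "A0 \<in> sets borel" and As: "set As \<subseteq> sets borel"
  shows "emeasure path_law (cylinder r A0 As) = (\<integral>\<^sup>+x\<in>A0. ennreal (pathw r (Wt r m0) As x) \<partial>\<mu>)"
proof -
  let ?n = "length As"
  have nth_meas: "(A0 # As) ! i \<in> sets borel" if "i < Suc ?n" for i
    using that As A0 nth_mem by (cases i) auto
  have P_meas [measurable]: "(\<lambda>\<omega>. \<Prod>i<Suc ?n. indicator ((A0 # As) ! i) (\<omega> i) :: ennreal) \<in> borel_measurable (Pi\<^sub>M {0..<Suc ?n} (\<lambda>_. borel))"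
    using nth_meas by (intro borel_measurable_prod_ennreal) (auto intro!: measurable_compose[OF measurable_coord borel_measurable_indicator])
  have ind: "indicator (cylinder r A0 As) \<omega> = (\<Prod>i<Suc ?n. indicator ((A0 # As) ! i) (\<omega> i) :: ennreal)"
    if "\<omega> \<in> solenoid r" for \<omega>
  proof (cases "\<omega> \<in> cylinder r A0 As")
    case True
    then show ?thesis
      by (auto simp: cylinder_def nth_Cons intro!: prod.neutral[symmetric] split: nat.split split_indicator)
  next
    case False
    have "\<omega> \<in> cylinder r A0 As" if *: "\<And>i. i < Suc ?n \<Longrightarrow> \<omega> i \<in> (A0 # As) ! i"
      using *[of 0] *[of "Suc i" for i] \<open>\<omega> \<in> solenoid r\<close> by (auto simp: cylinder_def)
    with False obtain i where "i < Suc ?n" "\<omega> i \<notin> (A0 # As) ! i" by blast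
    then show ?thesis using False by (subst prod_zero) (auto simp del: prod.lessThan_Suc intro!: bexI[of _ i])
  qed
  have cyl: "cylinder r A0 As = solenoid r \<inter> (\<Inter>i\<in>{..<Suc ?n}. (\<lambda>\<omega>. \<omega> i) -` ((A0 # As) ! i))"
    by (force simp: cylinder_def space_PiM lessThan_Suc_eq_insert_0)
  have "(\<lambda>\<omega>. \<omega> i) -` ((A0 # As) ! i) \<in> sets (Pi\<^sub>M UNIV (\<lambda>_. borel))" if "i < Suc ?n" for i
    using measurable_sets[OF measurable_component_singleton[of i UNIV "\<lambda>_. borel"] nth_meas[OF that]]
    by (simp add: space_PiM)
  then have "cylinder r A0 As \<in> sets (Pi\<^sub>M UNIV (\<lambda>_. borel))"
    unfolding cyl by (intro sets.Int measurable_solenoid sets.finite_INT) auto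
  then have "emeasure path_law (cylinder r A0 As) = (\<integral>\<^sup>+\<omega>. indicator (cylinder r A0 As) \<omega> \<partial>path_law)"
    by simp
  \<comment> \<open>The integrands agree only on the solenoid, since \<open>cylinder\<close>
    includes membership in it; the solenoid has full measure.\<close>
  also have "\<dots> = (\<integral>\<^sup>+\<omega>. (\<Prod>i<Suc ?n. indicator ((A0 # As) ! i) ((restrict \<omega> {0..<Suc ?n}) i)) \<partial>path_law)"
    using AE_path_law_solenoid by (intro nn_integral_cong_AE) (auto simp: ind intro!: prod.cong)
  also have "\<dots> = (\<integral>\<^sup>+\<omega>. (\<Prod>i<Suc ?n. indicator ((A0 # As) ! i) (\<omega> i)) \<partial>prefix_law (Suc ?n))"
    unfolding distr_path_law[symmetric] by (subst nn_integral_distr) (simp_all del: prod.lessThan_Suc IT.C.simps)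
  also have "\<dots> = (\<integral>\<^sup>+x. indicator A0 x * trw As (\<lambda>_. 1) x \<partial>\<mu>)"
    using nn_integral_prefix_law[OF A0 As, of "\<lambda>_. 1"] by (simp del: IT.C.simps)
  finally show ?thesis by (simp add: trw_one mult.commute)
qed

subsection \<open>The measure on the solenoid\<close>

abbreviation N :: "(nat \<Rightarrow> 'a) measure" where "N \<equiv> mu_inf r \<mu> m0"

text \<open>\<open>mu_inf\<close> is a choice, so nothing is known about it until the specification
  has a witness. The witness is the path law restricted to the solenoid; everything later uses only
  the specification.\<close>

lemma mu_inf_spec:
  "sets N = sets (solenoid_space r) \<and> space N = solenoid r \<and>
     (\<forall>A0 As. A0 \<in> sets borel \<longrightarrow> set As \<subseteq> sets borel \<longrightarrow>
        emeasure N (cylinder r A0 As) = (\<integral>\<^sup>+x\<in>A0. ennreal (pathw r (Wt r m0) As x) \<partial>\<mu>))"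
  unfolding mu_inf_def
proof (rule someI, intro conjI allI impI)
  let ?N = "restrict_space path_law (solenoid r)"
  show "sets ?N = sets (solenoid_space r)"
    unfolding solenoid_space_def by (rule sets_restrict_space_cong) simp
  show "space ?N = solenoid r" by (simp add: space_restrict_space)
  fix A0 :: "'a set" and As :: "'a set list" assume A: "A0 \<in> sets borel" "set As \<subseteq> sets borel"
  have "emeasure ?N (cylinder r A0 As) = emeasure path_law (cylinder r A0 As)"
    by (rule emeasure_restrict_space) (auto simp: cylinder_def)
  with A show "emeasure ?N (cylinder r A0 As) = (\<integral>\<^sup>+x\<in>A0. ennreal (pathw r (Wt r m0) As x) \<partial>\<mu>)"
    by (simp add: emeasure_path_law_cylinder)
qed

lemma sets_N: "sets N = sets (restrict_space (Pi\<^sub>M UNIV (\<lambda>_. borel)) (solenoid r))"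
  and space_N [simp]: "space N = solenoid r"
  and emeasure_N_cylinder: "A0 \<in> sets borel \<Longrightarrow> set As \<subseteq> sets borel \<Longrightarrow>
        emeasure N (cylinder r A0 As) = (\<integral>\<^sup>+x\<in>A0. ennreal (pathw r (Wt r m0) As x) \<partial>\<mu>)"
  using mu_inf_spec by (auto simp: solenoid_space_def)

lemma coord_measurable [measurable]: "(\<lambda>\<omega>. \<omega> n) \<in> N \<rightarrow>\<^sub>M borel"
  unfolding measurable_cong_sets[OF sets_N refl]
  by (intro measurable_restrict_space1 measurable_component_singleton) simp

lemma r_inf_simps [simp]: "r_inf r \<omega> 0 = r (\<omega> 0)" "r_inf r \<omega> (Suc n) = \<omega> n"
  by (simp_all add: r_inf_def)

lemma r_inf_solenoid [simp]: "\<omega> \<in> solenoid r \<Longrightarrow> r_inf r \<omega> \<in> solenoid r"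
  by (auto simp: solenoid_def r_inf_def split: nat.split)

lemma r_inf_measurable [measurable]: "r_inf r \<in> N \<rightarrow>\<^sub>M N"
  unfolding measurable_cong_sets[OF refl sets_N]
proof (rule measurable_restrict_space2)
  show "r_inf r \<in> space N \<rightarrow> solenoid r" by simp
  show "r_inf r \<in> N \<rightarrow>\<^sub>M Pi\<^sub>M UNIV (\<lambda>_. borel)"
  proof (rule measurable_PiM_single')
    show "(\<lambda>\<omega>. r_inf r \<omega> i) \<in> N \<rightarrow>\<^sub>M borel" for i by (cases i) simp_all
  qed simp
qed

sublocale N: prob_space N
proof (rule prob_spaceI)
  have "cylinder r UNIV [] = solenoid r" by (auto simp: cylinder_def)
  then show "emeasure N (space N) = 1"
    using emeasure_N_cylinder[of UNIV "[]"] by simp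
qed

text \<open>Leaving the intermediate coordinates free turns the path weight into a power of
  \<open>tr\<close>. For n = 0 both constraints fall on the same coordinate.\<close>

lemma emeasure_N_coords:
  assumes "A \<in> sets borel" "B \<in> sets borel"
  shows "emeasure N {\<omega> \<in> space N. \<omega> 0 \<in> A \<and> \<omega> n \<in> B} = (\<integral>\<^sup>+x. indicator A x * (tr ^^ n) (indicator B) x \<partial>\<mu>)"
proof (cases n)
  case 0
  have "{\<omega> \<in> space N. \<omega> 0 \<in> A \<and> \<omega> 0 \<in> B} = cylinder r (A \<inter> B) []" by (auto simp: cylinder_def)
  then show ?thesis using assms by (simp add: 0 emeasure_N_cylinder indicator_inter_arith)
next
  case (Suc k)
  have eq: "{\<omega> \<in> space N. \<omega> 0 \<in> A \<and> \<omega> (Suc k) \<in> B} = cylinder r A (replicate k UNIV @ [B])"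
    by (auto simp: cylinder_def nth_append less_Suc_eq)
  have "ennreal (pathw r (Wt r m0) (replicate k UNIV @ [B]) x) = (tr ^^ Suc k) (indicator B) x" for x
  proof (induction k arbitrary: x)
    case 0 show ?case unfolding replicate_0 append_Nil ennreal_pathw_Cons by simp
  next
    case (Suc k) show ?case unfolding replicate_Suc append_Cons ennreal_pathw_Cons Suc by simp
  qed
  moreover have "set (replicate k UNIV @ [B]) \<subseteq> sets borel" using assms by auto
  ultimately show ?thesis using assms unfolding Suc eq by (simp add: emeasure_N_cylinder mult.commute)
qed

lemma emeasure_N_coord0: "A \<in> sets borel \<Longrightarrow> emeasure N {\<omega> \<in> space N. \<omega> 0 \<in> A} = emeasure \<mu> A"
  using emeasure_N_coords[of A UNIV 0] by simp

lemma distr_N_coord0: "distr N borel (\<lambda>\<omega>. \<omega> 0) = \<mu>"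
proof (rule measure_eqI)
  fix A assume "A \<in> sets (distr N borel (\<lambda>\<omega>. \<omega> 0))"
  then have "A \<in> sets borel" by simp
  moreover have "(\<lambda>\<omega>. \<omega> 0) -` A \<inter> space N = {\<omega> \<in> space N. \<omega> 0 \<in> A}" by auto
  ultimately show "emeasure (distr N borel (\<lambda>\<omega>. \<omega> 0)) A = emeasure \<mu> A"
    by (simp add: emeasure_distr emeasure_N_coord0 del: space_N)
qed simp

lemma nn_integral_N_coord0: "f \<in> borel_measurable borel \<Longrightarrow> (\<integral>\<^sup>+\<omega>. f (\<omega> 0) \<partial>N) = (\<integral>\<^sup>+x. f x \<partial>\<mu>)"
  using nn_integral_distr[of "\<lambda>\<omega>. \<omega> 0" N borel f] by (simp add: distr_N_coord0)

lemma AE_N_coord0: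
  assumes "AE x in \<mu>. P x" shows "AE \<omega> in N. P (\<omega> 0)"
proof (rule AE_distrD[where f = "\<lambda>\<omega>. \<omega> 0" and M' = borel])
  show "AE x in distr N borel (\<lambda>\<omega>. \<omega> 0). P x" unfolding distr_N_coord0 by fact
qed simp

lemma nn_integral_N_coords:
  assumes [measurable]: "\<phi> \<in> borel_measurable borel" "B \<in> sets borel"
  shows "(\<integral>\<^sup>+\<omega>. \<phi> (\<omega> 0) * indicator B (\<omega> n) \<partial>N) = (\<integral>\<^sup>+x. \<phi> x * (tr ^^ n) (indicator B) x \<partial>\<mu>)"
proof -
  have "distr (density N (\<lambda>\<omega>. indicator B (\<omega> n))) borel (\<lambda>\<omega>. \<omega> 0) = density \<mu> ((tr ^^ n) (indicator B))" (is "?D1 = ?D2")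
  proof (rule measure_eqI)
    fix A assume "A \<in> sets ?D1"
    then have [measurable]: "A \<in> sets borel" by simp
    have [measurable]: "(\<lambda>\<omega>. \<omega> 0) -` A \<inter> solenoid r \<in> sets N"
      using measurable_sets[OF coord_measurable, of A 0] by simp
    have "emeasure ?D1 A = (\<integral>\<^sup>+\<omega>. indicator B (\<omega> n) * indicator ((\<lambda>\<omega>. \<omega> 0) -` A \<inter> space N) \<omega> \<partial>N)"
      by (simp add: emeasure_distr emeasure_density)
    also have "\<dots> = (\<integral>\<^sup>+\<omega>. indicator {\<omega> \<in> space N. \<omega> 0 \<in> A \<and> \<omega> n \<in> B} \<omega> \<partial>N)"
      by (intro nn_integral_cong) (auto split: split_indicator)
    also have "\<dots> = (\<integral>\<^sup>+x. indicator A x * (tr ^^ n) (indicator B) x \<partial>\<mu>)"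
      by (subst nn_integral_indicator) (simp_all add: emeasure_N_coords del: space_N)
    also have "\<dots> = emeasure ?D2 A" by (simp add: emeasure_density mult.commute)
    finally show "emeasure ?D1 A = emeasure ?D2 A" .
  qed simp
  then have "(\<integral>\<^sup>+x. \<phi> x \<partial>?D1) = (\<integral>\<^sup>+x. \<phi> x \<partial>?D2)" by simp
  then show ?thesis
    by (simp add: nn_integral_distr nn_integral_density mult.commute)
qed

lemma solenoid_iterate: "\<omega> \<in> solenoid r \<Longrightarrow> (r ^^ k) (\<omega> (n + k)) = \<omega> n"
  by (induction k arbitrary: n) (auto simp: solenoid_def funpow_swap1)

definition coord_sets :: "(nat \<Rightarrow> 'a) set set" where
  "coord_sets = {{\<omega> \<in> solenoid r. \<omega> n \<in> B} | n B. B \<in> sets borel}"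

lemma coord_setsI: "B \<in> sets borel \<Longrightarrow> {\<omega> \<in> solenoid r. \<omega> n \<in> B} \<in> coord_sets"
  by (auto simp: coord_sets_def)

lemma Int_stable_coord_sets: "Int_stable coord_sets"
proof -
  have *: "{\<omega> \<in> solenoid r. \<omega> n \<in> A} \<inter> {\<omega> \<in> solenoid r. \<omega> m \<in> B} \<in> coord_sets"
    if [measurable]: "A \<in> sets borel" "B \<in> sets borel" and "n \<le> m" for A B n m
  proof -
    have "(r ^^ (m - n)) (\<omega> m) = \<omega> n" if "\<omega> \<in> solenoid r" for \<omega>
      using solenoid_iterate[OF that, of "m - n" n] \<open>n \<le> m\<close> by simp
    then have eq: "{\<omega> \<in> solenoid r. \<omega> n \<in> A} \<inter> {\<omega> \<in> solenoid r. \<omega> m \<in> B} =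
      {\<omega> \<in> solenoid r. \<omega> m \<in> (r ^^ (m - n)) -` A \<inter> B}" by auto
    have "(r ^^ (m - n)) -` A \<in> sets borel"
      using measurable_sets[OF funpow_r_borel that(1), of "m - n"] by simp
    then have "(r ^^ (m - n)) -` A \<inter> B \<in> sets borel"
      by (rule sets.Int) fact
    then show ?thesis unfolding eq by (rule coord_setsI)
  qed
  show ?thesis
    unfolding Int_stable_def
  proof (intro ballI)
    fix a b assume "a \<in> coord_sets" "b \<in> coord_sets"
    then obtain n A m B where ab: "a = {\<omega> \<in> solenoid r. \<omega> n \<in> A}" "b = {\<omega> \<in> solenoid r. \<omega> m \<in> B}"
      and AB: "A \<in> sets borel" "B \<in> sets borel"
      by (auto simp: coord_sets_def)
    show "a \<inter> b \<in> coord_sets"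
      using *[OF AB, of n m] *[OF AB(2,1), of m n] unfolding ab by (cases "n \<le> m") (simp_all add: Int_commute)
  qed
qed

lemma sets_N_eq_sigma: "sets N = sigma_sets (solenoid r) coord_sets"
proof -
  let ?G = "{{f \<in> \<Pi>\<^sub>E i\<in>UNIV. space borel. f i \<in> A} | i A. i \<in> UNIV \<and> A \<in> sets (borel :: 'a measure)}"
  have PiM: "sets (Pi\<^sub>M UNIV (\<lambda>_. borel)) = sigma_sets (\<Pi>\<^sub>E i\<in>(UNIV::nat set). space (borel :: 'a measure)) ?G"
    by (rule sets_PiM_single)
  have "sets N = (\<inter>) (solenoid r) ` sigma_sets (\<Pi>\<^sub>E i\<in>UNIV. space borel) ?G"
    unfolding sets_N sets_restrict_space PiM ..
  also have "\<dots> = sigma_sets (solenoid r) ((\<inter>) (solenoid r) ` ?G)"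
  proof (rule sigma_sets_Int)
    show "solenoid r \<in> sigma_sets (\<Pi>\<^sub>E i\<in>UNIV. space borel) ?G"
      using measurable_solenoid unfolding PiM .
    show "solenoid r \<subseteq> (\<Pi>\<^sub>E i\<in>UNIV. space borel)" by auto
  qed
  also have "(\<inter>) (solenoid r) ` ?G = coord_sets"
  proof (intro set_eqI iffI)
    fix X assume "X \<in> (\<inter>) (solenoid r) ` ?G"
    then obtain i A where "X = solenoid r \<inter> {f \<in> \<Pi>\<^sub>E i\<in>UNIV. space borel. f i \<in> A}" and A: "A \<in> sets borel"
      by blast
    then have "X = {\<omega> \<in> solenoid r. \<omega> i \<in> A}" by auto
    with A show "X \<in> coord_sets" using coord_setsI by simp
  next
    fix X assume "X \<in> coord_sets"
    then obtain i A where X: "X = {\<omega> \<in> solenoid r. \<omega> i \<in> A}" and A: "A \<in> sets borel"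
      unfolding coord_sets_def by blast
    then have "X = solenoid r \<inter> {f \<in> \<Pi>\<^sub>E i\<in>UNIV. space borel. f i \<in> A}" by auto
    with A show "X \<in> (\<inter>) (solenoid r) ` ?G" by blast
  qed
  finally show ?thesis .
qed

lemma coord_sets_subset: "coord_sets \<subseteq> Pow (solenoid r)"
  by (auto simp: coord_sets_def)

lemma measure_eq_on_coord_sets:
  assumes sets: "sets M1 = sets N" "sets M2 = sets N" and fin: "emeasure M1 (solenoid r) \<noteq> \<infinity>"
    and eq: "\<And>n B. B \<in> sets borel \<Longrightarrow> emeasure M1 {\<omega> \<in> solenoid r. \<omega> n \<in> B} = emeasure M2 {\<omega> \<in> solenoid r. \<omega> n \<in> B}"
  shows "M1 = M2"
proof (rule measure_eqI_generator_eq[OF Int_stable_coord_sets coord_sets_subset])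
  show "emeasure M1 X = emeasure M2 X" if "X \<in> coord_sets" for X
    using that eq by (auto simp: coord_sets_def)
  show "range (\<lambda>_::nat. solenoid r) \<subseteq> coord_sets"
    using coord_setsI[of UNIV 0] by auto
  show "sets M1 = sigma_sets (solenoid r) coord_sets" "sets M2 = sigma_sets (solenoid r) coord_sets"
    using sets by (simp_all add: sets_N_eq_sigma)
qed (use fin in auto)

section \<open>Change of variables under the automorphism\<close>

text \<open>The measure form of the isometry of U. Coordinate Suc k of
  \<open>r_inf r \<omega>\<close> is \<open>\<omega> k\<close>, and the weight \<open>w\<close>
  supplies one further \<open>tr\<close> by duality; coordinate 0 is \<open>r (\<omega> 0)\<close>,
  where \<open>tr 1 = 1\<close> absorbs the weight.\<close>

lemma distr_r_inf: "distr (density N (\<lambda>\<omega>. w (\<omega> 0))) N (r_inf r) = N"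
proof (rule measure_eq_on_coord_sets)
  have em: "emeasure (distr (density N (\<lambda>\<omega>. w (\<omega> 0))) N (r_inf r)) {\<omega> \<in> solenoid r. \<omega> n \<in> B} =
     emeasure N {\<omega> \<in> solenoid r. \<omega> n \<in> B}" if [measurable]: "B \<in> sets borel" for n B
  proof -
    have "{\<omega> \<in> space N. \<omega> n \<in> B} \<in> sets N" by measurable
    then have [measurable]: "{\<omega> \<in> solenoid r. \<omega> n \<in> B} \<in> sets N" by simp
    have "emeasure (distr (density N (\<lambda>\<omega>. w (\<omega> 0))) N (r_inf r)) {\<omega> \<in> solenoid r. \<omega> n \<in> B}
      = emeasure (density N (\<lambda>\<omega>. w (\<omega> 0))) (r_inf r -` {\<omega> \<in> solenoid r. \<omega> n \<in> B} \<inter> space N)"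
      by (subst emeasure_distr) simp_all
    also have "\<dots> = (\<integral>\<^sup>+\<omega>. w (\<omega> 0) * indicator (r_inf r -` {\<omega> \<in> solenoid r. \<omega> n \<in> B} \<inter> space N) \<omega> \<partial>N)"
      by (rule emeasure_density) measurable
    also have "\<dots> = (\<integral>\<^sup>+\<omega>. w (\<omega> 0) * indicator B (r_inf r \<omega> n) \<partial>N)"
      by (intro nn_integral_cong) (auto split: split_indicator)
    also have "\<dots> = emeasure N {\<omega> \<in> space N. \<omega> 0 \<in> UNIV \<and> \<omega> n \<in> B}"
    proof (cases n)
      case 0
      have "(\<integral>\<^sup>+\<omega>. w (\<omega> 0) * indicator B (r (\<omega> 0)) \<partial>N) = (\<integral>\<^sup>+x. w x * indicator B (r x) \<partial>\<mu>)"
        by (rule nn_integral_N_coord0) simp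
      also have "\<dots> = (\<integral>\<^sup>+x. tr (\<lambda>x. indicator B (r x) * 1) x \<partial>\<mu>)"
        by (subst nn_integral_tr) auto
      also have "\<dots> = (\<integral>\<^sup>+x. indicator B x \<partial>\<mu>)"
        by (subst tr_comp) (simp add: tr_const)
      finally show ?thesis by (simp add: 0 emeasure_N_coord0[simplified])
    next
      case (Suc k)
      have "(\<integral>\<^sup>+\<omega>. w (\<omega> 0) * indicator B (\<omega> k) \<partial>N) = (\<integral>\<^sup>+x. w x * (tr ^^ k) (indicator B) x \<partial>\<mu>)"
        by (rule nn_integral_N_coords) auto
      also have "\<dots> = (\<integral>\<^sup>+x. indicator UNIV x * (tr ^^ Suc k) (indicator B) x \<partial>\<mu>)"
        by (simp add: nn_integral_tr)
      finally show ?thesis unfolding Suc by (subst emeasure_N_coords) auto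
    qed
    finally show ?thesis by simp
  qed
  then show "emeasure (distr (density N (\<lambda>\<omega>. w (\<omega> 0))) N (r_inf r)) {\<omega> \<in> solenoid r. \<omega> n \<in> B} =
     emeasure N {\<omega> \<in> solenoid r. \<omega> n \<in> B}" if "B \<in> sets borel" for n B using that .
  show "emeasure (distr (density N (\<lambda>\<omega>. w (\<omega> 0))) N (r_inf r)) (solenoid r) \<noteq> \<infinity>"
    using em[of UNIV 0] by (simp add: N.emeasure_space_1[simplified])
qed simp_all

lemma nn_integral_r_inf:
  assumes [measurable]: "f \<in> borel_measurable N"
  shows "(\<integral>\<^sup>+\<omega>. w (\<omega> 0) * f (r_inf r \<omega>) \<partial>N) = (\<integral>\<^sup>+\<omega>. f \<omega> \<partial>N)"
proof -
  have "(\<integral>\<^sup>+\<omega>. f \<omega> \<partial>N) = (\<integral>\<^sup>+\<omega>. f \<omega> \<partial>distr (density N (\<lambda>\<omega>. w (\<omega> 0))) N (r_inf r))"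
    by (simp add: distr_r_inf)
  also have "\<dots> = (\<integral>\<^sup>+\<omega>. w (\<omega> 0) * f (r_inf r \<omega>) \<partial>N)"
    by (subst nn_integral_distr, simp, simp, subst nn_integral_density) auto
  finally show ?thesis ..
qed

lemma funpow_r_inf_measurable [measurable]: "(r_inf r ^^ n) \<in> N \<rightarrow>\<^sub>M N"
  by (induction n) (auto simp: id_def)

lemma nn_integral_funpow_r_inf:
  assumes [measurable]: "f \<in> borel_measurable N"
  shows "(\<integral>\<^sup>+\<omega>. w_iter n (\<omega> 0) * f ((r_inf r ^^ n) \<omega>) \<partial>N) = (\<integral>\<^sup>+\<omega>. f \<omega> \<partial>N)"
proof (induction n)
  case 0 show ?case by (simp add: w_iter_def)
next
  case (Suc n)
  have "(\<integral>\<^sup>+\<omega>. w_iter (Suc n) (\<omega> 0) * f ((r_inf r ^^ Suc n) \<omega>) \<partial>N) =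
    (\<integral>\<^sup>+\<omega>. w (\<omega> 0) * (w_iter n (r_inf r \<omega> 0) * f ((r_inf r ^^ n) (r_inf r \<omega>))) \<partial>N)"
    by (simp add: w_iter_Suc mult.assoc funpow_swap1)
  also have "\<dots> = (\<integral>\<^sup>+\<omega>. w_iter n (\<omega> 0) * f ((r_inf r ^^ n) \<omega>) \<partial>N)"
    by (rule nn_integral_r_inf) measurable
  finally show ?case using Suc by simp
qed

lemma funpow_r_inf_coord: "(r_inf r ^^ n) \<omega> (n + k) = \<omega> k"
proof (induction n arbitrary: k)
  case (Suc n) then show ?case by simp
qed simp

lemma nn_integral_N_coord:
  assumes [measurable]: "f \<in> borel_measurable borel"
  shows "(\<integral>\<^sup>+\<omega>. f (\<omega> n) \<partial>N) = (\<integral>\<^sup>+x. w_iter n x * f x \<partial>\<mu>)"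
proof -
  have "(\<integral>\<^sup>+\<omega>. f (\<omega> n) \<partial>N) = (\<integral>\<^sup>+\<omega>. w_iter n (\<omega> 0) * f ((r_inf r ^^ n) \<omega> n) \<partial>N)"
    by (rule nn_integral_funpow_r_inf[symmetric]) measurable
  also have "\<dots> = (\<integral>\<^sup>+\<omega>. w_iter n (\<omega> 0) * f (\<omega> 0) \<partial>N)"
    using funpow_r_inf_coord[of n _ 0] by simp
  also have "\<dots> = (\<integral>\<^sup>+x. w_iter n x * f x \<partial>\<mu>)"
    by (rule nn_integral_N_coord0) measurable
  finally show ?thesis .
qed

text \<open>The change of variables only says that preimages of null sets carry no
  \<open>w\<close>-mass. They are null for \<open>N\<close> because \<open>w\<close> is almost
  everywhere nonzero, which is where non-singularity of \<open>m0\<close> enters.\<close>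

lemma AE_r_inf:
  assumes "AE \<omega> in N. P \<omega>" shows "AE \<omega> in N. P (r_inf r \<omega>)"
proof -
  from assms obtain S where S: "{x \<in> space N. \<not> P x} \<subseteq> S" "emeasure N S = 0" "S \<in> sets N"
    by (rule AE_E)
  note [measurable] = S(3)
  have "(\<integral>\<^sup>+\<omega>. w (\<omega> 0) * indicator S (r_inf r \<omega>) \<partial>N) = 0"
    using S by (subst nn_integral_r_inf) auto
  then have "AE \<omega> in N. w (\<omega> 0) * indicator S (r_inf r \<omega>) = 0"
    by (subst (asm) nn_integral_0_iff_AE) auto
  with AE_N_coord0[OF w_nonzero] AE_space[of N] show ?thesis
  proof eventually_elim
    fix \<omega> assume "w (\<omega> 0) \<noteq> 0" "\<omega> \<in> space N" "w (\<omega> 0) * indicator S (r_inf r \<omega>) = 0"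
    then have "r_inf r \<omega> \<in> space N" "r_inf r \<omega> \<notin> S" by (auto split: split_indicator_asm)
    then show "P (r_inf r \<omega>)" using S(1) by auto
  qed
qed

text \<open>\<open>r_inf r\<close> is onto modulo null sets: the mass of the exceptional set equals
  the \<open>w\<close>-mass of its preimage, which vanishes.\<close>

lemma AE_r_inf_D:
  assumes "AE \<omega> in N. P (r_inf r \<omega>)" and [measurable]: "Measurable.pred N P"
  shows "AE \<omega> in N. P \<omega>"
proof -
  have "(\<integral>\<^sup>+\<omega>. indicator {\<omega>. \<not> P \<omega>} \<omega> \<partial>N) = (\<integral>\<^sup>+\<omega>. w (\<omega> 0) * indicator {\<omega>. \<not> P \<omega>} (r_inf r \<omega>) \<partial>N)"
    by (rule nn_integral_r_inf[symmetric]) measurable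
  also have "\<dots> = (\<integral>\<^sup>+\<omega>. 0 \<partial>N)"
    using assms(1) by (intro nn_integral_cong_AE) auto
  finally show ?thesis using assms(2) by (subst AE_iff_nn_integral) (simp_all add: pred_def)
qed

subsection \<open>Ergodicity and the commutant\<close>

text \<open>\<open>ergodic_map\<close> tests only strictly invariant sets, while \<open>f\<close> is
  invariant only almost everywhere. Visiting \<open>V\<close> infinitely often is a strictly
  invariant condition, and almost surely all iterates of a point have the same value of
  \<open>f\<close>.\<close>

lemma ergodic_zero_one:
  assumes erg: "ergodic_map N (r_inf r)"
    and f [measurable]: "f \<in> N \<rightarrow>\<^sub>M M'" and inv: "AE \<omega> in N. f (r_inf r \<omega>) = f \<omega>"
    and V [measurable]: "V \<in> sets M'"
  shows "(AE \<omega> in N. f \<omega> \<in> V) \<or> (AE \<omega> in N. f \<omega> \<notin> V)"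
proof -
  (* a strictly invariant set that differs from {f \<in> V} by a null set *)
  define A where "A = {\<omega> \<in> space N. \<forall>m. \<exists>k\<ge>m. f ((r_inf r ^^ k) \<omega>) \<in> V}"
  have [measurable]: "A \<in> sets N" unfolding A_def by measurable
  have "r_inf r -` A \<inter> space N = A"
  proof (intro set_eqI iffI)
    fix \<omega> assume "\<omega> \<in> r_inf r -` A \<inter> space N"
    then show "\<omega> \<in> A"
      unfolding A_def by (auto simp: funpow_swap1[symmetric]) (metis Suc_leD Suc_le_mono funpow_swap1 funpow.simps(2) o_apply)
  next
    fix \<omega> assume \<omega>: "\<omega> \<in> A"
    have "\<exists>k\<ge>m. f ((r_inf r ^^ k) (r_inf r \<omega>)) \<in> V" for m
    proof -
      obtain k where k: "k \<ge> Suc m" "f ((r_inf r ^^ k) \<omega>) \<in> V" using \<omega> by (auto simp: A_def)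
      then obtain j where "k = Suc j" by (cases k) auto
      with k show ?thesis by (auto simp: funpow_swap1 intro!: exI[of _ j])
    qed
    with \<omega> show "\<omega> \<in> r_inf r -` A \<inter> space N" by (auto simp: A_def)
  qed
  with erg have A: "emeasure N A = 0 \<or> emeasure N A = 1"
    by (auto simp: ergodic_map_def)
  have "AE \<omega> in N. f ((r_inf r ^^ k) \<omega>) = f \<omega>" for k
  proof (induction k)
    case (Suc k)
    from AE_r_inf[OF Suc] inv show ?case by eventually_elim (simp add: funpow_swap1)
  qed simp
  then have "AE \<omega> in N. \<forall>k. f ((r_inf r ^^ k) \<omega>) = f \<omega>"
    by (simp add: AE_all_countable)
  with AE_space[of N] have *: "AE \<omega> in N. \<omega> \<in> A \<longleftrightarrow> f \<omega> \<in> V"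
    by eventually_elim (auto simp: A_def)
  from A show ?thesis
  proof
    assume "emeasure N A = 0"
    then have "AE \<omega> in N. \<omega> \<notin> A" by (intro AE_not_in) (auto simp: null_sets_def)
    with * have "AE \<omega> in N. f \<omega> \<notin> V" by eventually_elim auto
    then show ?thesis ..
  next
    assume "emeasure N A = 1"
    then have "AE \<omega> in N. \<omega> \<in> A" by (subst N.AE_in_set_eq_1) (auto simp: N.emeasure_eq_measure)
    with * have "AE \<omega> in N. f \<omega> \<in> V" by eventually_elim auto
    then show ?thesis ..
  qed
qed

text \<open>The value is known in advance: a random variable is neither almost surely below nor
  almost surely above its mean, so the zero-one law excludes both sides.\<close>

lemma ergodic_invariant_real:
  fixes f :: "(nat \<Rightarrow> 'a) \<Rightarrow> real"
  assumes erg: "ergodic_map N (r_inf r)" and int: "integrable N f"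
    and inv: "AE \<omega> in N. f (r_inf r \<omega>) = f \<omega>"
  shows "AE \<omega> in N. f \<omega> = N.expectation f"
proof -
  let ?c = "N.expectation f"
  have m: "f \<in> borel_measurable N" using int by auto
  have zero_one: "(AE \<omega> in N. f \<omega> \<in> V) \<or> (AE \<omega> in N. f \<omega> \<notin> V)" if "V \<in> sets borel" for V
    by (rule ergodic_zero_one[OF erg m inv that])
  have "\<not> (AE \<omega> in N. f \<omega> \<in> {..<?c})"
    using N.expectation_less[OF int, of ?c] by auto
  then have "AE \<omega> in N. f \<omega> \<notin> {..<?c}" using zero_one[OF borel_open[OF open_lessThan[of ?c]]] by blast
  moreover have "\<not> (AE \<omega> in N. f \<omega> \<in> {?c<..})"
    using N.expectation_greater[OF int, of ?c] by auto
  then have "AE \<omega> in N. f \<omega> \<notin> {?c<..}" using zero_one[OF borel_open[OF open_greaterThan[of ?c]]] by blast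
  ultimately show ?thesis by eventually_elim auto
qed

section \<open>Square-integrable functions and fixed vectors\<close>

lemma L2_const: "(\<lambda>_. c) \<in> L2 N"
  by (simp add: L2_def)

lemma L2_bounded:
  assumes "f \<in> borel_measurable N" "AE x in N. cmod (f x) \<le> K" shows "f \<in> L2 N"
  using L2_bound[OF L2_const[of 1] assms(1), of K] assms(2) by simp

lemma L2_lincomb:
  assumes f: "f \<in> L2 M" and g: "g \<in> L2 M"
  shows "(\<lambda>x. a * f x + b * g x) \<in> L2 M"
proof -
  have [measurable]: "f \<in> borel_measurable M" "g \<in> borel_measurable M" using f g by (auto simp: L2_def)
  have "integrable M (\<lambda>x. 2 * ((cmod a)\<^sup>2 * (cmod (f x))\<^sup>2) + 2 * ((cmod b)\<^sup>2 * (cmod (g x))\<^sup>2))"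
    using f g by (simp add: L2_def)
  moreover have "(cmod (a * f x + b * g x))\<^sup>2 \<le> 2 * ((cmod a)\<^sup>2 * (cmod (f x))\<^sup>2) + 2 * ((cmod b)\<^sup>2 * (cmod (g x))\<^sup>2)" for x
  proof -
    have "(cmod (a * f x + b * g x))\<^sup>2 \<le> (cmod (a * f x) + cmod (b * g x))\<^sup>2"
      by (intro power_mono norm_triangle_ineq) simp
    also have "\<dots> \<le> 2 * (cmod (a * f x))\<^sup>2 + 2 * (cmod (b * g x))\<^sup>2"
      using sum_squares_bound[of "cmod (a * f x)" "cmod (b * g x)"] by (simp add: power2_sum)
    finally show ?thesis by (simp add: norm_mult power_mult_distrib)
  qed
  ultimately have "integrable M (\<lambda>x. (cmod (a * f x + b * g x))\<^sup>2)"
    by (intro Bochner_Integration.integrable_bound[of M _ "\<lambda>x. (cmod (a * f x + b * g x))\<^sup>2"]) auto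
  then show ?thesis by (simp add: L2_def)
qed

lemma L2_integrable:
  assumes "f \<in> L2 N" shows "integrable N f"
proof (rule Bochner_Integration.integrable_bound)
  show "integrable N (\<lambda>x. 1 + (cmod (f x))\<^sup>2)" using assms by (simp add: L2_def)
  show "f \<in> borel_measurable N" using assms by (simp add: L2_def)
  have "cmod (f x) \<le> 1 + (cmod (f x))\<^sup>2" for x
  proof -
    have "2 * cmod (f x) \<le> 1 + (cmod (f x))\<^sup>2"
      using sum_squares_bound[of "1 :: real" "cmod (f x)"] by simp
    with norm_ge_zero[of "f x"] show ?thesis by linarith
  qed
  then show "AE x in N. norm (f x) \<le> norm (1 + (cmod (f x))\<^sup>2)" by simp
qed

lemma ergodic_invariant_L2:
  assumes erg: "ergodic_map N (r_inf r)" and f: "f \<in> L2 N"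
    and inv: "AE \<omega> in N. f (r_inf r \<omega>) = f \<omega>"
  shows "\<exists>c. AE \<omega> in N. f \<omega> = c"
proof -
  have int: "integrable N f" using f by (rule L2_integrable)
  have "AE \<omega> in N. Re (f \<omega>) = N.expectation (\<lambda>\<omega>. Re (f \<omega>))"
    by (rule ergodic_invariant_real[OF erg]) (use int inv in auto)
  moreover have "AE \<omega> in N. Im (f \<omega>) = N.expectation (\<lambda>\<omega>. Im (f \<omega>))"
    by (rule ergodic_invariant_real[OF erg]) (use int inv in auto)
  ultimately have "AE \<omega> in N. f \<omega> = Complex (N.expectation (\<lambda>\<omega>. Re (f \<omega>))) (N.expectation (\<lambda>\<omega>. Im (f \<omega>)))"
    by eventually_elim (simp add: complex_eq_iff)
  then show ?thesis ..
qed

lemma indicator_AE_const: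
  assumes [measurable]: "A \<in> sets N" and c: "AE \<omega> in N. indicator A \<omega> = (c :: complex)"
  shows "emeasure N A = 0 \<or> emeasure N A = 1"
proof (cases "c = 1")
  case True
  with c have "AE \<omega> in N. \<omega> \<in> A" by (auto elim!: eventually_mono split: split_indicator_asm)
  then show ?thesis by (subst (asm) N.AE_in_set_eq_1) (auto simp: N.emeasure_eq_measure)
next
  case False
  with c have "AE \<omega> in N. \<omega> \<notin> A" by (auto elim!: eventually_mono split: split_indicator_asm)
  then show ?thesis by (metis AE_iff_null_sets assms(1) null_setsD1)
qed

lemma m0_coord0_nonzero: "AE \<omega> in N. m0 (\<omega> 0) \<noteq> 0"
  using AE_N_coord0[OF w_nonzero] by eventually_elim (auto simp: w_def)

lemma Uop_L2:
  assumes f: "f \<in> L2 N" shows "Uop r m0 f \<in> L2 N"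
proof -
  have [measurable]: "f \<in> borel_measurable N" using f by (simp add: L2_def)
  have "(\<integral>\<^sup>+\<omega>. ennreal ((cmod (Uop r m0 f \<omega>))\<^sup>2) \<partial>N) = (\<integral>\<^sup>+\<omega>. w (\<omega> 0) * ennreal ((cmod (f (r_inf r \<omega>)))\<^sup>2) \<partial>N)"
    by (simp add: Uop_def theta0_def w_def norm_mult power_mult_distrib ennreal_mult)
  also have "\<dots> = (\<integral>\<^sup>+\<omega>. ennreal ((cmod (f \<omega>))\<^sup>2) \<partial>N)"
    by (rule nn_integral_r_inf) measurable
  also have "\<dots> < \<infinity>" using f by (simp add: L2_iff)
  finally show ?thesis by (simp add: L2_iff Uop_def[abs_def] theta0_def)
qed

text \<open>Injectivity of U on classes of functions: divide by \<open>m0\<close>, then undo the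
  composition with \<open>r_inf r\<close>.\<close>

lemma Uop_cancel:
  assumes [measurable]: "f \<in> borel_measurable N" "g \<in> borel_measurable N"
    and eq: "AE \<omega> in N. Uop r m0 f \<omega> = Uop r m0 g \<omega>"
  shows "AE \<omega> in N. f \<omega> = g \<omega>"
proof (rule AE_r_inf_D)
  from eq m0_coord0_nonzero show "AE \<omega> in N. f (r_inf r \<omega>) = g (r_inf r \<omega>)"
    by eventually_elim (simp add: Uop_def theta0_def)
  show "Measurable.pred N (\<lambda>\<omega>. f \<omega> = g \<omega>)"
    unfolding pred_def by (rule measurable_equality_set) fact+
qed

definition fixed_vectors_const :: bool where
  "fixed_vectors_const \<longleftrightarrow> (\<forall>\<phi>'\<in>L2 N. (AE \<omega> in N. Uop r m0 \<phi>' \<omega> = piop m0 \<phi>' \<omega>)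
            \<longrightarrow> (\<exists>c. AE \<omega> in N. \<phi>' \<omega> = c * 1))"

text \<open>After division by \<open>m0\<close> the equation says that the vector is
  \<open>r_inf r\<close>-invariant; conversely, the indicator of an invariant set is such a
  vector.\<close>

lemma ergodic_iff_fixed_vectors_const: "ergodic_map N (r_inf r) \<longleftrightarrow> fixed_vectors_const"
proof
  assume erg: "ergodic_map N (r_inf r)"
  show fixed_vectors_const
    unfolding fixed_vectors_const_def
  proof (intro ballI impI)
    fix f assume f: "f \<in> L2 N" and eq: "AE \<omega> in N. Uop r m0 f \<omega> = piop m0 f \<omega>"
    from eq m0_coord0_nonzero have "AE \<omega> in N. f (r_inf r \<omega>) = f \<omega>"
      by eventually_elim (simp add: Uop_def piop_def theta0_def)
    from ergodic_invariant_L2[OF erg f this] show "\<exists>c. AE \<omega> in N. f \<omega> = c * 1" by simp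
  qed
next
  assume *: fixed_vectors_const
  show "ergodic_map N (r_inf r)"
    unfolding ergodic_map_def
  proof (intro ballI impI)
    fix A assume [measurable]: "A \<in> sets N" and inv: "r_inf r -` A \<inter> space N = A"
    have "indicator A \<in> L2 N" by (rule L2_bounded[where K = 1]) (auto split: split_indicator)
    moreover have "AE \<omega> in N. Uop r m0 (indicator A) \<omega> = piop m0 (indicator A) \<omega>"
      using AE_space by eventually_elim (use inv in \<open>auto simp: Uop_def piop_def split: split_indicator\<close>)
    ultimately have "\<exists>c. AE \<omega> in N. indicator A \<omega> = (c::complex) * 1"
      using * unfolding fixed_vectors_const_def by blast
    then show "emeasure N A = 0 \<or> emeasure N A = 1"
      using indicator_AE_const[of A] by auto
  qed
qed

text \<open>Multiplication by the indicator of an invariant set is a projection in the commutant. If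
  it is scalar, its value at 1 makes the indicator constant.\<close>

lemma irreducible_imp_ergodic:
  assumes irr: "wavelet_irreducible r \<mu> m0" shows "ergodic_map N (r_inf r)"
  unfolding ergodic_map_def
proof (intro ballI impI)
  fix A assume [measurable]: "A \<in> sets N" and inv: "r_inf r -` A \<inter> space N = A"
  define T where "T f \<omega> = indicator A \<omega> * f \<omega>" for f :: "(nat \<Rightarrow> 'a) \<Rightarrow> complex" and \<omega>
  have le: "cmod (T f \<omega>) \<le> 1 * cmod (f \<omega>)" for f \<omega>
    by (auto simp: T_def norm_mult split: split_indicator)
  have L2T: "T f \<in> L2 N" if "f \<in> L2 N" for f
    using that le by (intro L2_bound[OF that, of _ 1]) (auto simp: T_def[abs_def] L2_def)
  have "(\<integral>x. (cmod (T f x))\<^sup>2 \<partial>N) \<le> 1 * (\<integral>x. (cmod (f x))\<^sup>2 \<partial>N)" if "f \<in> L2 N" for f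
    using that L2T[OF that] le[of f] by (auto simp: L2_def intro!: integral_mono power_mono)
  then have "\<exists>C. \<forall>f\<in>L2 N. (\<integral>x. (cmod (T f x))\<^sup>2 \<partial>N) \<le> C * (\<integral>x. (cmod (f x))\<^sup>2 \<partial>N)" by blast
  then have "bounded_op N T"
    unfolding bounded_op_def using L2T by (auto simp: T_def algebra_simps)
  moreover have "AE \<omega> in N. T (Uop r m0 f) \<omega> = Uop r m0 (T f) \<omega>" for f
    using AE_space by eventually_elim (use inv in \<open>auto simp: T_def Uop_def split: split_indicator\<close>)
  moreover have "AE \<omega> in N. T (piop g f) \<omega> = piop g (T f) \<omega>" for f g
    by (auto simp: T_def piop_def)
  ultimately obtain c where "\<forall>f\<in>L2 N. AE \<omega> in N. T f \<omega> = c * f \<omega>"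
    using irr unfolding wavelet_irreducible_def Let_def by blast
  then have "AE \<omega> in N. T (\<lambda>_. 1) \<omega> = c * 1" using L2_const[of 1] by blast
  then have "AE \<omega> in N. indicator A \<omega> = c" by (simp add: T_def)
  then show "emeasure N A = 0 \<or> emeasure N A = 1" by (intro indicator_AE_const) auto
qed

section \<open>Operators in the commutant\<close>

context
  fixes T :: "((nat \<Rightarrow> 'a) \<Rightarrow> complex) \<Rightarrow> (nat \<Rightarrow> 'a) \<Rightarrow> complex"
  assumes T: "bounded_op N T"
begin

lemma T_L2: "f \<in> L2 N \<Longrightarrow> T f \<in> L2 N"
  using T by (simp add: bounded_op_def)

lemma T_measurable: "f \<in> L2 N \<Longrightarrow> T f \<in> borel_measurable N"
  using T_L2 by (rule L2_measurable)

lemma T_cong: "f \<in> L2 N \<Longrightarrow> g \<in> L2 N \<Longrightarrow> AE \<omega> in N. f \<omega> = g \<omega> \<Longrightarrow> AE \<omega> in N. T f \<omega> = T g \<omega>"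
  using T by (simp add: bounded_op_def)

lemma T_lincomb: "f \<in> L2 N \<Longrightarrow> g \<in> L2 N \<Longrightarrow>
    AE \<omega> in N. T (\<lambda>y. a * f y + b * g y) \<omega> = a * T f \<omega> + b * T g \<omega>"
  using T unfolding bounded_op_def by blast

lemma T_bound:
  obtains K :: real where "K \<ge> 0" "\<And>f. f \<in> L2 N \<Longrightarrow>
     (\<integral>\<^sup>+\<omega>. ennreal ((cmod (T f \<omega>))\<^sup>2) \<partial>N) \<le> ennreal K * (\<integral>\<^sup>+\<omega>. ennreal ((cmod (f \<omega>))\<^sup>2) \<partial>N)"
proof -
  from T obtain K where K: "\<And>f. f \<in> L2 N \<Longrightarrow> (\<integral>\<omega>. (cmod (T f \<omega>))\<^sup>2 \<partial>N) \<le> K * (\<integral>\<omega>. (cmod (f \<omega>))\<^sup>2 \<partial>N)"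
    unfolding bounded_op_def by blast
  show ?thesis
  proof
    \<comment> \<open>The constant in \<open>bounded_op\<close> has no prescribed sign, while the
      ennreal form of the bound needs a nonnegative one.\<close>
    show "max K 0 \<ge> 0" by simp
    fix f assume f: "f \<in> L2 N"
    have "(\<integral>\<omega>. (cmod (T f \<omega>))\<^sup>2 \<partial>N) \<le> max K 0 * (\<integral>\<omega>. (cmod (f \<omega>))\<^sup>2 \<partial>N)"
      by (rule order_trans[OF K[OF f]]) (intro mult_right_mono, auto)
    then have "ennreal (\<integral>\<omega>. (cmod (T f \<omega>))\<^sup>2 \<partial>N) \<le> ennreal (max K 0) * ennreal (\<integral>\<omega>. (cmod (f \<omega>))\<^sup>2 \<partial>N)"
      by (subst ennreal_mult[symmetric]) (auto intro: ennreal_leI)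
    moreover have "(\<integral>\<^sup>+\<omega>. ennreal ((cmod (g \<omega>))\<^sup>2) \<partial>N) = ennreal (\<integral>\<omega>. (cmod (g \<omega>))\<^sup>2 \<partial>N)" if "g \<in> L2 N" for g
      using that by (intro nn_integral_eq_integral) (auto simp: L2_def)
    ultimately show "(\<integral>\<^sup>+\<omega>. ennreal ((cmod (T f \<omega>))\<^sup>2) \<partial>N) \<le> ennreal (max K 0) * (\<integral>\<^sup>+\<omega>. ennreal ((cmod (f \<omega>))\<^sup>2) \<partial>N)"
      using f T_L2[OF f] by simp
  qed
qed

text \<open>The vectors on which T already acts as multiplication by \<open>T 1\<close>. The class
  is enlarged from indicators of coordinate events to all of L^2 by linear combinations and
  dominated limits.\<close>

definition mult_by_T1 :: "((nat \<Rightarrow> 'a) \<Rightarrow> complex) \<Rightarrow> bool" where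
  "mult_by_T1 f \<longleftrightarrow> f \<in> L2 N \<and> (AE \<omega> in N. T f \<omega> = f \<omega> * T (\<lambda>_. 1) \<omega>)"

lemma mult_by_T1_lincomb:
  assumes f: "mult_by_T1 f" and g: "mult_by_T1 g" shows "mult_by_T1 (\<lambda>x. a * f x + b * g x)"
proof -
  have L2: "f \<in> L2 N" "g \<in> L2 N" using f g by (auto simp: mult_by_T1_def)
  have "AE \<omega> in N. T f \<omega> = f \<omega> * T (\<lambda>_. 1) \<omega>" "AE \<omega> in N. T g \<omega> = g \<omega> * T (\<lambda>_. 1) \<omega>"
    using f g by (auto simp: mult_by_T1_def)
  with T_lincomb[OF L2, of a b] have "AE \<omega> in N. T (\<lambda>x. a * f x + b * g x) \<omega> = (a * f \<omega> + b * g \<omega>) * T (\<lambda>_. 1) \<omega>"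
    by eventually_elim (simp add: algebra_simps)
  with L2_lincomb[OF L2] show ?thesis by (simp add: mult_by_T1_def)
qed

lemma mult_by_T1_one: "mult_by_T1 (\<lambda>_. 1)"
  by (simp add: mult_by_T1_def L2_const)

lemma mult_by_T1_sum:
  assumes "finite I" "\<And>i. i \<in> I \<Longrightarrow> mult_by_T1 (f i)"
  shows "mult_by_T1 (\<lambda>x. \<Sum>i\<in>I. c i * f i x)"
  using assms
proof (induction I rule: finite_induct)
  case empty show ?case using mult_by_T1_lincomb[OF mult_by_T1_one mult_by_T1_one, of 0 0] by simp
next
  case (insert i I)
  then have "mult_by_T1 (\<lambda>x. c i * f i x + 1 * (\<Sum>i\<in>I. c i * f i x))"
    by (intro mult_by_T1_lincomb) auto
  with insert show ?case by simp
qed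

lemma mult_by_T1_cong:
  assumes f: "mult_by_T1 f" and g: "g \<in> borel_measurable N" and eq: "\<And>\<omega>. \<omega> \<in> space N \<Longrightarrow> f \<omega> = g \<omega>"
  shows "mult_by_T1 g"
proof -
  have ae: "AE \<omega> in N. f \<omega> = g \<omega>" using eq by (rule AE_I2)
  have fL2: "f \<in> L2 N" using f by (simp add: mult_by_T1_def)
  have gL2: "g \<in> L2 N" by (rule L2_bound[OF fL2 g, of 1]) (use ae in \<open>auto elim: eventually_mono\<close>)
  have "AE \<omega> in N. T f \<omega> = f \<omega> * T (\<lambda>_. 1) \<omega>" using f by (simp add: mult_by_T1_def)
  with T_cong[OF fL2 gL2 ae] ae have "AE \<omega> in N. T g \<omega> = g \<omega> * T (\<lambda>_. 1) \<omega>"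
    by eventually_elim simp
  with gL2 show ?thesis by (simp add: mult_by_T1_def)
qed

text \<open>\<open>T 1\<close> is only square integrable, so its product with \<open>f\<close> is
  not known to lie in L^2 beforehand. Fatou is therefore applied to the squared modulus of
  \<open>T f - s n * T 1\<close>, whose integral is bounded by the operator bound times the squared
  L^2 distance of \<open>f\<close> and \<open>s n\<close>.\<close>

lemma mult_by_T1_limit:
  assumes f: "f \<in> L2 N" and s: "\<And>n. mult_by_T1 (s n)"
    and lim: "\<And>\<omega>. \<omega> \<in> space N \<Longrightarrow> (\<lambda>n. s n \<omega>) \<longlonglongrightarrow> f \<omega>"
    and dom: "\<And>n \<omega>. \<omega> \<in> space N \<Longrightarrow> cmod (s n \<omega>) \<le> 2 * cmod (f \<omega>)"
  shows "mult_by_T1 f"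
proof -
  let ?h = "T (\<lambda>_. 1)"
  have sL2: "s n \<in> L2 N" and Ts: "AE \<omega> in N. T (s n) \<omega> = s n \<omega> * ?h \<omega>" for n
    using s[of n] by (auto simp: mult_by_T1_def)
  note [measurable] = L2_measurable[OF f] L2_measurable[OF sL2] T_measurable[OF f] T_measurable[OF sL2]
    T_measurable[OF L2_const]
  obtain K where K: "K \<ge> 0" "\<And>f. f \<in> L2 N \<Longrightarrow>
     (\<integral>\<^sup>+\<omega>. ennreal ((cmod (T f \<omega>))\<^sup>2) \<partial>N) \<le> ennreal K * (\<integral>\<^sup>+\<omega>. ennreal ((cmod (f \<omega>))\<^sup>2) \<partial>N)"
    using T_bound by blast
  have to0: "(\<lambda>n. \<integral>\<^sup>+\<omega>. ennreal ((cmod (f \<omega> - s n \<omega>))\<^sup>2) \<partial>N) \<longlonglongrightarrow> (\<integral>\<^sup>+\<omega>. 0 \<partial>N)"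
  proof (rule nn_integral_dominated_convergence)
    \<comment> \<open>9 is the square of 1 + 2, by the triangle inequality and \<open>dom\<close>;
      the 2 in \<open>dom\<close> comes from the standard approximation by simple functions.\<close>
    show "AE \<omega> in N. ennreal ((cmod (f \<omega> - s n \<omega>))\<^sup>2) \<le> 9 * ennreal ((cmod (f \<omega>))\<^sup>2)" for n
    proof (rule AE_I2)
      fix \<omega> assume "\<omega> \<in> space N"
      from dom[OF this, of n] have "cmod (f \<omega> - s n \<omega>) \<le> 3 * cmod (f \<omega>)"
        using norm_triangle_ineq4[of "f \<omega>" "s n \<omega>"] by linarith
      then have "(cmod (f \<omega> - s n \<omega>))\<^sup>2 \<le> (3 * cmod (f \<omega>))\<^sup>2" by (intro power_mono) auto
      then have "ennreal ((cmod (f \<omega> - s n \<omega>))\<^sup>2) \<le> ennreal (9 * (cmod (f \<omega>))\<^sup>2)"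
        by (intro ennreal_leI) (simp add: power_mult_distrib)
      then show "ennreal ((cmod (f \<omega> - s n \<omega>))\<^sup>2) \<le> 9 * ennreal ((cmod (f \<omega>))\<^sup>2)"
        by (simp add: ennreal_mult)
    qed
    show "(\<integral>\<^sup>+\<omega>. 9 * ennreal ((cmod (f \<omega>))\<^sup>2) \<partial>N) < \<infinity>"
      using f by (simp add: nn_integral_cmult L2_iff ennreal_mult_less_top)
    show "AE \<omega> in N. (\<lambda>n. ennreal ((cmod (f \<omega> - s n \<omega>))\<^sup>2)) \<longlonglongrightarrow> 0"
    proof (rule AE_I2)
      fix \<omega> assume "\<omega> \<in> space N"
      then have "(\<lambda>n. (cmod (f \<omega> - s n \<omega>))\<^sup>2) \<longlonglongrightarrow> (cmod (f \<omega> - f \<omega>))\<^sup>2"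
        by (intro tendsto_intros lim)
      then have "(\<lambda>n. ennreal ((cmod (f \<omega> - s n \<omega>))\<^sup>2)) \<longlonglongrightarrow> ennreal ((cmod (f \<omega> - f \<omega>))\<^sup>2)"
        by (rule tendsto_ennrealI)
      then show "(\<lambda>n. ennreal ((cmod (f \<omega> - s n \<omega>))\<^sup>2)) \<longlonglongrightarrow> 0" by simp
    qed
  qed measurable
  have le: "(\<integral>\<^sup>+\<omega>. ennreal ((cmod (T f \<omega> - s n \<omega> * ?h \<omega>))\<^sup>2) \<partial>N) \<le> ennreal K * (\<integral>\<^sup>+\<omega>. ennreal ((cmod (f \<omega> - s n \<omega>))\<^sup>2) \<partial>N)" for n
  proof -
    from T_lincomb[OF f sL2, of 1 "- 1" n] Ts[of n]
    have "AE \<omega> in N. T f \<omega> - s n \<omega> * ?h \<omega> = T (\<lambda>x. 1 * f x + (- 1) * s n x) \<omega>"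
      by eventually_elim simp
    then have "(\<integral>\<^sup>+\<omega>. ennreal ((cmod (T f \<omega> - s n \<omega> * ?h \<omega>))\<^sup>2) \<partial>N) =
        (\<integral>\<^sup>+\<omega>. ennreal ((cmod (T (\<lambda>x. 1 * f x + (- 1) * s n x) \<omega>))\<^sup>2) \<partial>N)"
      by (intro nn_integral_cong_AE) (auto elim!: eventually_mono)
    also have "\<dots> \<le> ennreal K * (\<integral>\<^sup>+\<omega>. ennreal ((cmod (1 * f \<omega> + (- 1) * s n \<omega>))\<^sup>2) \<partial>N)"
      by (rule K(2)) (rule L2_lincomb[OF f sL2])
    finally show ?thesis by simp
  qed
  have "(\<integral>\<^sup>+\<omega>. ennreal ((cmod (T f \<omega> - f \<omega> * ?h \<omega>))\<^sup>2) \<partial>N) =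
      (\<integral>\<^sup>+\<omega>. liminf (\<lambda>n. ennreal ((cmod (T f \<omega> - s n \<omega> * ?h \<omega>))\<^sup>2)) \<partial>N)"
  proof (rule nn_integral_cong)
    fix \<omega> assume "\<omega> \<in> space N"
    then have "(\<lambda>n. ennreal ((cmod (T f \<omega> - s n \<omega> * ?h \<omega>))\<^sup>2)) \<longlonglongrightarrow> ennreal ((cmod (T f \<omega> - f \<omega> * ?h \<omega>))\<^sup>2)"
      by (intro tendsto_ennrealI tendsto_intros lim)
    then show "ennreal ((cmod (T f \<omega> - f \<omega> * ?h \<omega>))\<^sup>2) = liminf (\<lambda>n. ennreal ((cmod (T f \<omega> - s n \<omega> * ?h \<omega>))\<^sup>2))"
      by (intro lim_imp_Liminf[symmetric]) auto
  qed
  also have "\<dots> \<le> liminf (\<lambda>n. \<integral>\<^sup>+\<omega>. ennreal ((cmod (T f \<omega> - s n \<omega> * ?h \<omega>))\<^sup>2) \<partial>N)"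
    by (rule nn_integral_liminf) measurable
  also have "\<dots> \<le> liminf (\<lambda>n. ennreal K * (\<integral>\<^sup>+\<omega>. ennreal ((cmod (f \<omega> - s n \<omega>))\<^sup>2) \<partial>N))"
    by (intro Liminf_mono always_eventually allI le)
  also have "\<dots> = 0"
  proof (rule lim_imp_Liminf)
    have "(\<lambda>n. ennreal K * (\<integral>\<^sup>+\<omega>. ennreal ((cmod (f \<omega> - s n \<omega>))\<^sup>2) \<partial>N)) \<longlonglongrightarrow> ennreal K * (\<integral>\<^sup>+\<omega>. 0 \<partial>N)"
      by (rule ennreal_tendsto_cmult[OF _ to0]) simp
    then show "(\<lambda>n. ennreal K * (\<integral>\<^sup>+\<omega>. ennreal ((cmod (f \<omega> - s n \<omega>))\<^sup>2) \<partial>N)) \<longlonglongrightarrow> 0" by simp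
  qed simp
  finally have "(\<integral>\<^sup>+\<omega>. ennreal ((cmod (T f \<omega> - f \<omega> * ?h \<omega>))\<^sup>2) \<partial>N) = 0" by simp
  then have "AE \<omega> in N. ennreal ((cmod (T f \<omega> - f \<omega> * ?h \<omega>))\<^sup>2) = 0"
    by (subst (asm) nn_integral_0_iff_AE) auto
  then have "AE \<omega> in N. T f \<omega> = f \<omega> * ?h \<omega>" by eventually_elim simp
  with f show ?thesis by (simp add: mult_by_T1_def)
qed

context
  assumes comm_U: "\<And>f. f \<in> L2 N \<Longrightarrow> AE \<omega> in N. T (Uop r m0 f) \<omega> = Uop r m0 (T f) \<omega>"
    and comm_pi: "\<And>g f. ess_bounded \<mu> g \<Longrightarrow> f \<in> L2 N \<Longrightarrow> AE \<omega> in N. T (piop g f) \<omega> = piop g (T f) \<omega>"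
begin

text \<open>Commutation with \<open>piop\<close> covers coordinate 0. U turns a function of
  \<open>\<omega> (Suc n)\<close> into one of \<open>\<omega> n\<close>, so the induction applies U,
  uses the hypothesis on \<open>Uop r m0 f\<close>, and cancels U.\<close>

lemma T_commutes_coord:
  assumes B [measurable]: "B \<in> sets borel" and f: "f \<in> L2 N"
  shows "AE \<omega> in N. T (\<lambda>\<omega>. indicator B (\<omega> n) * f \<omega>) \<omega> = indicator B (\<omega> n) * T f \<omega>"
  using f
proof (induction n arbitrary: f)
  case 0
  have "ess_bounded \<mu> (indicator B)"
    by (auto simp: ess_bounded_def intro!: exI[of _ 1] split: split_indicator)
  from comm_pi[OF this 0] show ?case by (simp add: piop_def[abs_def] theta0_def)
next
  case (Suc n)
  let ?g = "\<lambda>\<omega>. indicator B (\<omega> (Suc n)) * f \<omega>"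
  have [measurable]: "f \<in> borel_measurable N" using Suc.prems by (rule L2_measurable)
  have g: "?g \<in> L2 N"
    by (rule L2_bound[OF Suc.prems, of _ 1]) (auto simp: norm_mult split: split_indicator)
  have Ug: "Uop r m0 ?g = (\<lambda>\<omega>. indicator B (\<omega> n) * Uop r m0 f \<omega>)"
    by (simp add: Uop_def fun_eq_iff)
  show ?case
  proof (rule Uop_cancel)
    show "T ?g \<in> borel_measurable N" using g by (rule T_measurable)
    show "(\<lambda>\<omega>. indicator B (\<omega> (Suc n)) * T f \<omega>) \<in> borel_measurable N"
      using T_measurable[OF Suc.prems] by measurable
    have UT: "Uop r m0 (\<lambda>\<omega>. indicator B (\<omega> (Suc n)) * T f \<omega>) \<omega> = indicator B (\<omega> n) * Uop r m0 (T f) \<omega>" for \<omega>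
      by (simp add: Uop_def)
    from comm_U[OF g] comm_U[OF Suc.prems] Suc.IH[OF Uop_L2[OF Suc.prems]]
    show "AE \<omega> in N. Uop r m0 (T ?g) \<omega> = Uop r m0 (\<lambda>\<omega>. indicator B (\<omega> (Suc n)) * T f \<omega>) \<omega>"
      unfolding Ug by eventually_elim (simp add: UT)
  qed
qed

lemma mult_by_T1_indicator:
  assumes "A \<in> sets N" shows "mult_by_T1 (indicator A)"
proof -
  have L2: "(indicator A :: _ \<Rightarrow> complex) \<in> L2 N" if "A \<in> sets N" for A
    using that by (intro L2_bounded[where K = 1]) (auto split: split_indicator)
  have "A \<in> sigma_sets (solenoid r) coord_sets" using assms by (simp add: sets_N_eq_sigma)
  with Int_stable_coord_sets coord_sets_subset show ?thesis
  proof (induction rule: sigma_sets_induct_disjoint)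
    case (basic A)
    then obtain n B where A: "A = {\<omega> \<in> solenoid r. \<omega> n \<in> B}" and [measurable]: "B \<in> sets borel"
      by (auto simp: coord_sets_def)
    have "A \<in> sets N" using basic by (simp add: sets_N_eq_sigma)
    have "mult_by_T1 (\<lambda>\<omega>. indicator B (\<omega> n) * 1)"
      using T_commutes_coord[of B "\<lambda>_. 1" n] by (auto simp: mult_by_T1_def L2_const intro!: L2_bounded[where K = 1] split: split_indicator)
    then show ?case
    proof (rule mult_by_T1_cong)
      show "indicator A \<in> borel_measurable N" using \<open>A \<in> sets N\<close> by simp
      show "indicator B (\<omega> n) * 1 = (indicator A \<omega> :: complex)" if "\<omega> \<in> space N" for \<omega>
        using that by (auto simp: A split: split_indicator)
    qed
  next
    case empty
    show ?case using mult_by_T1_sum[of "{}"] by (simp add: indicator_def[abs_def])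
  next
    case (compl A)
    then have "A \<in> sets N" by (simp add: sets_N_eq_sigma)
    have "mult_by_T1 (\<lambda>x. 1 * 1 + (- 1) * indicator A x)"
      by (rule mult_by_T1_lincomb[OF mult_by_T1_one compl(2)])
    then show ?case
    proof (rule mult_by_T1_cong)
      have "solenoid r - A \<in> sets N" using sets.compl_sets[OF \<open>A \<in> sets N\<close>] by simp
      then show "indicator (solenoid r - A) \<in> borel_measurable N" by simp
    qed (auto split: split_indicator)
  next
    case (union A)
    then have A: "A i \<in> sets N" for i by (auto simp: sets_N_eq_sigma)
    show ?case
    proof (rule mult_by_T1_limit)
      show "indicator (\<Union>i. A i) \<in> L2 N" using A by (intro L2) auto
      show "mult_by_T1 (\<lambda>x. \<Sum>i<n. 1 * indicator (A i) x)" for n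
        using union(3) by (intro mult_by_T1_sum) auto
      have eq: "(\<Sum>i<n. 1 * indicator (A i) x) = (indicator (\<Union>i<n. A i) x :: complex)" for n x
        using union(1) by (subst indicator_UN_disjoint) (auto simp: disjoint_family_on_def)
      show "(\<lambda>n. \<Sum>i<n. 1 * indicator (A i) x) \<longlonglongrightarrow> (indicator (\<Union>i. A i) x :: complex)" for x
        unfolding eq by (rule LIMSEQ_indicator_UN)
      show "cmod (\<Sum>i<n. 1 * indicator (A i) x) \<le> 2 * cmod (indicator (\<Union>i. A i) x)" for n x
        unfolding eq by (auto split: split_indicator)
    qed
  qed
qed

lemma mult_by_T1_L2:
  assumes f: "f \<in> L2 N" shows "mult_by_T1 f"
proof -
  have "f \<in> borel_measurable N" using f by (rule L2_measurable)
  from borel_measurable_implies_sequence_metric[OF this, of 0]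
  obtain s where s: "\<And>i. simple_function N (s i)" "\<And>x. x \<in> space N \<Longrightarrow> (\<lambda>i. s i x) \<longlonglongrightarrow> f x"
    "\<And>i x. x \<in> space N \<Longrightarrow> dist (s i x) 0 \<le> 2 * dist (f x) 0"
    by blast
  show ?thesis
  proof (rule mult_by_T1_limit[OF f])
    show "(\<lambda>i. s i x) \<longlonglongrightarrow> f x" "cmod (s i x) \<le> 2 * cmod (f x)" if "x \<in> space N" for x i
      using s(2)[OF that] s(3)[OF that, of i] by auto
    fix i
    have fin: "finite (s i ` space N)" using s(1)[of i] by (simp add: simple_function_def)
    have m: "s i -` {y} \<inter> space N \<in> sets N" for y using s(1)[of i] by (rule simple_functionD)
    have "mult_by_T1 (\<lambda>x. \<Sum>y\<in>s i ` space N. y * indicator (s i -` {y} \<inter> space N) x)"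
      using fin m by (intro mult_by_T1_sum mult_by_T1_indicator)
    then show "mult_by_T1 (s i)"
    proof (rule mult_by_T1_cong)
      show "s i \<in> borel_measurable N" using s(1) by (rule borel_measurable_simple_function)
      fix x assume x: "x \<in> space N"
      have "(\<Sum>y\<in>s i ` space N. y * indicator (s i -` {y} \<inter> space N) x) = (\<Sum>y\<in>s i ` space N. if y = s i x then y else 0)"
        using x by (intro sum.cong) (auto split: split_indicator)
      also have "\<dots> = s i x" using fin x by (subst sum.delta) auto
      finally show "(\<Sum>y\<in>s i ` space N. y * indicator (s i -` {y} \<inter> space N) x) = s i x" .
    qed
  qed
qed

text \<open>Evaluate \<open>T (U 1)\<close> twice: as multiplication it is \<open>U 1 * T 1\<close>,
  by commutation it is \<open>U (T 1)\<close>. Both carry the factor \<open>m0 (\<omega> 0)\<close>,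
  which cancels.\<close>

lemma T1_invariant: "AE \<omega> in N. T (\<lambda>_. 1) (r_inf r \<omega>) = T (\<lambda>_. 1) \<omega>"
proof -
  have "AE \<omega> in N. T (Uop r m0 (\<lambda>_. 1)) \<omega> = Uop r m0 (\<lambda>_. 1) \<omega> * T (\<lambda>_. 1) \<omega>"
    using mult_by_T1_L2[OF Uop_L2[OF L2_const]] by (simp add: mult_by_T1_def)
  with comm_U[OF L2_const[of 1]] m0_coord0_nonzero show ?thesis
    by eventually_elim (simp add: Uop_def theta0_def)
qed

lemma T_scalar:
  assumes erg: "ergodic_map N (r_inf r)"
  shows "\<exists>c. \<forall>f\<in>L2 N. AE \<omega> in N. T f \<omega> = c * f \<omega>"
proof -
  obtain c where c: "AE \<omega> in N. T (\<lambda>_. 1) \<omega> = c"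
    using ergodic_invariant_L2[OF erg T_L2[OF L2_const] T1_invariant] by blast
  have "AE \<omega> in N. T f \<omega> = c * f \<omega>" if "f \<in> L2 N" for f
    using mult_by_T1_L2[OF that] c unfolding mult_by_T1_def by (auto elim: eventually_elim2)
  then show ?thesis by blast
qed

end

end

lemma irreducible_iff_ergodic: "wavelet_irreducible r \<mu> m0 \<longleftrightarrow> ergodic_map N (r_inf r)"
  using irreducible_imp_ergodic T_scalar unfolding wavelet_irreducible_def Let_def by blast

subsection \<open>Harmonic functions\<close>

text \<open>A normal form of the fixed point condition on \<open>transfer_op\<close>: values in
  [0,1], with the bound everywhere rather than essentially, so that it can be used directly with
  \<open>tr\<close>.\<close>

definition nn_harmonic_const :: bool where
  "nn_harmonic_const \<longleftrightarrow> (\<forall>f\<in>borel_measurable borel. (\<forall>x. f x \<le> 1) \<longrightarrow> (AE x in \<mu>. tr f x = f x)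
     \<longrightarrow> (\<exists>c. AE x in \<mu>. f x = c))"

text \<open>\<open>h\<close> is the conditional probability of \<open>A\<close> given the starting
  point, morally P_x(A), obtained as a Radon-Nikodym derivative. Invariance of \<open>A\<close>
  makes it harmonic.\<close>

lemma invariant_set_conditional:
  assumes A [measurable]: "A \<in> sets N" and inv: "r_inf r -` A \<inter> space N = A"
  obtains h where "h \<in> borel_measurable borel" "\<And>x. h x \<le> 1" "AE x in \<mu>. tr h x = h x"
    "\<And>\<phi>. \<phi> \<in> borel_measurable borel \<Longrightarrow>
       (\<integral>\<^sup>+\<omega>. \<phi> (\<omega> 0) * indicator A \<omega> \<partial>N) = (\<integral>\<^sup>+x. \<phi> x * h x \<partial>\<mu>)"
proof -
  define \<nu> where "\<nu> = distr (density N (indicator A)) borel (\<lambda>\<omega>. \<omega> 0)"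
  have sets_nu: "sets \<nu> = sets \<mu>" by (simp add: \<nu>_def)
  have nu: "(\<integral>\<^sup>+x. \<phi> x \<partial>\<nu>) = (\<integral>\<^sup>+\<omega>. \<phi> (\<omega> 0) * indicator A \<omega> \<partial>N)" if [measurable]: "\<phi> \<in> borel_measurable borel" for \<phi>
    unfolding \<nu>_def by (subst nn_integral_distr) (simp_all add: nn_integral_density mult.commute)
  have nu_le: "(\<integral>\<^sup>+x. \<phi> x \<partial>\<nu>) \<le> (\<integral>\<^sup>+x. \<phi> x \<partial>\<mu>)" if [measurable]: "\<phi> \<in> borel_measurable borel" for \<phi>
  proof -
    have "(\<integral>\<^sup>+\<omega>. \<phi> (\<omega> 0) * indicator A \<omega> \<partial>N) \<le> (\<integral>\<^sup>+\<omega>. \<phi> (\<omega> 0) \<partial>N)"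
      by (intro nn_integral_mono) (auto split: split_indicator)
    then show ?thesis by (simp add: nu nn_integral_N_coord0)
  qed
  have ac: "absolutely_continuous \<mu> \<nu>"
    unfolding absolutely_continuous_def
  proof
    fix B assume "B \<in> null_sets \<mu>"
    then have B: "B \<in> sets borel" "emeasure \<mu> B = 0" by (auto simp: null_sets_def)
    then have "emeasure \<nu> B \<le> emeasure \<mu> B" using nu_le[of "indicator B"] sets_nu by simp
    with B sets_nu show "B \<in> null_sets \<nu>" by (auto simp: null_sets_def)
  qed
  define h0 where "h0 = RN_deriv \<mu> \<nu>"
  have h0 [measurable]: "h0 \<in> borel_measurable borel"
    using borel_measurable_RN_deriv[of \<mu> \<nu>] by (simp add: h0_def)
  have h0_int: "(\<integral>\<^sup>+\<omega>. \<phi> (\<omega> 0) * indicator A \<omega> \<partial>N) = (\<integral>\<^sup>+x. \<phi> x * h0 x \<partial>\<mu>)"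
    if [measurable]: "\<phi> \<in> borel_measurable borel" for \<phi>
    using mu.RN_deriv_nn_integral[OF ac sets_nu, of \<phi>] by (simp add: nu h0_def mult.commute)
  have h0_le: "AE x in \<mu>. h0 x \<le> 1"
  proof -
    \<comment> \<open>On this set the derivative exceeds 1; unless the set were null, its \<nu>-mass
      would be larger than its \<mu>-mass, against \<open>nu_le\<close>.\<close>
    let ?B = "{x. h0 x > 1}"
    have "AE x in \<mu>. h0 x * indicator ?B x \<le> indicator ?B x"
    proof (rule ccontr)
      assume "\<not> (AE x in \<mu>. h0 x * indicator ?B x \<le> indicator ?B x)"
      then have "(\<integral>\<^sup>+x. indicator ?B x \<partial>\<mu>) < (\<integral>\<^sup>+x. h0 x * indicator ?B x \<partial>\<mu>)"
        by (intro nn_integral_less) (auto split: split_indicator)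
      also have "\<dots> = (\<integral>\<^sup>+\<omega>. indicator ?B (\<omega> 0) * indicator A \<omega> \<partial>N)"
        by (subst h0_int) (simp_all add: mult.commute)
      also have "\<dots> = (\<integral>\<^sup>+x. indicator ?B x \<partial>\<nu>)"
        by (rule nu[symmetric]) measurable
      also have "\<dots> \<le> (\<integral>\<^sup>+x. indicator ?B x \<partial>\<mu>)" by (rule nu_le) measurable
      finally show False by simp
    qed
    then show ?thesis by eventually_elim (auto split: split_indicator_asm simp: not_less[symmetric])
  qed
  have h0_harm: "AE x in \<mu>. tr h0 x = h0 x"
  proof (rule mu.density_unique_finite_measure)
    fix B assume "B \<in> sets \<mu>"
    then have [measurable]: "B \<in> sets borel" by simp
    have "(\<integral>\<^sup>+x. tr h0 x * indicator B x \<partial>\<mu>) = (\<integral>\<^sup>+x. tr (\<lambda>y. indicator B (r y) * h0 y) x \<partial>\<mu>)"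
      by (subst tr_comp) (simp add: mult.commute)
    also have "\<dots> = (\<integral>\<^sup>+x. (w x * indicator B (r x)) * h0 x \<partial>\<mu>)"
      by (subst nn_integral_tr) (auto simp: mult.assoc)
    also have "\<dots> = (\<integral>\<^sup>+\<omega>. (w (\<omega> 0) * indicator B (r (\<omega> 0))) * indicator A \<omega> \<partial>N)"
      by (rule h0_int[symmetric]) measurable
    \<comment> \<open>Since \<open>r (\<omega> 0)\<close> is coordinate 0 of
      \<open>r_inf r \<omega>\<close> and \<open>A\<close> is invariant, the integrand other than
      \<open>w\<close> is a function of \<open>r_inf r \<omega>\<close>, so the change of variables
      applies.\<close>
    also have "\<dots> = (\<integral>\<^sup>+\<omega>. w (\<omega> 0) * (indicator B (r_inf r \<omega> 0) * indicator A (r_inf r \<omega>)) \<partial>N)"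
      by (intro nn_integral_cong) (use inv in \<open>auto split: split_indicator\<close>)
    also have "\<dots> = (\<integral>\<^sup>+\<omega>. indicator B (\<omega> 0) * indicator A \<omega> \<partial>N)"
      by (rule nn_integral_r_inf) measurable
    also have "\<dots> = (\<integral>\<^sup>+x. h0 x * indicator B x \<partial>\<mu>)"
      by (subst h0_int) (auto simp: mult.commute)
    finally show "(\<integral>\<^sup>+x. tr h0 x * indicator B x \<partial>\<mu>) = (\<integral>\<^sup>+x. h0 x * indicator B x \<partial>\<mu>)" .
  qed auto
  \<comment> \<open>Truncation turns the almost-everywhere bound into one that holds
    everywhere.\<close>
  define h where "h x = min (h0 x) 1" for x
  have hh0: "AE x in \<mu>. h x = h0 x" using h0_le by eventually_elim (simp add: h_def min_def)
  show ?thesis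
  proof
    show [measurable]: "h \<in> borel_measurable borel" unfolding h_def[abs_def] by measurable
    show "h x \<le> 1" for x by (simp add: h_def)
    from tr_AE_cong[OF hh0] h0_harm hh0 show "AE x in \<mu>. tr h x = h x" by eventually_elim simp
    fix \<phi> :: "'a \<Rightarrow> ennreal" assume "\<phi> \<in> borel_measurable borel"
    from h0_int[OF this] show "(\<integral>\<^sup>+\<omega>. \<phi> (\<omega> 0) * indicator A \<omega> \<partial>N) = (\<integral>\<^sup>+x. \<phi> x * h x \<partial>\<mu>)"
      using hh0 by (auto intro!: nn_integral_cong_AE elim!: eventually_mono)
  qed
qed

text \<open>If the conditional probability of \<open>A\<close> is a constant c, then
  \<open>A\<close> is independent of each coordinate: n changes of variables move
  \<open>\<omega> n\<close> to \<open>\<omega> 0\<close> without moving \<open>A\<close>. On the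
  generating events the indicator of \<open>A\<close> thus has the same integrals as c, so it equals
  c almost everywhere.\<close>

lemma nn_harmonic_const_imp_ergodic:
  assumes nn_harmonic_const shows "ergodic_map N (r_inf r)"
  unfolding ergodic_map_def
proof (intro ballI impI)
  fix A assume A [measurable]: "A \<in> sets N" and inv: "r_inf r -` A \<inter> space N = A"
  obtain h where h [measurable]: "h \<in> borel_measurable borel" "\<And>x. h x \<le> 1" "AE x in \<mu>. tr h x = h x"
    and h_int: "\<And>\<phi>. \<phi> \<in> borel_measurable borel \<Longrightarrow>
       (\<integral>\<^sup>+\<omega>. \<phi> (\<omega> 0) * indicator A \<omega> \<partial>N) = (\<integral>\<^sup>+x. \<phi> x * h x \<partial>\<mu>)"
    using invariant_set_conditional[OF A inv] by blast
  then obtain c where c: "AE x in \<mu>. h x = c" using assms unfolding nn_harmonic_const_def by blast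
  have sp: "(r_inf r ^^ n) \<omega> \<in> space N" if "\<omega> \<in> space N" for n \<omega>
    using measurable_space[OF funpow_r_inf_measurable that] .
  have Ainv: "(r_inf r ^^ n) \<omega> \<in> A \<longleftrightarrow> \<omega> \<in> A" if "\<omega> \<in> space N" for n \<omega>
  proof (induction n)
    case (Suc n)
    have "r_inf r \<eta> \<in> A \<longleftrightarrow> \<eta> \<in> A" if "\<eta> \<in> space N" for \<eta> using that inv by auto
    from this[OF sp[OF \<open>\<omega> \<in> space N\<close>, of n]] Suc show ?case by simp
  qed simp
  have "density N (indicator A) = density N (\<lambda>_. c)"
  proof (rule measure_eq_on_coord_sets)
    show "emeasure (density N (indicator A)) (solenoid r) \<noteq> \<infinity>"
      using sets.top[of N] N.emeasure_finite[of A] by (simp add: emeasure_density nn_integral_indicator Int_absorb2 flip: indicator_inter_arith)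
    fix n and B :: "'a set" assume [measurable]: "B \<in> sets borel"
    have S: "{\<omega> \<in> solenoid r. \<omega> n \<in> B} \<in> sets N"
      using coord_setsI[of B n] by (simp add: sets_N_eq_sigma)
    have "emeasure (density N (indicator A)) {\<omega> \<in> solenoid r. \<omega> n \<in> B} = (\<integral>\<^sup>+\<omega>. indicator B (\<omega> n) * indicator A \<omega> \<partial>N)"
      using S by (subst emeasure_density) (auto intro!: nn_integral_cong split: split_indicator)
    also have "\<dots> = (\<integral>\<^sup>+\<omega>. w_iter n (\<omega> 0) * (indicator B ((r_inf r ^^ n) \<omega> n) * indicator A ((r_inf r ^^ n) \<omega>)) \<partial>N)"
      by (rule nn_integral_funpow_r_inf[symmetric]) measurable
    also have "\<dots> = (\<integral>\<^sup>+\<omega>. (w_iter n (\<omega> 0) * indicator B (\<omega> 0)) * indicator A \<omega> \<partial>N)"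
      using Ainv funpow_r_inf_coord[of n _ 0] by (intro nn_integral_cong) (auto split: split_indicator)
    also have "\<dots> = (\<integral>\<^sup>+x. (w_iter n x * indicator B x) * h x \<partial>\<mu>)" by (rule h_int) measurable
    also have "\<dots> = (\<integral>\<^sup>+x. c * (w_iter n x * indicator B x) \<partial>\<mu>)"
      using c by (intro nn_integral_cong_AE) (auto elim!: eventually_mono simp: mult.commute)
    also have "\<dots> = c * (\<integral>\<^sup>+\<omega>. indicator B (\<omega> n) \<partial>N)"
      by (simp add: nn_integral_cmult nn_integral_N_coord)
    also have "\<dots> = emeasure (density N (\<lambda>_. c)) {\<omega> \<in> solenoid r. \<omega> n \<in> B}"
      using S by (subst emeasure_density) (auto simp: nn_integral_cmult[symmetric] intro!: nn_integral_cong split: split_indicator)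
    finally show "emeasure (density N (indicator A)) {\<omega> \<in> solenoid r. \<omega> n \<in> B} =
      emeasure (density N (\<lambda>_. c)) {\<omega> \<in> solenoid r. \<omega> n \<in> B}" .
  qed simp_all
  then have "AE \<omega> in N. indicator A \<omega> = c" by (subst (asm) N.density_unique_iff) auto
  then have "AE \<omega> in N. indicator A \<omega> = complex_of_real (enn2real c)"
    by eventually_elim (auto split: split_indicator)
  with A show "emeasure N A = 0 \<or> emeasure N A = 1" by (rule indicator_AE_const)
qed

section \<open>Bounded real and complex harmonic functions\<close>

definition trR :: "('a \<Rightarrow> real) \<Rightarrow> 'a \<Rightarrow> real" where
  "trR u x = (\<Sum>y\<in>fib r x. Wt r m0 y * u y)"

lemma tr_ennreal: "(\<And>y. 0 \<le> u y) \<Longrightarrow> tr (\<lambda>y. ennreal (u y)) x = ennreal (trR u x)"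
  unfolding tr_def trR_def by (subst sum_ennreal[symmetric]) (auto simp: ennreal_mult intro!: sum.cong)

lemma trR_nonneg: "(\<And>y. 0 \<le> u y) \<Longrightarrow> 0 \<le> trR u x"
  unfolding trR_def by (intro sum_nonneg) auto

lemma trR_const: "trR (\<lambda>_. c) x = c"
proof -
  have "trR (\<lambda>_. 1) x = 1"
    using tr_ennreal[of "\<lambda>_. 1" x] trR_nonneg[of "\<lambda>_. 1" x] by (simp add: tr_const)
  then show ?thesis by (simp add: trR_def flip: sum_distrib_right)
qed

lemma trR_affine: "trR (\<lambda>y. a * u y + b) x = a * trR u x + b"
proof -
  have "trR (\<lambda>y. a * u y + b) x = a * trR u x + trR (\<lambda>_. b) x"
    by (simp add: trR_def sum.distrib sum_distrib_left algebra_simps)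
  then show ?thesis by (simp add: trR_const)
qed

lemma trR_AE_cong:
  assumes "AE x in \<mu>. f x = g x" shows "AE x in \<mu>. trR f x = trR g x"
  using AE_fib[OF assms] by eventually_elim (auto simp: trR_def intro: sum.cong)

lemma transfer_op_eq: "transfer_op r m0 h x = (\<Sum>y\<in>fib r x. of_real (Wt r m0 y) * h y)"
  unfolding transfer_op_def sum_divide_distrib by (intro sum.cong) (auto simp: Wt_def)

lemma Re_transfer_op: "Re (transfer_op r m0 h x) = trR (\<lambda>y. Re (h y)) x"
  and Im_transfer_op: "Im (transfer_op r m0 h x) = trR (\<lambda>y. Im (h y)) x"
  by (simp_all add: transfer_op_eq trR_def)

lemma real_harmonic_const:
  assumes nn_harmonic_const
    and [measurable]: "u \<in> borel_measurable borel" and bd: "AE x in \<mu>. \<bar>u x\<bar> \<le> B"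
    and harm: "AE x in \<mu>. trR u x = u x"
  shows "\<exists>c. AE x in \<mu>. u x = c"
proof -
  \<comment> \<open>\<open>B\<close> may be zero, so it is enlarged before dividing by it.\<close>
  define B' where "B' = max B 1"
  have B': "B' > 0" "B \<le> B'" by (auto simp: B'_def)
  \<comment> \<open>The affine map sends [-B', B'] onto [0,1] and commutes with \<open>trR\<close>;
    the clamp changes \<open>u\<close> only on a null set but gives the bounds everywhere.\<close>
  define v where "v x = max 0 (min 1 (1 / (2 * B') * u x + 1 / 2))" for x
  have vu: "AE x in \<mu>. v x = 1 / (2 * B') * u x + 1 / 2"
    using bd
  proof eventually_elim
    fix x assume "\<bar>u x\<bar> \<le> B"
    then have "- B' \<le> u x" "u x \<le> B'" using B' by auto
    then have "0 \<le> 1 / (2 * B') * u x + 1 / 2" "1 / (2 * B') * u x + 1 / 2 \<le> 1"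
      using B' by (auto simp: field_simps)
    then show "v x = 1 / (2 * B') * u x + 1 / 2" by (simp add: v_def)
  qed
  have v0: "0 \<le> v x" "v x \<le> 1" for x by (auto simp: v_def)
  have [measurable]: "v \<in> borel_measurable borel" unfolding v_def[abs_def] by measurable
  from trR_AE_cong[OF vu] harm vu have "AE x in \<mu>. tr (\<lambda>y. ennreal (v y)) x = ennreal (v x)"
    by eventually_elim (simp only: tr_ennreal[OF v0(1)] trR_affine)
  then obtain c where "AE x in \<mu>. ennreal (v x) = c"
    using assms(1) v0 unfolding nn_harmonic_const_def by (auto dest!: bspec[of _ _ "\<lambda>x. ennreal (v x)"])
  then have "AE x in \<mu>. u x = 2 * B' * (enn2real c - 1 / 2)"
    using vu
  proof eventually_elim
    fix x assume "ennreal (v x) = c" and "v x = 1 / (2 * B') * u x + 1 / 2"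
    then have "enn2real c = 1 / (2 * B') * u x + 1 / 2" using v0[of x] by auto
    then show "u x = 2 * B' * (enn2real c - 1 / 2)" using B' by (simp add: field_simps)
  qed
  then show ?thesis by blast
qed

definition bounded_harmonic_const :: bool where
  "bounded_harmonic_const \<longleftrightarrow> (\<forall>h. ess_bounded \<mu> h \<and> (AE x in \<mu>. transfer_op r m0 h x = h x)
             \<longrightarrow> (\<exists>c. AE x in \<mu>. h x = c))"

lemma bounded_harmonic_const_iff: "bounded_harmonic_const \<longleftrightarrow> nn_harmonic_const"
proof
  assume *: bounded_harmonic_const
  show nn_harmonic_const
    unfolding nn_harmonic_const_def
  proof (intro ballI impI)
    fix f :: "'a \<Rightarrow> ennreal" assume [measurable]: "f \<in> borel_measurable borel"
      and le: "\<forall>x. f x \<le> 1" and harm: "AE x in \<mu>. tr f x = f x"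
    define u where "u x = enn2real (f x)" for x
    have fu: "f = (\<lambda>x. ennreal (u x))"
      using le unfolding u_def by (auto simp: fun_eq_iff) (metis ennreal_enn2real ennreal_one_less_top order.strict_trans1)
    have u0: "0 \<le> u x" "u x \<le> 1" for x
      using le by (auto simp: u_def intro: enn2real_leI)
    have "ess_bounded \<mu> (\<lambda>x. complex_of_real (u x))"
      unfolding ess_bounded_def using u0 by (auto simp: u_def intro!: exI[of _ 1])
    moreover from harm have "AE x in \<mu>. transfer_op r m0 (\<lambda>x. complex_of_real (u x)) x = complex_of_real (u x)"
    proof eventually_elim
      fix x assume "tr f x = f x"
      then have "trR u x = u x" using u0 trR_nonneg[of u x] by (simp add: fu tr_ennreal)
      then show "transfer_op r m0 (\<lambda>x. complex_of_real (u x)) x = complex_of_real (u x)"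
        by (simp add: complex_eq_iff Re_transfer_op Im_transfer_op trR_const)
    qed
    ultimately obtain c where "AE x in \<mu>. complex_of_real (u x) = c"
      using * unfolding bounded_harmonic_const_def by blast
    then have "AE x in \<mu>. f x = ennreal (Re c)" unfolding fu by eventually_elim auto
    then show "\<exists>c. AE x in \<mu>. f x = c" by blast
  qed
next
  assume *: nn_harmonic_const
  show bounded_harmonic_const
    unfolding bounded_harmonic_const_def
  proof (intro allI impI, elim conjE)
    fix h assume bd: "ess_bounded \<mu> h" and harm: "AE x in \<mu>. transfer_op r m0 h x = h x"
    from bd obtain B where [measurable]: "h \<in> borel_measurable borel" and B: "AE x in \<mu>. cmod (h x) \<le> B"
      by (auto simp: ess_bounded_def)
    have "AE x in \<mu>. \<bar>Re (h x)\<bar> \<le> B" "AE x in \<mu>. \<bar>Im (h x)\<bar> \<le> B"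
      using B by (auto elim!: eventually_mono intro: order_trans[OF abs_Re_le_cmod] order_trans[OF abs_Im_le_cmod])
    moreover have "AE x in \<mu>. trR (\<lambda>x. Re (h x)) x = Re (h x)" "AE x in \<mu>. trR (\<lambda>x. Im (h x)) x = Im (h x)"
      using harm by (auto elim!: eventually_mono simp: Re_transfer_op[symmetric] Im_transfer_op[symmetric])
    ultimately obtain c d where "AE x in \<mu>. Re (h x) = c" "AE x in \<mu>. Im (h x) = d"
      using real_harmonic_const[OF *, of "\<lambda>x. Re (h x)" B] real_harmonic_const[OF *, of "\<lambda>x. Im (h x)" B] by auto
    then have "AE x in \<mu>. h x = Complex c d" by eventually_elim (simp add: complex_eq_iff)
    then show "\<exists>c. AE x in \<mu>. h x = c" by blast
  qed
qed

section \<open>The martingale along a path\<close>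

text \<open>Test functions of \<open>\<omega> n\<close> alone suffice, as earlier coordinates are
  functions of it. Each step writes everything through the later coordinate, passes to \<mu> with
  the density \<open>w_iter\<close>, and trades one factor \<open>w\<close> for a \<open>tr\<close>
  that harmonicity removes.\<close>

lemma martingale:
  assumes [measurable]: "f \<in> borel_measurable borel" "\<phi> \<in> borel_measurable borel"
    and harm: "AE x in \<mu>. tr f x = f x"
  shows "(\<integral>\<^sup>+\<omega>. \<phi> (\<omega> n) * f (\<omega> (n + k)) \<partial>N) = (\<integral>\<^sup>+\<omega>. \<phi> (\<omega> n) * f (\<omega> n) \<partial>N)"
proof (induction k)
  case (Suc k)
  let ?m = "n + k"
  let ?\<psi> = "\<lambda>x. \<phi> ((r ^^ k) x)"
  have "(\<integral>\<^sup>+\<omega>. \<phi> (\<omega> n) * f (\<omega> (n + Suc k)) \<partial>N) = (\<integral>\<^sup>+\<omega>. ?\<psi> (r (\<omega> (Suc ?m))) * f (\<omega> (Suc ?m)) \<partial>N)"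
    using solenoid_iterate[of _ "Suc k" n] by (intro nn_integral_cong) (simp add: funpow_swap1)
  also have "\<dots> = (\<integral>\<^sup>+x. w_iter (Suc ?m) x * (?\<psi> (r x) * f x) \<partial>\<mu>)"
    by (rule nn_integral_N_coord) measurable
  also have "\<dots> = (\<integral>\<^sup>+x. w x * ((\<lambda>x. w_iter ?m x * ?\<psi> x) (r x) * f x) \<partial>\<mu>)"
    by (simp add: w_iter_Suc mult.assoc)
  also have "\<dots> = (\<integral>\<^sup>+x. tr (\<lambda>x. (\<lambda>x. w_iter ?m x * ?\<psi> x) (r x) * f x) x \<partial>\<mu>)"
    by (rule nn_integral_tr[symmetric]) measurable
  also have "\<dots> = (\<integral>\<^sup>+x. (\<lambda>x. w_iter ?m x * ?\<psi> x) x * tr f x \<partial>\<mu>)"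
    by (subst tr_comp) simp
  also have "\<dots> = (\<integral>\<^sup>+x. w_iter ?m x * (?\<psi> x * f x) \<partial>\<mu>)"
    using harm by (intro nn_integral_cong_AE) (auto elim!: eventually_mono simp: mult.assoc)
  also have "\<dots> = (\<integral>\<^sup>+\<omega>. ?\<psi> (\<omega> ?m) * f (\<omega> ?m) \<partial>N)"
    by (rule nn_integral_N_coord[symmetric]) measurable
  also have "\<dots> = (\<integral>\<^sup>+\<omega>. \<phi> (\<omega> n) * f (\<omega> (n + k)) \<partial>N)"
    using solenoid_iterate[of _ k n] by (intro nn_integral_cong) simp
  finally show ?case using Suc by simp
qed simp

text \<open>Second moments of order 4^-k give first absolute moments of order 2^-k, so the series of
  absolute values has a finite integral.\<close>

lemma AE_summable_of_L2:
  fixes Z :: "nat \<Rightarrow> (nat \<Rightarrow> 'a) \<Rightarrow> real"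
  assumes [measurable]: "\<And>k. Z k \<in> borel_measurable N" and int: "\<And>k. integrable N (\<lambda>\<omega>. (Z k \<omega>)\<^sup>2)"
    and le: "\<And>k. N.expectation (\<lambda>\<omega>. (Z k \<omega>)\<^sup>2) \<le> (1 / 4) ^ k"
  shows "AE \<omega> in N. summable (\<lambda>k. Z k \<omega>)"
proof -
  have bound: "(\<integral>\<^sup>+\<omega>. ennreal \<bar>Z k \<omega>\<bar> \<partial>N) \<le> ennreal ((1 / 2) ^ k)" for k
  proof -
    let ?B = "\<lambda>\<omega>. (2 ^ k * (Z k \<omega>)\<^sup>2 + (1 / 2) ^ k) / 2"
    \<comment> \<open>The arithmetic-geometric mean inequality with weights 2^k and 2^-k; the factor
      2^k is balanced against the decay 4^-k.\<close>
    have "\<bar>z\<bar> \<le> (2 ^ k * z\<^sup>2 + (1 / 2) ^ k) / 2" for z :: real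
    proof -
      have "0 \<le> (2 ^ k * \<bar>z\<bar> - 1)\<^sup>2 * (1 / 2) ^ k" by simp
      also have "\<dots> = 2 ^ k * z\<^sup>2 + (1 / 2) ^ k - 2 * \<bar>z\<bar>"
        by (simp add: power2_eq_square field_simps)
      finally show ?thesis by simp
    qed
    then have "(\<integral>\<^sup>+\<omega>. ennreal \<bar>Z k \<omega>\<bar> \<partial>N) \<le> (\<integral>\<^sup>+\<omega>. ennreal (?B \<omega>) \<partial>N)"
      by (intro nn_integral_mono ennreal_leI)
    also have "\<dots> = ennreal (N.expectation ?B)"
      using int[of k] by (intro nn_integral_eq_integral) auto
    also have "N.expectation ?B = (2 ^ k * N.expectation (\<lambda>\<omega>. (Z k \<omega>)\<^sup>2) + (1 / 2) ^ k) / 2"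
      using int[of k] by (simp add: N.prob_space del: space_N)
    also have "ennreal \<dots> \<le> ennreal ((1 / 2) ^ k)"
    proof (rule ennreal_leI)
      have "2 ^ k * N.expectation (\<lambda>\<omega>. (Z k \<omega>)\<^sup>2) \<le> 2 ^ k * (1 / 4) ^ k"
        using le[of k] by (intro mult_left_mono) auto
      also have "\<dots> = (1 / 2 :: real) ^ k" by (simp flip: power_mult_distrib)
      finally show "(2 ^ k * N.expectation (\<lambda>\<omega>. (Z k \<omega>)\<^sup>2) + (1 / 2) ^ k) / 2 \<le> (1 / 2) ^ k" by simp
    qed
    finally show ?thesis .
  qed
  have "(\<integral>\<^sup>+\<omega>. (\<Sum>k. ennreal \<bar>Z k \<omega>\<bar>) \<partial>N) = (\<Sum>k. \<integral>\<^sup>+\<omega>. ennreal \<bar>Z k \<omega>\<bar> \<partial>N)"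
    by (rule nn_integral_suminf) measurable
  also have "\<dots> \<le> (\<Sum>k. ennreal ((1 / 2) ^ k))"
    using bound by (intro suminf_le) auto
  also have "\<dots> = ennreal (\<Sum>k. (1 / 2) ^ k)"
    by (rule suminf_ennreal2) auto
  also have "\<dots> < \<infinity>" by simp
  finally have "AE \<omega> in N. (\<Sum>k. ennreal \<bar>Z k \<omega>\<bar>) \<noteq> \<infinity>"
    by (intro nn_integral_PInf_AE) auto
  then show ?thesis
  proof eventually_elim
    fix \<omega> assume "(\<Sum>k. ennreal \<bar>Z k \<omega>\<bar>) \<noteq> \<infinity>"
    then have "summable (\<lambda>k. \<bar>Z k \<omega>\<bar>)" by (intro summable_suminf_not_top) auto
    then show "summable (\<lambda>k. Z k \<omega>)" by (rule summable_rabs_cancel)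
  qed
qed

text \<open>Martingale increments are orthogonal, so the second moments \<open>a n\<close> increase,
  are bounded by 1, and measure the L^2 distances. A subsequence then converges almost surely to an
  invariant limit, constant by ergodicity, and the martingale property recovers \<open>f\<close>
  from it.\<close>

lemma ergodic_imp_nn_harmonic_const:
  assumes erg: "ergodic_map N (r_inf r)" shows nn_harmonic_const
  unfolding nn_harmonic_const_def
proof (intro ballI impI)
  fix f :: "'a \<Rightarrow> ennreal" assume [measurable]: "f \<in> borel_measurable borel"
    and le: "\<forall>x. f x \<le> 1" and harm: "AE x in \<mu>. tr f x = f x"
  define u where "u x = enn2real (f x)" for x
  have [measurable]: "u \<in> borel_measurable borel" unfolding u_def[abs_def] by measurable
  have fu: "f x = ennreal (u x)" for x
    using le unfolding u_def by (metis ennreal_enn2real ennreal_one_less_top order.strict_trans1)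
  have u0: "0 \<le> u x" "u x \<le> 1" for x
    using le by (auto simp: u_def intro: enn2real_leI)
  define a where "a n = N.expectation (\<lambda>\<omega>. (u (\<omega> n))\<^sup>2)" for n
  have int2: "integrable N (\<lambda>\<omega>. u (\<omega> n) * u (\<omega> m))" for n m
    using u0 by (intro N.integrable_const_bound[where B = 1]) (auto simp: abs_mult intro!: mult_le_one)
  have mart: "N.expectation (\<lambda>\<omega>. u (\<omega> n) * u (\<omega> (n + k))) = a n" for n k
  proof -
    have *: "(\<integral>\<^sup>+\<omega>. f (\<omega> i) * f (\<omega> j) \<partial>N) = ennreal (N.expectation (\<lambda>\<omega>. u (\<omega> i) * u (\<omega> j)))" for i j
      unfolding fu using u0 by (subst nn_integral_eq_integral[symmetric]) (auto simp: int2 simp flip: ennreal_mult)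
    from martingale[of f f n k, OF _ _ harm]
    have "ennreal (N.expectation (\<lambda>\<omega>. u (\<omega> n) * u (\<omega> (n + k)))) = ennreal (N.expectation (\<lambda>\<omega>. u (\<omega> n) * u (\<omega> n)))"
      unfolding * by simp
    then show ?thesis
      using u0 by (subst (asm) ennreal_inj) (auto simp: a_def power2_eq_square intro!: Bochner_Integration.integral_nonneg)
  qed
  have diff_int: "integrable N (\<lambda>\<omega>. (u (\<omega> m) - u (\<omega> n))\<^sup>2)" for n m
    by (simp add: power2_eq_square algebra_simps int2)
  have diff: "N.expectation (\<lambda>\<omega>. (u (\<omega> m) - u (\<omega> n))\<^sup>2) = a m - a n" if "n \<le> m" for n m
  proof -
    have "N.expectation (\<lambda>\<omega>. (u (\<omega> m) - u (\<omega> n))\<^sup>2) =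
      N.expectation (\<lambda>\<omega>. u (\<omega> m) * u (\<omega> m) - 2 * (u (\<omega> n) * u (\<omega> m)) + u (\<omega> n) * u (\<omega> n))"
      by (simp add: power2_eq_square algebra_simps)
    also have "\<dots> = a m - 2 * a n + a n"
      using mart[of n "m - n"] that int2 by (simp add: a_def power2_eq_square)
    finally show ?thesis by simp
  qed
  have inc: "incseq a"
  proof (rule monoI)
    fix n m :: nat assume nm: "n \<le> m"
    have "0 \<le> N.expectation (\<lambda>\<omega>. (u (\<omega> m) - u (\<omega> n))\<^sup>2)" by (intro Bochner_Integration.integral_nonneg) auto
    with diff[OF nm] show "a n \<le> a m" by simp
  qed
  have "a n \<le> 1" for n
    unfolding a_def using int2[of n n] u0
    by (intro N.integral_le_const) (auto simp: power2_eq_square intro!: mult_le_one)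
  then obtain L where L: "a \<longlonglongrightarrow> L" "\<And>n. a n \<le> L"
    using incseq_convergent[OF inc, of 1] by auto
  have "\<exists>n. \<forall>m\<ge>n. L - a m \<le> (1 / 4) ^ k" for k :: nat
  proof -
    have "eventually (\<lambda>m. a m > L - (1 / 4) ^ k) sequentially"
      using L(1) by (rule order_tendstoD) simp
    then show ?thesis unfolding eventually_sequentially by (metis diff_le_eq add.commute diff_less_eq less_imp_le)
  qed
  then obtain n0 where n0: "\<And>k m. m \<ge> n0 k \<Longrightarrow> L - a m \<le> (1 / 4) ^ k" by metis
  \<comment> \<open>Partial sums of \<open>n0\<close>, not \<open>n0\<close> itself, to obtain a
    monotone sequence that still dominates \<open>n0 k\<close>.\<close>
  define m where "m k = (\<Sum>i\<le>k. n0 i)" for k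
  have m_ge: "n0 k \<le> m k" for k unfolding m_def by (rule member_le_sum) auto
  have m_mono: "m k \<le> m (Suc k)" for k by (simp add: m_def)
  have *: "N.expectation (\<lambda>\<omega>. (u (\<omega> j) - u (\<omega> i))\<^sup>2) \<le> (1 / 4) ^ k" if "m k \<le> i" "i \<le> j" for i j k
    using diff[OF that(2)] n0[of k i] m_ge[of k] that L(2)[of j] by linarith
  \<comment> \<open>The first series telescopes and yields convergence along
    \<open>Suc (m k)\<close>. The second shows that the coordinates \<open>m k\<close> share the
    limit; as \<open>r_inf r \<omega>\<close> has \<open>\<omega> (m k)\<close> at index
    \<open>Suc (m k)\<close>, this gives invariance of the limit.\<close>
  have "AE \<omega> in N. summable (\<lambda>k. u (\<omega> (Suc (m (Suc k)))) - u (\<omega> (Suc (m k))))"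
    using m_mono by (intro AE_summable_of_L2 diff_int * ) auto
  moreover have "AE \<omega> in N. summable (\<lambda>k. u (\<omega> (Suc (m k))) - u (\<omega> (m k)))"
    by (intro AE_summable_of_L2 diff_int * ) auto
  ultimately have conv: "AE \<omega> in N. convergent (\<lambda>k. u (\<omega> (Suc (m k)))) \<and> (\<lambda>k. u (\<omega> (Suc (m k))) - u (\<omega> (m k))) \<longlonglongrightarrow> 0"
  proof eventually_elim
    fix \<omega> assume 1: "summable (\<lambda>k. u (\<omega> (Suc (m (Suc k)))) - u (\<omega> (Suc (m k))))"
      and 2: "summable (\<lambda>k. u (\<omega> (Suc (m k))) - u (\<omega> (m k)))"
    from summable_LIMSEQ[OF 1]
    have "(\<lambda>n. u (\<omega> (Suc (m n))) - u (\<omega> (Suc (m 0)))) \<longlonglongrightarrow> (\<Sum>k. u (\<omega> (Suc (m (Suc k)))) - u (\<omega> (Suc (m k))))"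
      by (simp add: sum_lessThan_telescope[of "\<lambda>k. u (\<omega> (Suc (m k)))"])
    from tendsto_add[OF this tendsto_const[of "u (\<omega> (Suc (m 0)))"]]
    have "convergent (\<lambda>n. u (\<omega> (Suc (m n))))" by (auto simp: convergent_def)
    with summable_LIMSEQ_zero[OF 2]
    show "convergent (\<lambda>k. u (\<omega> (Suc (m k)))) \<and> (\<lambda>k. u (\<omega> (Suc (m k))) - u (\<omega> (m k))) \<longlonglongrightarrow> 0" by simp
  qed
  define \<Phi> where "\<Phi> \<omega> = lim (\<lambda>k. u (\<omega> (Suc (m k))))" for \<omega>
  have [measurable]: "\<Phi> \<in> borel_measurable N" unfolding \<Phi>_def[abs_def] by measurable
  have lim: "AE \<omega> in N. (\<lambda>k. u (\<omega> (Suc (m k)))) \<longlonglongrightarrow> \<Phi> \<omega>"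
    using conv by eventually_elim (simp add: \<Phi>_def convergent_LIMSEQ_iff)
  then have bdd: "AE \<omega> in N. 0 \<le> \<Phi> \<omega> \<and> \<Phi> \<omega> \<le> 1"
    by eventually_elim (use u0 in \<open>auto intro: LIMSEQ_le_const LIMSEQ_le_const2\<close>)
  have "AE \<omega> in N. norm (\<Phi> \<omega>) \<le> 1" using bdd by eventually_elim simp
  then have int: "integrable N \<Phi>" by (intro N.integrable_const_bound[where B = 1]) auto
  from conv lim AE_r_inf[OF lim] have "AE \<omega> in N. \<Phi> (r_inf r \<omega>) = \<Phi> \<omega>"
  proof eventually_elim
    fix \<omega> assume c: "convergent (\<lambda>k. u (\<omega> (Suc (m k)))) \<and> (\<lambda>k. u (\<omega> (Suc (m k))) - u (\<omega> (m k))) \<longlonglongrightarrow> 0"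
      and l: "(\<lambda>k. u (\<omega> (Suc (m k)))) \<longlonglongrightarrow> \<Phi> \<omega>"
      and l': "(\<lambda>k. u (r_inf r \<omega> (Suc (m k)))) \<longlonglongrightarrow> \<Phi> (r_inf r \<omega>)"
    from tendsto_diff[OF l conjunct2[OF c]] have "(\<lambda>k. u (\<omega> (m k))) \<longlonglongrightarrow> \<Phi> \<omega>" by simp
    with l' show "\<Phi> (r_inf r \<omega>) = \<Phi> \<omega>" by (simp add: LIMSEQ_unique)
  qed
  from ergodic_invariant_real[OF erg int this]
  have \<Phi>c: "AE \<omega> in N. \<Phi> \<omega> = N.expectation \<Phi>" .
  define c where "c = N.expectation \<Phi>"
  have "AE x in \<mu>. f x = ennreal c"
  proof (rule mu.density_unique_finite_measure)
    fix B assume "B \<in> sets \<mu>"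
    then have [measurable]: "B \<in> sets borel" by simp
    \<comment> \<open>By the martingale property the left integrals do not depend on k: each is the
      integral of \<open>f\<close> over \<open>B\<close>. The limit therefore identifies
      \<open>f\<close> with c.\<close>
    have "(\<lambda>k. \<integral>\<^sup>+\<omega>. indicator B (\<omega> 0) * f (\<omega> (Suc (m k))) \<partial>N) \<longlonglongrightarrow> (\<integral>\<^sup>+\<omega>. indicator B (\<omega> 0) * ennreal c \<partial>N)"
    proof (rule nn_integral_dominated_convergence[where w = "\<lambda>_. 1"])
      show "AE \<omega> in N. indicator B (\<omega> 0) * f (\<omega> (Suc (m k))) \<le> 1" for k
        using le by (intro AE_I2) (auto split: split_indicator)
      from lim \<Phi>c show "AE \<omega> in N. (\<lambda>k. indicator B (\<omega> 0) * f (\<omega> (Suc (m k)))) \<longlonglongrightarrow> indicator B (\<omega> 0) * ennreal c"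
        unfolding fu by eventually_elim (auto simp: c_def split: split_indicator intro: tendsto_ennrealI)
    qed (auto simp: N.emeasure_space_1 simp del: space_N)
    moreover have "(\<integral>\<^sup>+\<omega>. indicator B (\<omega> 0) * f (\<omega> (Suc (m k))) \<partial>N) = (\<integral>\<^sup>+x. f x * indicator B x \<partial>\<mu>)" for k
      using martingale[of f "indicator B" 0 "Suc (m k)", OF _ _ harm] nn_integral_N_coord0[of "\<lambda>x. indicator B x * f x"]
      by (simp add: mult.commute)
    moreover have "(\<integral>\<^sup>+\<omega>. indicator B (\<omega> 0) * ennreal c \<partial>N) = (\<integral>\<^sup>+x. ennreal c * indicator B x \<partial>\<mu>)"
      using nn_integral_N_coord0[of "\<lambda>x. indicator B x * ennreal c"] by (simp add: mult.commute)
    ultimately show "(\<integral>\<^sup>+x. f x * indicator B x \<partial>\<mu>) = (\<integral>\<^sup>+x. ennreal c * indicator B x \<partial>\<mu>)"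
      by (simp add: LIMSEQ_const_iff)
  qed auto
  then show "\<exists>c. AE x in \<mu>. f x = c" by blast
qed

(* its higher-order pattern unifies with every application and derails the measurability prover below *)
declare coord_measurable [measurable del]

section \<open>Harmonic majorants\<close>

lemma funpow_tr_add: "(tr ^^ n) (\<lambda>x. f x + g x) = (\<lambda>x. (tr ^^ n) f x + (tr ^^ n) g x)"
proof (induction n)
  case (Suc n)
  have "(tr ^^ Suc n) (\<lambda>x. f x + g x) = tr (\<lambda>x. (tr ^^ n) f x + (tr ^^ n) g x)" using Suc by simp
  then show ?case by (simp add: tr_add fun_eq_iff)
qed simp

lemma funpow_tr_mono: "(\<And>x. f x \<le> g x) \<Longrightarrow> (tr ^^ n) f x \<le> (tr ^^ n) g x"
  by (induction n arbitrary: x) (auto intro: tr_mono)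

lemma nn_integral_funpow_tr_one:
  "f \<in> borel_measurable borel \<Longrightarrow> (\<integral>\<^sup>+x. (tr ^^ n) f x \<partial>\<mu>) = (\<integral>\<^sup>+x. w_iter n x * f x \<partial>\<mu>)"
  using nn_integral_funpow_tr[of "\<lambda>_. 1" f n] by simp

text \<open>On a finite fibre \<open>tr\<close> commutes with pointwise limits, and
  \<open>AE_fib\<close> provides convergence on whole fibres; shifting n by one leaves the limit
  unchanged.\<close>

lemma tr_AE_limit:
  assumes lim: "AE x in \<mu>. (\<lambda>n. (tr ^^ n) f x) \<longlonglongrightarrow> g x"
  shows "AE x in \<mu>. tr g x = g x"
  using AE_fib[OF lim] lim
proof eventually_elim
  fix x assume 1: "\<forall>y. r y = x \<longrightarrow> (\<lambda>n. (tr ^^ n) f y) \<longlonglongrightarrow> g y" and 2: "(\<lambda>n. (tr ^^ n) f x) \<longlonglongrightarrow> g x"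
  have "(\<lambda>n. tr ((tr ^^ n) f) x) \<longlonglongrightarrow> tr g x" using 1 by (intro tr_tendsto) auto
  moreover have "(\<lambda>n. tr ((tr ^^ n) f) x) \<longlonglongrightarrow> g x" using LIMSEQ_Suc[OF 2] by simp
  ultimately show "tr g x = g x" by (rule LIMSEQ_unique)
qed

lemma bounded_nn_harmonic_const:
  assumes nn_harmonic_const and [measurable]: "f \<in> borel_measurable borel"
    and le: "\<And>x. f x \<le> ennreal K" and K: "K > 0" and harm: "AE x in \<mu>. tr f x = f x"
  shows "\<exists>c. AE x in \<mu>. f x = c"
proof -
  let ?f = "\<lambda>x. ennreal (1 / K) * f x"
  have "?f x \<le> 1" for x
  proof -
    have "?f x \<le> ennreal (1 / K) * ennreal K" by (intro mult_left_mono le) auto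
    also have "\<dots> = 1" using K by (simp flip: ennreal_mult)
    finally show ?thesis .
  qed
  moreover have "AE x in \<mu>. tr ?f x = ?f x" using harm by eventually_elim (simp add: tr_cmult)
  moreover have "?f \<in> borel_measurable borel" by measurable
  ultimately obtain c where c: "AE x in \<mu>. ?f x = c"
    using assms(1)[unfolded nn_harmonic_const_def, rule_format, of ?f] by metis
  have "AE x in \<mu>. f x = ennreal K * c"
    using c
  proof eventually_elim
    fix x assume "?f x = c"
    then have "ennreal K * c = (ennreal K * ennreal (1 / K)) * f x" by (simp add: mult.assoc)
    also have "ennreal K * ennreal (1 / K) = 1" using K by (simp flip: ennreal_mult)
    finally show "f x = ennreal K * c" by simp
  qed
  then show ?thesis by blast
qed

(* A subharmonic g with uniformly small tails is bounded: its least harmonic majorant k is constant,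
   being the L1-limit of the bounded harmonic functions lim (tr^n) (min k K). *)
lemma subharmonic_bounded:
  assumes const: nn_harmonic_const and [measurable]: "g \<in> borel_measurable borel"
    and sub: "AE x in \<mu>. g x \<le> tr g x"
    and tail: "\<And>n K. (\<integral>\<^sup>+x. w_iter n x * (g x - ennreal (real (Suc K))) \<partial>\<mu>) \<le> \<epsilon> K"
    and eps: "\<epsilon> \<longlonglongrightarrow> 0" and eps_fin: "\<epsilon> 0 < \<top>"
  shows "\<exists>c<\<top>. AE x in \<mu>. g x \<le> c"
proof -
  define G where "G n = (tr ^^ n) g" for n
  have [measurable]: "G n \<in> borel_measurable borel" for n unfolding G_def by measurable
  have "AE x in \<mu>. G n x \<le> G (Suc n) x" for n
  proof (induction n)
    case 0 show ?case using sub by (simp add: G_def)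
  next
    case (Suc n) from tr_AE_mono[OF Suc] show ?case by (simp add: G_def)
  qed
  then have incG: "AE x in \<mu>. incseq (\<lambda>n. G n x)"
    by (simp add: incseq_Suc_iff AE_all_countable)
  define k where "k x = (SUP n. G n x)" for x
  have [measurable]: "k \<in> borel_measurable borel" unfolding k_def[abs_def] by measurable
  have limG: "AE x in \<mu>. (\<lambda>n. G n x) \<longlonglongrightarrow> k x"
    using incG unfolding k_def by eventually_elim (rule LIMSEQ_SUP)
  then have harm_k: "AE x in \<mu>. tr k x = k x"
    unfolding G_def by (rule tr_AE_limit)
  have g_le_k: "g x \<le> k x" for x unfolding k_def by (rule SUP_upper2[of 0]) (auto simp: G_def)
  have iter_k: "AE x in \<mu>. (tr ^^ n) k x = k x" for n
  proof (induction n)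
    case (Suc n)
    from tr_AE_cong[OF Suc] harm_k show ?case by eventually_elim simp
  qed simp

  \<comment> \<open>The tail bound passes from \<open>g\<close> to its majorant \<open>k\<close>:
    since \<open>tr\<close> fixes constants, truncated subtraction gives
    \<open>G m - K \<le> tr^m (g - K)\<close>, and Fatou handles the limit in m. Merging the two
    times into \<open>w_iter (n + m)\<close> is why \<open>tail\<close> must be uniform in
    n.\<close>
  have tail_k: "(\<integral>\<^sup>+x. (tr ^^ n) (\<lambda>x. k x - ennreal (real (Suc K))) x \<partial>\<mu>) \<le> \<epsilon> K" for n K
  proof -
    let ?K = "ennreal (real (Suc K))"
    have G_le: "G m x - ?K \<le> (tr ^^ m) (\<lambda>x. g x - ?K) x" for m x
    proof -
      have "g y \<le> (g y - ?K) + ?K" for y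
        using ennreal_le_add_minus[of "g y" ?K] by (simp add: add.commute)
      then have "G m x \<le> (tr ^^ m) (\<lambda>x. (g x - ?K) + ?K) x"
        unfolding G_def by (intro funpow_tr_mono)
      also have "\<dots> = (tr ^^ m) (\<lambda>x. g x - ?K) x + ?K"
        by (simp add: funpow_tr_add funpow_tr_const)
      finally show ?thesis by (simp add: ennreal_minus_le_iff add.commute)
    qed
    have "(\<integral>\<^sup>+x. (tr ^^ n) (\<lambda>x. k x - ?K) x \<partial>\<mu>) = (\<integral>\<^sup>+x. w_iter n x * (k x - ?K) \<partial>\<mu>)"
      by (rule nn_integral_funpow_tr_one) measurable
    also have "\<dots> \<le> (\<integral>\<^sup>+x. liminf (\<lambda>m. w_iter n x * (tr ^^ m) (\<lambda>x. g x - ?K) x) \<partial>\<mu>)"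
      using limG
    proof (intro nn_integral_mono_AE, eventually_elim)
      fix x assume "(\<lambda>m. G m x) \<longlonglongrightarrow> k x"
      then have "(\<lambda>m. w_iter n x * (G m x - ?K)) \<longlonglongrightarrow> w_iter n x * (k x - ?K)"
        by (intro ennreal_tendsto_cmult tendsto_diff_ennreal_general tendsto_const) (auto simp: w_iter_eq)
      then have "w_iter n x * (k x - ?K) = liminf (\<lambda>m. w_iter n x * (G m x - ?K))"
        by (intro lim_imp_Liminf[symmetric]) auto
      also have "\<dots> \<le> liminf (\<lambda>m. w_iter n x * (tr ^^ m) (\<lambda>x. g x - ?K) x)"
        by (intro Liminf_mono always_eventually allI mult_left_mono G_le) simp
      finally show "w_iter n x * (k x - ?K) \<le> liminf (\<lambda>m. w_iter n x * (tr ^^ m) (\<lambda>x. g x - ?K) x)" .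
    qed
    also have "\<dots> \<le> liminf (\<lambda>m. \<integral>\<^sup>+x. w_iter n x * (tr ^^ m) (\<lambda>x. g x - ?K) x \<partial>\<mu>)"
      by (rule nn_integral_liminf) measurable
    also have "\<dots> \<le> liminf (\<lambda>m. \<epsilon> K)"
    proof (intro Liminf_mono always_eventually allI)
      fix m
      have "(\<integral>\<^sup>+x. w_iter n x * (tr ^^ m) (\<lambda>x. g x - ?K) x \<partial>\<mu>) = (\<integral>\<^sup>+x. (tr ^^ n) ((tr ^^ m) (\<lambda>x. g x - ?K)) x \<partial>\<mu>)"
        by (rule nn_integral_funpow_tr_one[symmetric]) measurable
      also have "\<dots> = (\<integral>\<^sup>+x. (tr ^^ (n + m)) (\<lambda>x. g x - ?K) x \<partial>\<mu>)" by (simp add: funpow_add)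
      also have "\<dots> = (\<integral>\<^sup>+x. w_iter (n + m) x * (g x - ?K) \<partial>\<mu>)"
        by (rule nn_integral_funpow_tr_one) measurable
      also have "\<dots> \<le> \<epsilon> K" by (rule tail)
      finally show "(\<integral>\<^sup>+x. w_iter n x * (tr ^^ m) (\<lambda>x. g x - ?K) x \<partial>\<mu>) \<le> \<epsilon> K" .
    qed
    finally show ?thesis by (simp add: Liminf_const)
  qed

  \<comment> \<open>The minimum of \<open>k\<close> and the level is superharmonic, so its iterates
    decrease to a bounded harmonic function, a constant c. The mass of \<open>k\<close> that c
    misses is at most the tail.\<close>
  have "\<exists>c\<le>ennreal (real (Suc K)). (AE x in \<mu>. c \<le> k x) \<and> (\<integral>\<^sup>+x. k x \<partial>\<mu>) \<le> c + \<epsilon> K" for K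
  proof -
    let ?K = "ennreal (real (Suc K))"
    define v where "v n = (tr ^^ n) (\<lambda>x. min (k x) ?K)" for n
    have [measurable]: "v n \<in> borel_measurable borel" for n unfolding v_def by measurable
    have v_le: "v n x \<le> ?K" for n x
      using funpow_tr_mono[of "\<lambda>x. min (k x) ?K" "\<lambda>_. ?K" n x] by (simp add: v_def funpow_tr_const)
    have "AE x in \<mu>. v (Suc n) x \<le> v n x" for n
    proof (induction n)
      case 0
      from harm_k show ?case
      proof eventually_elim
        fix x assume "tr k x = k x"
        then have "tr (\<lambda>x. min (k x) ?K) x \<le> k x" using tr_mono[of x "\<lambda>x. min (k x) ?K" k] by simp
        moreover have "tr (\<lambda>x. min (k x) ?K) x \<le> ?K" using v_le[of 1 x] by (simp add: v_def)
        ultimately show "v (Suc 0) x \<le> v 0 x" by (simp add: v_def)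
      qed
    next
      case (Suc n) from tr_AE_mono[OF Suc] show ?case by (simp add: v_def)
    qed
    then have decv: "AE x in \<mu>. decseq (\<lambda>n. v n x)" by (simp add: decseq_Suc_iff AE_all_countable)
    define W where "W x = (INF n. v n x)" for x
    have [measurable]: "W \<in> borel_measurable borel" unfolding W_def[abs_def] by measurable
    have limv: "AE x in \<mu>. (\<lambda>n. v n x) \<longlonglongrightarrow> W x"
      using decv unfolding W_def by eventually_elim (rule LIMSEQ_INF)
    have W_le: "W x \<le> v 0 x" for x unfolding W_def by (rule INF_lower) simp
    have "AE x in \<mu>. tr W x = W x" using limv unfolding v_def by (rule tr_AE_limit)
    then obtain c where c: "AE x in \<mu>. W x = c"
      using bounded_nn_harmonic_const[OF const, of W "real (Suc K)"] order_trans[OF W_le v_le] by auto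
    have intW: "(\<integral>\<^sup>+x. W x \<partial>\<mu>) = c"
      using nn_integral_cong_AE[OF c] by simp
    have "(\<lambda>n. \<integral>\<^sup>+x. v n x \<partial>\<mu>) \<longlonglongrightarrow> (\<integral>\<^sup>+x. W x \<partial>\<mu>)"
      using v_le limv by (intro nn_integral_dominated_convergence[where w = "\<lambda>_. ?K"]) auto
    \<comment> \<open>Harmonicity gives \<open>k = tr^n k\<close>; splitting \<open>k\<close> at the
      level bounds it by \<open>v n\<close> plus an iterated tail, whose integral is small uniformly
      in n.\<close>
    moreover have "(\<integral>\<^sup>+x. k x \<partial>\<mu>) \<le> (\<integral>\<^sup>+x. v n x \<partial>\<mu>) + \<epsilon> K" for n
    proof -
      have "k x \<le> min (k x) ?K + (k x - ?K)" for x
        by (cases "k x \<le> ?K") (auto simp: min_def intro: add_increasing2 ennreal_le_add_minus)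
      then have "(tr ^^ n) k x \<le> (tr ^^ n) (\<lambda>x. min (k x) ?K + (k x - ?K)) x" for x
        by (intro funpow_tr_mono)
      then have "AE x in \<mu>. k x \<le> v n x + (tr ^^ n) (\<lambda>x. k x - ?K) x"
        using iter_k[of n] by (auto simp: v_def funpow_tr_add elim!: eventually_mono) metis
      then have "(\<integral>\<^sup>+x. k x \<partial>\<mu>) \<le> (\<integral>\<^sup>+x. v n x + (tr ^^ n) (\<lambda>x. k x - ?K) x \<partial>\<mu>)"
        by (rule nn_integral_mono_AE)
      also have "\<dots> = (\<integral>\<^sup>+x. v n x \<partial>\<mu>) + (\<integral>\<^sup>+x. (tr ^^ n) (\<lambda>x. k x - ?K) x \<partial>\<mu>)"
        by (rule nn_integral_add) measurable
      finally show ?thesis using tail_k[of n K] by (meson add_left_mono order_trans)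
    qed
    ultimately have "(\<integral>\<^sup>+x. k x \<partial>\<mu>) \<le> c + \<epsilon> K"
      unfolding intW by (intro LIMSEQ_le_const[OF tendsto_add[OF _ tendsto_const]]) auto
    moreover have "AE x in \<mu>. c \<le> k x"
      using c by eventually_elim (metis W_le min.boundedE v_def funpow_0)
    moreover have "c \<le> ?K"
    proof -
      have "(\<integral>\<^sup>+x. W x \<partial>\<mu>) \<le> (\<integral>\<^sup>+x. ?K \<partial>\<mu>)" by (intro nn_integral_mono order_trans[OF W_le v_le])
      then show ?thesis by (simp add: intW)
    qed
    ultimately show ?thesis by blast
  qed
  then obtain c where c: "\<And>K. c K \<le> ennreal (real (Suc K))" "\<And>K. AE x in \<mu>. c K \<le> k x"
    "\<And>K. (\<integral>\<^sup>+x. k x \<partial>\<mu>) \<le> c K + \<epsilon> K" by metis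
  \<comment> \<open>The supremum of the lower bounds is still below \<open>k\<close>, while letting
    K grow shows that the integral of \<open>k\<close> is at most d. With d finite, this forces
    \<open>k = d\<close> almost everywhere.\<close>
  define d where "d = (SUP K. c K)"
  have d_le: "AE x in \<mu>. d \<le> k x"
    using c(2) unfolding d_def by (simp add: SUP_le_iff AE_all_countable)
  have "(\<integral>\<^sup>+x. k x \<partial>\<mu>) \<le> d + \<epsilon> K" for K
    by (rule order_trans[OF c(3)]) (auto simp: d_def intro!: add_right_mono SUP_upper)
  then have k_le: "(\<integral>\<^sup>+x. k x \<partial>\<mu>) \<le> d"
    using LIMSEQ_le_const[OF tendsto_add[OF tendsto_const eps], of "\<integral>\<^sup>+x. k x \<partial>\<mu>" d] by auto
  have "(\<integral>\<^sup>+x. k x \<partial>\<mu>) < \<top>"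
    using c(1)[of 0] c(3)[of 0] eps_fin by (metis ennreal_add_less_top ennreal_less_top le_less_trans)
  moreover have "d \<le> (\<integral>\<^sup>+x. k x \<partial>\<mu>)"
    using nn_integral_mono_AE[OF d_le] by simp
  ultimately have d_fin: "d < \<top>" by (rule le_less_trans[rotated])
  have "AE x in \<mu>. k x \<le> d"
  proof (rule ccontr)
    assume "\<not> (AE x in \<mu>. k x \<le> d)"
    then have "(\<integral>\<^sup>+x. d \<partial>\<mu>) < (\<integral>\<^sup>+x. k x \<partial>\<mu>)"
      using d_le d_fin by (intro nn_integral_less) auto
    with k_le show False by simp
  qed
  then have "AE x in \<mu>. g x \<le> d" by eventually_elim (use g_le_k order_trans in blast)
  with d_fin show ?thesis by blast
qed

section \<open>Harmonic functions with uniformly bounded p-th moments\<close>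

definition Lp_harmonic_const :: bool where
  "Lp_harmonic_const \<longleftrightarrow> \<not> (\<exists>p::real. \<exists>h. p > 1 \<and> h \<in> borel_measurable \<mu>
             \<and> integrable \<mu> (\<lambda>x. cmod (h x) powr p)
             \<and> \<not> (\<exists>c. AE x in \<mu>. h x = c)
             \<and> (AE x in \<mu>. transfer_op r m0 h x = h x)
             \<and> (\<exists>B::real. \<forall>n. (\<integral>\<^sup>+x. ennreal ((cmod (m0_iter r m0 n x))\<^sup>2 * cmod (h x) powr p) \<partial>\<mu>) \<le> ennreal B))"

text \<open>The moment condition bounds the p-th moment of \<open>h (\<omega> n)\<close> uniformly
  in n, so the tails of the subharmonic modulus of \<open>h\<close> are uniformly small. Then
  \<open>h\<close> is essentially bounded and the bounded case applies.\<close>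

lemma bounded_harmonic_const_imp_Lp:
  assumes bounded_harmonic_const shows Lp_harmonic_const
proof -
  have nn: nn_harmonic_const using assms by (simp add: bounded_harmonic_const_iff)
  have "\<exists>c. AE x in \<mu>. h x = c"
    if p: "p > 1" and "h \<in> borel_measurable \<mu>" and harm: "AE x in \<mu>. transfer_op r m0 h x = h x"
      and B: "\<And>n. (\<integral>\<^sup>+x. ennreal ((cmod (m0_iter r m0 n x))\<^sup>2 * cmod (h x) powr p) \<partial>\<mu>) \<le> ennreal B"
    for p :: real and h B
  proof -
    have [measurable]: "h \<in> borel_measurable borel" using that by simp
    define g where "g x = ennreal (cmod (h x))" for x
    define \<epsilon> where "\<epsilon> K = ennreal B * ennreal (real (Suc K) powr (1 - p))" for K
    have g_tr: "AE x in \<mu>. g x \<le> tr g x"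
      using harm
    proof eventually_elim
      fix x assume "transfer_op r m0 h x = h x"
      then have "cmod (h x) = cmod (\<Sum>y\<in>fib r x. of_real (Wt r m0 y) * h y)" by (simp add: transfer_op_eq)
      also have "\<dots> \<le> (\<Sum>y\<in>fib r x. cmod (of_real (Wt r m0 y) * h y))" by (rule norm_sum)
      also have "\<dots> = trR (\<lambda>y. cmod (h y)) x" by (simp add: trR_def norm_mult)
      finally show "g x \<le> tr g x" by (simp add: g_def[abs_def] tr_ennreal ennreal_leI)
    qed
    have "\<exists>c<\<top>. AE x in \<mu>. g x \<le> c"
    proof (rule subharmonic_bounded[OF nn _ g_tr])
      show "g \<in> borel_measurable borel" unfolding g_def[abs_def] by measurable
      show "\<epsilon> 0 < \<top>" by (simp add: \<epsilon>_def ennreal_mult_less_top)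
      have "(\<lambda>K. real (Suc K) powr (1 - p)) \<longlonglongrightarrow> 0"
      proof (rule tendsto_neg_powr)
        show "1 - p < 0" using p by simp
        show "filterlim (\<lambda>K. real (Suc K)) at_top sequentially"
          by (rule filterlim_compose[OF filterlim_real_sequentially filterlim_Suc])
      qed
      then have "(\<lambda>K. ennreal (real (Suc K) powr (1 - p))) \<longlonglongrightarrow> ennreal 0" by (rule tendsto_ennrealI)
      then have "\<epsilon> \<longlonglongrightarrow> ennreal B * ennreal 0" unfolding \<epsilon>_def[abs_def] by (intro ennreal_tendsto_cmult) auto
      then show "\<epsilon> \<longlonglongrightarrow> 0" by simp
      fix n K
      \<comment> \<open>For t above K = \<open>Suc K\<close>, t^(1-p) is at most K^(1-p), so t
        itself is at most t^p K^(1-p). The negative exponent 1 - p makes the tails tend to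
        0.\<close>
      have tail_le: "t - real (Suc K) \<le> t powr p * real (Suc K) powr (1 - p)" if t: "t \<ge> 0" for t :: real
      proof (cases "t \<le> real (Suc K)")
        case True
        then have "t - real (Suc K) \<le> 0" by simp
        also have "0 \<le> t powr p * real (Suc K) powr (1 - p)" by simp
        finally show ?thesis .
      next
        case False
        then have "t powr (1 - p) \<le> real (Suc K) powr (1 - p)" using p by (intro powr_mono2') auto
        then have "t powr p * t powr (1 - p) \<le> t powr p * real (Suc K) powr (1 - p)"
          by (intro mult_left_mono) auto
        moreover have "t powr p * t powr (1 - p) = t" using False by (simp flip: powr_add)
        ultimately show ?thesis by linarith
      qed
      have le: "g x - ennreal (real (Suc K)) \<le> ennreal (cmod (h x) powr p) * ennreal (real (Suc K) powr (1 - p))" for x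
      proof -
        have "g x - ennreal (real (Suc K)) = ennreal (cmod (h x) - real (Suc K))"
          unfolding g_def by (rule ennreal_minus) simp
        also have "\<dots> \<le> ennreal (cmod (h x) powr p * real (Suc K) powr (1 - p))"
          by (intro ennreal_leI tail_le) simp
        also have "\<dots> = ennreal (cmod (h x) powr p) * ennreal (real (Suc K) powr (1 - p))"
          by (rule ennreal_mult) auto
        finally show ?thesis .
      qed
      have "(\<integral>\<^sup>+x. w_iter n x * (g x - ennreal (real (Suc K))) \<partial>\<mu>) \<le>
          (\<integral>\<^sup>+x. w_iter n x * (ennreal (cmod (h x) powr p) * ennreal (real (Suc K) powr (1 - p))) \<partial>\<mu>)"
        by (intro nn_integral_mono mult_left_mono le) simp
      also have "\<dots> = (\<integral>\<^sup>+x. ennreal ((cmod (m0_iter r m0 n x))\<^sup>2 * cmod (h x) powr p) * ennreal (real (Suc K) powr (1 - p)) \<partial>\<mu>)"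
        by (simp add: w_iter_eq ennreal_mult mult.assoc)
      also have "\<dots> = (\<integral>\<^sup>+x. ennreal ((cmod (m0_iter r m0 n x))\<^sup>2 * cmod (h x) powr p) \<partial>\<mu>) * ennreal (real (Suc K) powr (1 - p))"
      proof (rule nn_integral_multc)
        have "(\<lambda>x. w_iter n x * ennreal (cmod (h x) powr p)) \<in> borel_measurable \<mu>" by measurable
        then show "(\<lambda>x. ennreal ((cmod (m0_iter r m0 n x))\<^sup>2 * cmod (h x) powr p)) \<in> borel_measurable \<mu>"
          by (simp add: w_iter_eq ennreal_mult)
      qed
      also have "\<dots> \<le> \<epsilon> K" unfolding \<epsilon>_def by (intro mult_right_mono B) simp
      finally show "(\<integral>\<^sup>+x. w_iter n x * (g x - ennreal (real (Suc K))) \<partial>\<mu>) \<le> \<epsilon> K" .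
    qed
    then obtain c where c: "c < \<top>" and g_le: "AE x in \<mu>. g x \<le> c" by blast
    from g_le have "AE x in \<mu>. cmod (h x) \<le> enn2real c"
    proof eventually_elim
      fix x assume "g x \<le> c"
      then have "ennreal (cmod (h x)) \<le> ennreal (enn2real c)" using c by (simp add: g_def)
      then show "cmod (h x) \<le> enn2real c" by (simp add: ennreal_le_iff)
    qed
    then have "ess_bounded \<mu> h" by (auto simp: ess_bounded_def)
    with harm assms show ?thesis unfolding bounded_harmonic_const_def by blast
  qed
  then show ?thesis unfolding Lp_harmonic_const_def by blast
qed

text \<open>A non-constant bounded fixed point violates the L^p condition already with p = 2:
  \<open>w_iter n\<close> has integral 1, so the weighted second moments never exceed the square of
  the bound.\<close>

lemma Lp_imp_bounded_harmonic_const: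
  assumes Lp_harmonic_const shows bounded_harmonic_const
  unfolding bounded_harmonic_const_def
proof (intro allI impI, elim conjE, rule ccontr)
  fix h assume bd: "ess_bounded \<mu> h" and harm: "AE x in \<mu>. transfer_op r m0 h x = h x"
    and nc: "\<nexists>c. AE x in \<mu>. h x = c"
  from bd obtain B where [measurable]: "h \<in> borel_measurable borel" and B: "AE x in \<mu>. cmod (h x) \<le> B"
    by (auto simp: ess_bounded_def)
  have le: "AE x in \<mu>. cmod (h x) powr 2 \<le> B\<^sup>2"
    using B by eventually_elim (simp add: power_mono)
  have int: "integrable \<mu> (\<lambda>x. cmod (h x) powr 2)"
    using le by (intro mu.integrable_const_bound[where B = "B\<^sup>2"]) auto
  have bound: "(\<integral>\<^sup>+x. ennreal ((cmod (m0_iter r m0 n x))\<^sup>2 * cmod (h x) powr 2) \<partial>\<mu>) \<le> ennreal (B\<^sup>2)" for n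
  proof -
    have "(\<integral>\<^sup>+x. ennreal ((cmod (m0_iter r m0 n x))\<^sup>2 * cmod (h x) powr 2) \<partial>\<mu>) \<le> (\<integral>\<^sup>+x. ennreal (B\<^sup>2) * w_iter n x \<partial>\<mu>)"
      using le
    proof (intro nn_integral_mono_AE, eventually_elim)
      fix x assume "cmod (h x) powr 2 \<le> B\<^sup>2"
      then have "(cmod (m0_iter r m0 n x))\<^sup>2 * cmod (h x) powr 2 \<le> (cmod (m0_iter r m0 n x))\<^sup>2 * B\<^sup>2"
        by (rule mult_left_mono) simp
      then show "ennreal ((cmod (m0_iter r m0 n x))\<^sup>2 * cmod (h x) powr 2) \<le> ennreal (B\<^sup>2) * w_iter n x"
        by (simp add: w_iter_eq ennreal_leI mult.commute flip: ennreal_mult)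
    qed
    also have "\<dots> = ennreal (B\<^sup>2) * (\<integral>\<^sup>+x. w_iter n x \<partial>\<mu>)" by (rule nn_integral_cmult) simp
    also have "(\<integral>\<^sup>+x. w_iter n x \<partial>\<mu>) = 1"
      using nn_integral_funpow_tr_one[of "\<lambda>_. 1" n] by (simp add: funpow_tr_const)
    finally show ?thesis by simp
  qed
  have "\<not> Lp_harmonic_const"
    unfolding Lp_harmonic_const_def not_not
  proof (rule exI[of _ "2 :: real"], rule exI[of _ h], intro conjI)
    show "\<exists>B'::real. \<forall>n. (\<integral>\<^sup>+x. ennreal ((cmod (m0_iter r m0 n x))\<^sup>2 * cmod (h x) powr 2) \<partial>\<mu>) \<le> ennreal B'"
      using bound by blast
  qed (use int nc harm in simp_all)
  with assms show False by contradiction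
qed

end

theorem theorem2p5:
  fixes r :: "'a::metric_space \<Rightarrow> 'a" and \<mu> :: "'a measure" and m0 :: "'a \<Rightarrow> complex"
  assumes "compact (UNIV :: 'a set)"
    and "r \<in> borel_measurable borel"
    and "\<forall>x. finite (fib r x) \<and> fib r x \<noteq> {}"
    and "prob_space \<mu>" and "sets \<mu> = sets borel"
    and "strongly_invariant r \<mu>"
    and "ess_bounded \<mu> m0"
    and "\<forall>x. (\<Sum>y\<in>fib r x. (cmod (m0 y))\<^sup>2) / real (card (fib r x)) = 1"
    and "emeasure \<mu> {x. m0 x = 0} = 0"
  shows
    "(wavelet_irreducible r \<mu> m0 \<longleftrightarrow> ergodic_map (mu_inf r \<mu> m0) (r_inf r))
   \<and> (ergodic_map (mu_inf r \<mu> m0) (r_inf r) \<longleftrightarrow>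
        (\<forall>h. ess_bounded \<mu> h \<and> (AE x in \<mu>. transfer_op r m0 h x = h x)
             \<longrightarrow> (\<exists>c. AE x in \<mu>. h x = c)))
   \<and> ((\<forall>h. ess_bounded \<mu> h \<and> (AE x in \<mu>. transfer_op r m0 h x = h x)
             \<longrightarrow> (\<exists>c. AE x in \<mu>. h x = c)) \<longleftrightarrow>
        \<not> (\<exists>p::real. \<exists>h. p > 1 \<and> h \<in> borel_measurable \<mu>
             \<and> integrable \<mu> (\<lambda>x. cmod (h x) powr p)
             \<and> \<not> (\<exists>c. AE x in \<mu>. h x = c)
             \<and> (AE x in \<mu>. transfer_op r m0 h x = h x)
             \<and> (\<exists>B::real. \<forall>n. (\<integral>\<^sup>+x. ennreal ((cmod (m0_iter r m0 n x))\<^sup>2 * cmod (h x) powr p) \<partial>\<mu>) \<le> ennreal B)))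
   \<and> ((\<not> (\<exists>p::real. \<exists>h. p > 1 \<and> h \<in> borel_measurable \<mu>
             \<and> integrable \<mu> (\<lambda>x. cmod (h x) powr p)
             \<and> \<not> (\<exists>c. AE x in \<mu>. h x = c)
             \<and> (AE x in \<mu>. transfer_op r m0 h x = h x)
             \<and> (\<exists>B::real. \<forall>n. (\<integral>\<^sup>+x. ennreal ((cmod (m0_iter r m0 n x))\<^sup>2 * cmod (h x) powr p) \<partial>\<mu>) \<le> ennreal B)))
        \<longleftrightarrow>
        (\<forall>\<phi>'\<in>L2 (mu_inf r \<mu> m0).
            (AE \<omega> in mu_inf r \<mu> m0. Uop r m0 \<phi>' \<omega> = piop m0 \<phi>' \<omega>)
            \<longrightarrow> (\<exists>c. AE \<omega> in mu_inf r \<mu> m0. \<phi>' \<omega> = c * 1)))"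
proof -
  interpret wavelet_setup r \<mu> m0 using assms by (rule wavelet_setup.intro)
  have i_ii: "wavelet_irreducible r \<mu> m0 \<longleftrightarrow> ergodic_map (mu_inf r \<mu> m0) (r_inf r)"
    by (rule irreducible_iff_ergodic)
  have ii_iii: "ergodic_map (mu_inf r \<mu> m0) (r_inf r) \<longleftrightarrow> bounded_harmonic_const"
    using nn_harmonic_const_imp_ergodic ergodic_imp_nn_harmonic_const bounded_harmonic_const_iff by blast
  have iii_iv: "bounded_harmonic_const \<longleftrightarrow> Lp_harmonic_const"
    using bounded_harmonic_const_imp_Lp Lp_imp_bounded_harmonic_const by blast
  have iv_v: "Lp_harmonic_const \<longleftrightarrow> fixed_vectors_const"
    using ii_iii iii_iv ergodic_iff_fixed_vectors_const by blast
  from i_ii ii_iii iii_iv iv_v show ?thesis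
    unfolding bounded_harmonic_const_def Lp_harmonic_const_def fixed_vectors_const_def by (intro conjI)
qed

end
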